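(* Let $d\ge 1$ and let $g^{ij}$ be a symmetric $d\times d$ matrix of polynomials on $\mathbb{C}^d$, each of degree at most $2$, regarded as a symmetric contravariant $2$-tensor (cometric). Let $D=\det(g^{ij})$ and suppose that $\deg D=2d$, that $D$ has no multiple components (i.e. $D$ is square-free), and that for every $i$ the polynomial $\sum_j g^{ij}\,\partial_j D$ is divisible by $D$. Then $g$ is a direct sum of metrics $g_t$ each satisfying $\mathrm{Ric}(g_t)=\lambda_t g_t$ for some constant $\lambda_t$ (the constants $\lambda_t$ may differ for different $t$).
   Context: Where $D\neq 0$, the inverse matrix $g_{ij}=(g^{ij})^{-1}$ is a non-degenerate holomorphic (complex Riemannian) metric; $\mathrm{Ric}$ denotes its Ricci tensor, defined by the usual formulas from the Levi-Civita connection. "Direct sum" means: after a linear change of coordinates on $\mathbb{C}^d$ the coordinates are partitioned into groups so that the matrix $g^{ij}$ is block diagonal with respect to this partition, and the entries of the block $g_t^{ij}$ depend only on the coordinates of the $t$-th group; $g_t$ is then the metric on the corresponding coordinate subspace whose cometric is that block. *)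

theory Defs
  imports
    "HOL-Analysis.Analysis"
    "HOL-Computational_Algebra.Squarefree"
    "HOL-Library.Poly_Mapping"
    "HOL-Library.Disjoint_Sets"
begin

text \<open>
  Polynomials on \<open>\<complex>\<^sup>d\<close> are formal: finitely supported maps from exponent vectors to
  coefficients. The dimension \<open>d\<close> is the cardinality of the index type \<open>'n\<close>.
\<close>

type_synonym 'n cpoly = "('n \<Rightarrow>\<^sub>0 nat) \<Rightarrow>\<^sub>0 complex"

text \<open>The zero polynomial gets degree 0.\<close>

definition total_degree :: "('n::finite) cpoly \<Rightarrow> nat" where
  "total_degree p = Max (insert 0 ((\<lambda>m. \<Sum>i\<in>UNIV. Poly_Mapping.lookup m i) ` Poly_Mapping.keys p))"

text \<open>The truncated subtraction of exponents is harmless: where it truncates, the factor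
  \<open>Poly_Mapping.lookup m i\<close> vanishes.\<close>

definition partial_poly :: "'n \<Rightarrow> ('n::finite) cpoly \<Rightarrow> 'n cpoly" where
  "partial_poly i p =
     (\<Sum>m\<in>Poly_Mapping.keys p. Poly_Mapping.single (m - Poly_Mapping.single i 1)
                     (of_nat (Poly_Mapping.lookup m i) * Poly_Mapping.lookup p m))"

definition eval_poly :: "('n::finite) cpoly \<Rightarrow> complex ^ 'n \<Rightarrow> complex" where
  "eval_poly p x = (\<Sum>m\<in>Poly_Mapping.keys p. Poly_Mapping.lookup p m * (\<Prod>i\<in>UNIV. (x $ i) ^ Poly_Mapping.lookup m i))"

definition eval_mat :: "('n::finite) cpoly ^ 'n ^ 'n \<Rightarrow> complex ^ 'n \<Rightarrow> complex ^ 'n ^ 'n" where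
  "eval_mat g x = (\<chi> i j. eval_poly (g $ i $ j) x)"

text \<open>The contravariant tensor \<open>G\<close> in the coordinates \<open>y = A x\<close>.\<close>

definition change_coords ::
    "complex ^ 'n ^ 'n \<Rightarrow> (complex ^ 'n \<Rightarrow> complex ^ 'n ^ 'n) \<Rightarrow> complex ^ ('n::finite) \<Rightarrow> complex ^ 'n ^ 'n"
  where "change_coords A G y = A ** G (matrix_inv A *v y) ** transpose A"

definition direct_sum_wrt ::
    "'n set set \<Rightarrow> (complex ^ 'n \<Rightarrow> complex ^ 'n ^ ('n::finite)) \<Rightarrow> bool"
  where "direct_sum_wrt P G \<longleftrightarrow>
    partition_on UNIV P \<and>
    (\<forall>I\<in>P. \<forall>i\<in>I. \<forall>j. j \<notin> I \<longrightarrow> (\<forall>x. G x $ i $ j = 0)) \<and>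
    (\<forall>I\<in>P. \<forall>i\<in>I. \<forall>j\<in>I. \<forall>x y. (\<forall>k\<in>I. x $ k = y $ k) \<longrightarrow> G x $ i $ j = G y $ i $ j)"

definition coord_subspace :: "'n set \<Rightarrow> (complex ^ 'n) set" where
  "coord_subspace I = {x. \<forall>k. k \<notin> I \<longrightarrow> x $ k = 0}"

text \<open>
  The \<open>I \<times> I\<close> block of a matrix, completed by the identity outside \<open>I\<close> so that it is again
  indexed by \<open>'n\<close>. It is invertible iff the block is, and the entries of its inverse with
  indices in \<open>I\<close> form the inverse of the block. The completion has no other use: every
  index below ranges over \<open>I\<close>.
\<close>

definition block :: "'n set \<Rightarrow> complex ^ 'n ^ 'n \<Rightarrow> complex ^ 'n ^ ('n::finite)" where
  "block I M = (\<chi> i j. if i \<in> I \<and> j \<in> I then M $ i $ j else if i = j then 1 else 0)"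

definition cpartial :: "'n \<Rightarrow> (complex ^ 'n \<Rightarrow> complex) \<Rightarrow> complex ^ ('n::finite) \<Rightarrow> complex" where
  "cpartial k f x = deriv (\<lambda>z. f (x + z *s axis k 1)) 0"

text \<open>
  In the following, \<open>G\<close> is a cometric and \<open>I\<close> the set of indices of the coordinates on
  the coordinate subspace carrying the metric; \<open>metric_of I G x $ i $ j\<close> is \<open>g\<^sub>i\<^sub>j\<close> and
  \<open>christoffel I G k i j\<close> is \<open>\<Gamma>\<^sup>k\<^sub>i\<^sub>j\<close>.
\<close>

definition metric_of ::
    "'n set \<Rightarrow> (complex ^ 'n \<Rightarrow> complex ^ 'n ^ 'n) \<Rightarrow> complex ^ 'n \<Rightarrow> complex ^ 'n ^ ('n::finite)"
  where "metric_of I G x = matrix_inv (block I (G x))"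

definition christoffel ::
    "'n set \<Rightarrow> (complex ^ 'n \<Rightarrow> complex ^ 'n ^ 'n) \<Rightarrow> 'n \<Rightarrow> 'n \<Rightarrow> 'n \<Rightarrow> complex ^ ('n::finite) \<Rightarrow> complex"
  where "christoffel I G k i j x =
    (1/2) * (\<Sum>l\<in>I. G x $ k $ l *
       (cpartial i (\<lambda>y. metric_of I G y $ j $ l) x
      + cpartial j (\<lambda>y. metric_of I G y $ i $ l) x
      - cpartial l (\<lambda>y. metric_of I G y $ i $ j) x))"

definition ricci ::
    "'n set \<Rightarrow> (complex ^ 'n \<Rightarrow> complex ^ 'n ^ 'n) \<Rightarrow> 'n \<Rightarrow> 'n \<Rightarrow> complex ^ ('n::finite) \<Rightarrow> complex"
  where "ricci I G i j x =
    (\<Sum>k\<in>I. cpartial k (christoffel I G k i j) x - cpartial j (christoffel I G k i k) x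
       + (\<Sum>l\<in>I. christoffel I G k k l x * christoffel I G l i j x
                - christoffel I G k j l x * christoffel I G l i k x))"

definition einstein_metric ::
    "'n set \<Rightarrow> (complex ^ 'n \<Rightarrow> complex ^ 'n ^ ('n::finite)) \<Rightarrow> complex \<Rightarrow> bool"
  where "einstein_metric I G c \<longleftrightarrow>
    (\<forall>x\<in>coord_subspace I. det (block I (G x)) \<noteq> 0 \<longrightarrow>
       (\<forall>i\<in>I. \<forall>j\<in>I. ricci I G i j x = c * metric_of I G x $ i $ j))"

end

theory Submission
  imports Defs
    "HOL-Computational_Algebra.Field_as_Ring"
    "HOL-Computational_Algebra.Fundamental_Theorem_Algebra"
    "HOL-Computational_Algebra.Polynomial_Factorial"
    "HOL-Computational_Algebra.Polynomial_FPS"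
begin

text \<open>
  Write \<open>G\<close> for the cometric, \<open>D\<close> for its determinant, \<open>d\<close> for the gradient of \<open>D\<close> and \<open>n\<close> for
  the dimension. The divisibility hypothesis says \<open>G d = D L\<close> for a polynomial vector field \<open>L\<close>.

  Everything rests on one rigidity principle (\<open>rigid\<close>). Let \<open>f\<close> be a rational function whose
  only poles are on \<open>D = 0\<close>. Since \<open>D\<close> is square-free, it has only simple zeros on a generic line
  through a generic point, and since \<open>deg D = 2n\<close> is as large as it can be, it grows there like
  \<open>t ^ (2n)\<close>. If \<open>f\<close> is bounded along these lines both near the zeros of \<open>D\<close> and at infinity, then it
  is constant on each of them by Liouville's theorem, hence constant. If it decays, it vanishes;
  if it grows linearly, it is affine. The entries of the metric \<open>G\<inverse>\<close> decay like \<open>t ^ (-2)\<close>, so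
  only the behaviour near \<open>D = 0\<close> is ever in doubt.

  At a point of \<open>D = 0\<close> where \<open>d\<close> does not vanish, the kernel of \<open>G\<close> is the line spanned by \<open>d\<close>, the
  function \<open>E = L \<cdot> d\<close> is nonzero, and \<open>G\<inverse>\<close> is \<open>d d\<^sup>T / (D E)\<close> up to a bounded term
  (\<open>boundary_kernel\<close>, \<open>m_r\<close>). The metric looks like \<open>dx\<^sup>2 / x\<close>, which is smooth and even in
  \<open>\<surd>x\<close>; so its curvature should stay bounded. This is made explicit without leaving the given
  coordinates: the raised Christoffel symbols are bounded, hence affine, and in a suitable formula
  for the Ricci tensor with one raised index (\<open>raised_ricci\<close>) the remaining poles cancel. It
  is therefore a constant matrix \<open>R\<close> (\<open>ricci_endomorphism_const\<close>), and \<open>R G = G R\<^sup>T\<close>.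

  This relation makes the gradient \<open>d\<close> an eigenvector of \<open>R\<^sup>T\<close> at each such boundary point. The
  boundary gradients span the dual space: a vector \<open>u\<close> annihilated by all of them would make
  \<open>G\<inverse> u\<close> bounded and decaying, hence zero. So \<open>R\<close> is diagonal in linear coordinates whose
  differentials are boundary gradients, and \<open>G\<close> is block diagonal for the partition of the
  coordinates by eigenvalue. The derivative of a block with respect to a coordinate of another
  block, multiplied by \<open>G\<inverse>\<close>, is again bounded and decaying, hence zero
  (\<open>decoupled_independent\<close>): the blocks depend only on their own coordinates. The Ricci tensor of a
  block is the corresponding block of the whole Ricci tensor, which is the eigenvalue times the
  metric.

  The existence of good lines is algebra (\<open>squarefree_generic_line\<close>). If \<open>D\<close> had a multiple zero on
  every line, then \<open>D\<close> and its Euler derivative would have a common factor on every line, and these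
  factors fit together to a polynomial \<open>p\<close> that divides \<open>D\<close>. In the same way \<open>p\<close> and \<open>D / p\<close> turn out
  to have a common factor, whose square divides \<open>D\<close>.
\<close>

no_notation fps_nth (infixl \<open>$\<close> 75)

abbreviation "lookup \<equiv> Poly_Mapping.lookup"
abbreviation "keys \<equiv> Poly_Mapping.keys"

section \<open>Substitution into multivariate polynomials\<close>

definition ring_hom :: "('a::comm_ring_1 \<Rightarrow> 'b::comm_ring_1) \<Rightarrow> bool" where
  "ring_hom h \<longleftrightarrow> h 1 = 1 \<and> (\<forall>a b. h (a + b) = h a + h b) \<and> (\<forall>a b. h (a * b) = h a * h b)"

lemma ring_hom_simps:
  assumes "ring_hom h"
  shows "h 0 = 0" "h 1 = 1" "h (a + b) = h a + h b" "h (a * b) = h a * h b"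
    "h (a ^ n) = h a ^ n" "h (\<Sum>i\<in>A. f i) = (\<Sum>i\<in>A. h (f i))" "h (\<Prod>i\<in>A. f i) = (\<Prod>i\<in>A. h (f i))"
    "h (- a) = - h a" "h (a - b) = h a - h b"
proof -
  have add: "h (a + b) = h a + h b" for a b using assms by (auto simp: ring_hom_def)
  have mult: "h (a * b) = h a * h b" for a b using assms by (auto simp: ring_hom_def)
  show one: "h 1 = 1" using assms by (auto simp: ring_hom_def)
  show zero: "h 0 = 0" using add[of 0 0] by simp
  show "h (a + b) = h a + h b" "h (a * b) = h a * h b" by fact+
  show "h (a ^ n) = h a ^ n" by (induction n) (auto simp: one mult)
  show "h (\<Sum>i\<in>A. f i) = (\<Sum>i\<in>A. h (f i))" by (induction A rule: infinite_finite_induct) (auto simp: zero add)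
  show "h (\<Prod>i\<in>A. f i) = (\<Prod>i\<in>A. h (f i))" by (induction A rule: infinite_finite_induct) (auto simp: one mult)
  show minus: "h (- a) = - h a" for a using add[of a "-a"] zero by (metis add.right_inverse minus_unique)
  show "h (a - b) = h a - h b" using add[of a "-b"] minus[of b] by simp
qed

lemma ring_hom_poly: "ring_hom (\<lambda>p. poly p (a::'a::comm_ring_1))"
  by (simp add: ring_hom_def)

lemma ring_hom_map_poly:
  assumes "ring_hom h"
  shows "ring_hom (map_poly h)"
proof -
  note s = ring_hom_simps[OF assms]
  show ?thesis unfolding ring_hom_def
    by (auto simp: s coeff_map_poly coeff_mult intro!: poly_eqI)
qed

text \<open>
  All passages between polynomial rings below (evaluation, restriction to a line, translation) are
  instances of this one, with \<open>\<iota>\<close> the embedding of the scalars.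
\<close>

definition substitute :: "(complex \<Rightarrow> 'b) \<Rightarrow> ('n \<Rightarrow> 'b) \<Rightarrow> ('n::finite) cpoly \<Rightarrow> 'b::comm_ring_1" where
  "substitute \<iota> \<phi> F = (\<Sum>m\<in>keys F. \<iota> (lookup F m) * (\<Prod>i\<in>UNIV. \<phi> i ^ lookup m i))"

lemma substitute_superset:
  assumes "\<iota> 0 = 0" "finite K" "keys F \<subseteq> K"
  shows "substitute \<iota> \<phi> F = (\<Sum>m\<in>K. \<iota> (lookup F m) * (\<Prod>i\<in>UNIV. \<phi> i ^ lookup m i))"
  unfolding substitute_def using assms
  by (intro sum.mono_neutral_left) (auto simp: in_keys_iff)

lemma substitute_single:
  assumes "\<iota> 0 = 0"
  shows "substitute \<iota> \<phi> (Poly_Mapping.single m c) = \<iota> c * (\<Prod>i\<in>UNIV. \<phi> i ^ lookup m i)"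
  by (subst substitute_superset[where K="{m}"]) (auto simp: assms)

lemma cpoly_sum_single: "F = (\<Sum>m\<in>keys F. Poly_Mapping.single m (lookup F m))"
proof (rule poly_mapping_eqI)
  fix k
  have "lookup (\<Sum>m\<in>keys F. Poly_Mapping.single m (lookup F m)) k
     = (\<Sum>m\<in>keys F. if m = k then lookup F m else 0)"
    by (simp add: lookup_sum lookup_single when_def)
  also have "\<dots> = lookup F k" by (auto simp: in_keys_iff)
  finally show "lookup F k = lookup (\<Sum>m\<in>keys F. Poly_Mapping.single m (lookup F m)) k" ..
qed

lemma substitute_hom:
  assumes \<iota>: "ring_hom \<iota>"
  shows "ring_hom (substitute \<iota> \<phi>)"
proof -
  note s = ring_hom_simps[OF \<iota>]
  have add: "substitute \<iota> \<phi> (F + G) = substitute \<iota> \<phi> F + substitute \<iota> \<phi> G" for F G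
  proof -
    let ?K = "keys F \<union> keys G"
    have "substitute \<iota> \<phi> F = (\<Sum>m\<in>?K. \<iota> (lookup F m) * (\<Prod>i\<in>UNIV. \<phi> i ^ lookup m i))"
      by (rule substitute_superset) (auto simp: s)
    moreover have "substitute \<iota> \<phi> G = (\<Sum>m\<in>?K. \<iota> (lookup G m) * (\<Prod>i\<in>UNIV. \<phi> i ^ lookup m i))"
      by (rule substitute_superset) (auto simp: s)
    moreover have "substitute \<iota> \<phi> (F+G) = (\<Sum>m\<in>?K. \<iota> (lookup (F+G) m) * (\<Prod>i\<in>UNIV. \<phi> i ^ lookup m i))"
      by (rule substitute_superset) (use keys_add[of F G] in \<open>auto simp: s\<close>)
    ultimately show ?thesis by (simp add: lookup_add s distrib_right sum.distrib)
  qed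
  have zero: "substitute \<iota> \<phi> 0 = 0" by (simp add: substitute_def)
  have sum: "substitute \<iota> \<phi> (\<Sum>i\<in>A. f i) = (\<Sum>i\<in>A. substitute \<iota> \<phi> (f i))" for A and f :: "'c \<Rightarrow> _"
    by (induction A rule: infinite_finite_induct) (auto simp: zero add)
  have mult: "substitute \<iota> \<phi> (F * G) = substitute \<iota> \<phi> F * substitute \<iota> \<phi> G" for F G
  proof -
    have "F * G = (\<Sum>m\<in>keys F. \<Sum>n\<in>keys G.
        Poly_Mapping.single (m + n) (lookup F m * lookup G n))"
      by (subst cpoly_sum_single[of F], subst cpoly_sum_single[of G]) (simp add: sum_product mult_single)
    then have "substitute \<iota> \<phi> (F * G) = (\<Sum>m\<in>keys F. \<Sum>n\<in>keys G.
        (\<iota> (lookup F m) * (\<Prod>i\<in>UNIV. \<phi> i ^ lookup m i)) *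
        (\<iota> (lookup G n) * (\<Prod>i\<in>UNIV. \<phi> i ^ lookup n i)))"
      by (simp add: sum substitute_single s lookup_add power_add prod.distrib mult_ac)
    then show ?thesis by (simp add: substitute_def sum_product)
  qed
  have one: "substitute \<iota> \<phi> 1 = 1"
    using substitute_single[of \<iota> \<phi> 0 1] by (simp add: s)
  show ?thesis using add mult one by (simp add: ring_hom_def)
qed

lemma hom_substitute:
  assumes "ring_hom h"
  shows "h (substitute \<iota> \<phi> F) = substitute (\<lambda>c. h (\<iota> c)) (\<lambda>i. h (\<phi> i)) F"
  by (simp add: substitute_def ring_hom_simps[OF assms])

lemma ring_hom_const_poly: "ring_hom h \<Longrightarrow> ring_hom (\<lambda>c. [:h c:])"
  by (auto simp: ring_hom_def one_pCons)

lemma ring_hom_single: "ring_hom (Poly_Mapping.single (0::'n \<Rightarrow>\<^sub>0 nat) :: complex \<Rightarrow> ('n::finite) cpoly)"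
  by (auto simp: ring_hom_def single_add mult_single)

lemma ring_hom_id: "ring_hom (\<lambda>c. c)"
  by (auto simp: ring_hom_def)

lemma eval_poly_substitute: "eval_poly F x = substitute (\<lambda>c. c) (\<lambda>i. x $ i) F"
  by (simp add: eval_poly_def substitute_def)

lemma eval_hom: "ring_hom (\<lambda>F. eval_poly F x)"
  unfolding eval_poly_substitute by (rule substitute_hom[OF ring_hom_id])

definition "indet i = Poly_Mapping.single (Poly_Mapping.single i 1) (1::complex)"
definition "cst c = (Poly_Mapping.single 0 c :: ('n::finite) cpoly)"

lemma ring_hom_cst: "ring_hom cst"
  unfolding cst_def by (rule ring_hom_single)

lemma eval_indet [simp]: "eval_poly (indet i) x = x $ i"
  unfolding eval_poly_substitute indet_def
proof (subst substitute_single)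
  have "(\<Prod>j\<in>UNIV. x $ j ^ lookup (Poly_Mapping.single i (1::nat)) j) = (\<Prod>j\<in>UNIV. if j = i then x $ j else 1)"
    by (rule prod.cong) (auto simp: lookup_single when_def)
  then show "1 * (\<Prod>j\<in>UNIV. x $ j ^ lookup (Poly_Mapping.single i (1::nat)) j) = x $ i" by simp
qed simp

lemma eval_cst [simp]: "eval_poly (cst c) x = c"
  unfolding eval_poly_substitute cst_def by (subst substitute_single) auto

lemma eval_zero [simp]: "eval_poly 0 x = 0" and eval_one [simp]: "eval_poly 1 x = 1"
  and eval_add [simp]: "eval_poly (F + G) x = eval_poly F x + eval_poly G x"
  and eval_mult [simp]: "eval_poly (F * G) x = eval_poly F x * eval_poly G x"
  and eval_power [simp]: "eval_poly (F ^ n) x = eval_poly F x ^ n"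
  and eval_minus [simp]: "eval_poly (F - G) x = eval_poly F x - eval_poly G x"
  using ring_hom_simps[OF eval_hom[of x]] by auto

lemma eval_sum: "eval_poly (\<Sum>i\<in>A. f i) x = (\<Sum>i\<in>A. eval_poly (f i) x)"
  using ring_hom_simps(6)[OF eval_hom[of x]] .

text \<open>
  The polynomial \<open>F (t v)\<close> in \<open>t\<close>, with coefficients in the polynomials in \<open>v\<close>: its \<open>k\<close>-th
  coefficient is the homogeneous component of \<open>F\<close> of degree \<open>k\<close>. In contrast, \<open>along x v F\<close> is
  \<open>F (x + t v)\<close> for fixed \<open>x\<close> and \<open>v\<close>.
\<close>

definition line :: "('n::finite) cpoly \<Rightarrow> 'n cpoly poly" where
  "line = substitute (\<lambda>c. [:cst c:]) (\<lambda>i. monom (indet i) 1)"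

definition along :: "complex ^ 'n \<Rightarrow> complex ^ 'n \<Rightarrow> ('n::finite) cpoly \<Rightarrow> complex poly" where
  "along x v = substitute (\<lambda>c. [:c:]) (\<lambda>i. [:x $ i, v $ i:])"

definition shift :: "complex ^ 'n \<Rightarrow> ('n::finite) cpoly \<Rightarrow> 'n cpoly" where
  "shift a = substitute cst (\<lambda>i. indet i + cst (a $ i))"

lemma along_hom: "ring_hom (along x v)"
  unfolding along_def by (intro substitute_hom ring_hom_const_poly ring_hom_id)

lemma shift_hom: "ring_hom (shift a)"
  unfolding shift_def by (intro substitute_hom ring_hom_cst)

lemma poly_along: "poly (along x v F) t = eval_poly F (x + t *s v)"
  unfolding along_def eval_poly_substitute by (subst hom_substitute[OF ring_hom_poly]) (simp add: substitute_def mult_ac)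

lemma eval_shift: "eval_poly (shift a F) x = eval_poly F (a + x)"
  unfolding shift_def by (subst hom_substitute[OF eval_hom]) (simp add: substitute_def eval_poly_def[of F] add_ac)

lemma map_line: "map_poly (\<lambda>F. eval_poly F v) (line F) = along 0 v F"
  unfolding line_def along_def
proof (subst hom_substitute[OF ring_hom_map_poly[OF eval_hom]])
  have 1: "map_poly (\<lambda>F. eval_poly F v) [:cst c:] = [:c:]" for c
    by (rule poly_eqI) (simp add: coeff_map_poly coeff_pCons split: nat.split)
  have 2: "map_poly (\<lambda>F. eval_poly F v) (monom (indet i) 1) = [:0 $ i, v $ i:]" for i
    by (rule poly_eqI) (simp add: coeff_map_poly coeff_pCons coeff_monom split: nat.split)
  show "substitute (\<lambda>c. map_poly (\<lambda>F. eval_poly F v) [:cst c:]) (\<lambda>i. map_poly (\<lambda>F. eval_poly F v) (monom (indet i) 1)) F =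
    substitute (\<lambda>c. [:c:]) (\<lambda>i. [:0 $ i, v $ i:]) F"
    unfolding 1 2 ..
qed

lemma poly_eqI_fun: "(\<And>t. poly p t = poly q t) \<Longrightarrow> p = (q :: complex poly)"
  by (metis poly_eq_poly_eq_iff ext)

lemma along_shift: "along x v (shift a F) = along (a + x) v F"
  by (rule poly_eqI_fun) (simp add: poly_along eval_shift add_ac)

text \<open>
  Induction on the set of variables: for fixed values of the others, a polynomial in the new
  variable \<open>v\<close> vanishes identically, so the coefficient of each of its powers vanishes.
\<close>

lemma vanishing_sum_coeffs:
  fixes c :: "('n \<Rightarrow>\<^sub>0 nat) \<Rightarrow> complex"
  assumes "finite V" "finite K"
    and "\<And>m m'. m \<in> K \<Longrightarrow> m' \<in> K \<Longrightarrow> (\<And>i. i \<in> V \<Longrightarrow> lookup m i = lookup m' i) \<Longrightarrow> m = m'"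
    and "\<And>x::'n \<Rightarrow> complex. (\<Sum>m\<in>K. c m * (\<Prod>i\<in>V. x i ^ lookup m i)) = 0"
  shows "\<forall>m\<in>K. c m = 0"
  using assms
proof (induction V arbitrary: K rule: finite_induct)
  case empty
  show ?case
  proof
    fix m assume m: "m \<in> K"
    have "K = {m}" using empty(2) m by (metis empty_iff insertI1 subsetI subset_antisym singletonD)
    with empty(3) show "c m = 0" by simp
  qed
next
  case (insert v V)
  show ?case
  proof
    fix m0 assume m0: "m0 \<in> K"
    let ?K = "{m\<in>K. lookup m v = lookup m0 v}"
    have "\<forall>m\<in>?K. c m = 0"
    proof (rule insert.IH)
      show "finite ?K" using insert.prems by simp
      show "m = m'" if "m \<in> ?K" "m' \<in> ?K" "\<And>i. i \<in> V \<Longrightarrow> lookup m i = lookup m' i" for m m'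
        using that by (intro insert.prems(2)) auto
      fix x :: "'n \<Rightarrow> complex"
      define p where "p = (\<Sum>m\<in>K. monom (c m * (\<Prod>i\<in>V. x i ^ lookup m i)) (lookup m v))"
      have "poly p t = 0" for t
      proof -
        have "(\<Sum>m\<in>K. c m * (\<Prod>i\<in>insert v V. (x(v := t)) i ^ lookup m i)) = 0"
          using insert.prems(3) .
        moreover have "(\<Prod>i\<in>insert v V. (x(v := t)) i ^ lookup m i) = t ^ lookup m v * (\<Prod>i\<in>V. x i ^ lookup m i)" for m
        proof -
          have "(\<Prod>i\<in>V. (x(v := t)) i ^ lookup m i) = (\<Prod>i\<in>V. x i ^ lookup m i)"
            by (rule prod.cong) (use insert in auto)
          then show ?thesis using insert by simp
        qed
        ultimately show ?thesis by (simp add: p_def poly_sum poly_monom mult_ac)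
      qed
      then have "p = 0" by (metis poly_all_0_iff_0)
      then have "coeff p (lookup m0 v) = 0" by simp
      then show "(\<Sum>m\<in>?K. c m * (\<Prod>i\<in>V. x i ^ lookup m i)) = 0"
        unfolding p_def coeff_sum coeff_monom using insert.prems(1)
        by (simp add: sum.If_cases Int_def conj_commute)
    qed
    then show "c m0 = 0" using m0 by auto
  qed
qed

lemma eval_eq_0_imp: "(\<And>x. eval_poly F x = 0) \<Longrightarrow> F = 0"
proof -
  assume a: "\<And>x. eval_poly F x = 0"
  have "\<forall>m\<in>keys F. lookup F m = 0"
  proof (rule vanishing_sum_coeffs[of "UNIV :: 'a set"])
    fix x :: "'a \<Rightarrow> complex"
    show "(\<Sum>m\<in>keys F. lookup F m * (\<Prod>i\<in>UNIV. x i ^ lookup m i)) = 0"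
      using a[of "\<chi> i. x i"] by (simp add: eval_poly_def)
  qed (auto intro: poly_mapping_eqI)
  then show "F = 0" by (auto simp: in_keys_iff intro!: poly_mapping_eqI)
qed

lemma eval_eqI: "(\<And>x. eval_poly F x = eval_poly G x) \<Longrightarrow> F = G"
  using eval_eq_0_imp[of "F - G"] by simp

lemma cpoly_mult_neq_0:
  assumes "F \<noteq> 0" "G \<noteq> (0::('n::finite) cpoly)" shows "F * G \<noteq> 0"
proof -
  obtain x where x: "eval_poly F x \<noteq> 0" using eval_eq_0_imp assms by blast
  obtain y where y: "eval_poly G y \<noteq> 0" using eval_eq_0_imp assms by blast
  have "along x (y - x) F \<noteq> 0"
    using poly_along[of x "y-x" F 0] x by auto
  moreover have "along x (y - x) G \<noteq> 0"
    using poly_along[of x "y-x" G 1] y by auto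
  ultimately have "along x (y-x) (F * G) \<noteq> 0"
    by (simp add: ring_hom_simps[OF along_hom])
  then show ?thesis using ring_hom_simps(1)[OF along_hom] by metis
qed

text \<open>
  Here and below, a property holds generically if it holds wherever some nonzero polynomial \<open>c\<close>
  does not vanish.
\<close>

lemma generic_eqI:
  assumes "c \<noteq> 0" "\<And>x. eval_poly c x \<noteq> 0 \<Longrightarrow> eval_poly F x = eval_poly G x"
  shows "F = (G::('n::finite) cpoly)"
proof (rule ccontr)
  assume "F \<noteq> G"
  then have "c * (F - G) \<noteq> 0" using cpoly_mult_neq_0[OF assms(1), of "F - G"] by auto
  moreover have "c * (F - G) = 0"
    by (rule eval_eq_0_imp) (use assms(2) in auto)
  ultimately show False by simp
qed

section \<open>Square-free polynomials on generic lines\<close>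

lemma poly_map_poly_hom:
  assumes "ring_hom h"
  shows "poly (map_poly h p) (h y) = h (poly p y)"
  by (induction p) (auto simp: map_poly_pCons ring_hom_simps[OF assms])

abbreviation ev :: "complex ^ 'n \<Rightarrow> ('n::finite) cpoly poly \<Rightarrow> complex poly" where
  "ev v \<equiv> map_poly (\<lambda>F. eval_poly F v)"

lemma ev_hom: "ring_hom (ev v)" by (rule ring_hom_map_poly[OF eval_hom])

lemma ev_line: "ev v (line F) = along 0 v F" by (rule map_line)

lemma coeff_ev: "coeff (ev v P) k = eval_poly (coeff P k) v" by (simp add: coeff_map_poly)

lemma ev_smult: "ev v (Polynomial.smult a P) = Polynomial.smult (eval_poly a v) (ev v P)"
  by (rule poly_eqI) (simp add: coeff_map_poly)

lemma coeff_line_0: "coeff (line F) 0 = cst (eval_poly F 0)"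
proof (rule eval_eqI)
  fix x
  have "eval_poly (coeff (line F) 0) x = poly (along 0 x F) 0"
    by (simp add: poly_0_coeff_0 flip: ev_line coeff_ev)
  then show "eval_poly (coeff (line F) 0) x = eval_poly (cst (eval_poly F 0)) x"
    by (simp add: poly_along)
qed

lemma poly_ev_1: "poly (ev v P) 1 = eval_poly (poly P 1) v"
  using poly_map_poly_hom[OF eval_hom, of v P 1] by simp

lemma poly_line_1: "poly (line F) 1 = F"
  by (rule eval_eqI) (simp add: ev_line poly_along flip: poly_ev_1)

lemma shift_shift: "shift (- a) (shift a F) = F"
  by (rule eval_eqI) (simp add: eval_shift)

text \<open>
  Divisibility can be tested on the lines through a point \<open>a0\<close> where \<open>b\<close> does not vanish. After a
  translation \<open>a0 = 0\<close>. The quotient of \<open>a (t v)\<close> by \<open>b (t v)\<close> exists as a power series in \<open>t\<close> because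
  the constant term of \<open>b (t v)\<close> is a nonzero scalar, and its coefficients are polynomials in \<open>v\<close>. On a
  generic line the quotient is a polynomial of degree at most that of \<open>a\<close>, so the higher
  coefficients vanish generically and hence identically; put \<open>t = 1\<close>.
\<close>

lemma line_test:
  assumes b0: "eval_poly b a0 \<noteq> 0" and c: "c \<noteq> (0::('n::finite) cpoly)"
    and d: "\<And>v. eval_poly c v \<noteq> 0 \<Longrightarrow> along a0 v b dvd along a0 v a"
  shows "b dvd a"
proof -
  define a' where "a' = shift a0 a"
  define b' where "b' = shift a0 b"
  define \<kappa> where "\<kappa> = eval_poly b a0"
  have \<kappa>: "\<kappa> \<noteq> 0" "eval_poly b' 0 = \<kappa>" using b0 by (auto simp: \<kappa>_def b'_def eval_shift)
  \<comment> \<open>\<open>J\<close> is the inverse power series of \<open>b\<close>, with coefficients polynomial in the direction.\<close>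
  define B where "B = fps_of_poly (line b')"
  define J where "J = fps_right_inverse B (cst (1 / \<kappa>))"
  have BJ: "B * J = 1" unfolding J_def
  proof (rule fps_right_inverse)
    have "cst \<kappa> * cst (1 / \<kappa>) = (cst (\<kappa> * (1/\<kappa>)) :: 'n cpoly)"
      by (rule eval_eqI) simp
    then show "fps_nth B 0 * cst (1 / \<kappa>) = 1"
      using \<kappa> by (simp add: B_def coeff_line_0 ring_hom_simps[OF ring_hom_cst])
  qed
  define q where "q = fps_of_poly (line a') * J"
  have Bq: "B * q = fps_of_poly (line a')"
    using BJ by (simp add: q_def mult.left_commute[of B])
  define N where "N = degree (line a')"
  have qn: "fps_nth q n = 0" if "n > N" for n
  proof (rule generic_eqI[OF c])
    fix v assume v: "eval_poly c v \<noteq> 0"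
    have "along 0 v b' dvd along 0 v a'"
      using d[OF v] by (simp add: a'_def b'_def along_shift)
    then obtain r where r: "along 0 v a' = along 0 v b' * r" by (elim dvdE)
    define Q where "Q = Abs_fps (\<lambda>n. eval_poly (fps_nth q n) v)"
    have "fps_of_poly (along 0 v b') * Q = fps_of_poly (along 0 v a')"
    proof (rule fps_ext)
      fix n
      have "eval_poly (fps_nth (B * q) n) v = eval_poly (coeff (line a') n) v"
        unfolding Bq by simp
      then show "fps_nth (fps_of_poly (along 0 v b') * Q) n = fps_nth (fps_of_poly (along 0 v a')) n"
        by (simp add: fps_mult_nth B_def Q_def eval_sum flip: ev_line coeff_ev)
    qed
    then have "fps_of_poly (along 0 v b') * Q = fps_of_poly (along 0 v b') * fps_of_poly r"
      by (simp add: r fps_of_poly_mult)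
    moreover have "along 0 v b' \<noteq> 0"
      using poly_along[of 0 v b' 0] \<kappa> by auto
    ultimately have Qr: "Q = fps_of_poly r" by simp
    have "degree r \<le> N"
    proof (cases "r = 0")
      case False
      have "degree r \<le> degree (along 0 v a')"
        using False r \<open>along 0 v b' \<noteq> 0\<close> by (simp add: degree_mult_eq)
      also have "\<dots> \<le> N" unfolding N_def by (metis map_poly_degree_leq ev_line)
      finally show ?thesis .
    qed auto
    then have "fps_nth Q n = 0" using that by (simp add: Qr coeff_eq_0)
    then show "eval_poly (fps_nth q n) v = eval_poly 0 v" by (simp add: Q_def)
  qed
  define qq where "qq = (\<Sum>n\<le>N. monom (fps_nth q n) n)"
  have "fps_of_poly qq = q"
    by (rule fps_ext) (use qn in \<open>auto simp: qq_def coeff_sum coeff_monom\<close>)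
  then have "fps_of_poly (line b' * qq) = fps_of_poly (line a')"
    using Bq by (simp add: B_def fps_of_poly_mult)
  then have "line b' * qq = line a'" by simp
  then have "poly (line b') 1 * poly qq 1 = poly (line a') 1" by (metis poly_mult)
  then have "a' = b' * poly qq 1" by (simp add: poly_line_1)
  then have "shift (-a0) a' = shift (-a0) b' * shift (-a0) (poly qq 1)"
    by (simp add: ring_hom_simps[OF shift_hom])
  then show ?thesis by (simp add: a'_def b'_def shift_shift)
qed

text \<open>
  Since \<open>coeff f 0\<close> is a unit, \<open>f\<close> is primitive, and by Gauss's lemma the primitive part of \<open>h\<close> divides
  \<open>f\<close> up to a unit. Hence its constant coefficient is a unit, so \<open>coeff h 0\<close> is the content of \<open>h\<close>
  up to a unit.
\<close>

lemma complex_poly_gauss: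
  fixes h q f :: "complex poly poly"
  assumes eq: "Polynomial.smult e f = h * q" and e: "e \<noteq> 0" and f0: "is_unit (coeff f 0)"
  shows "coeff h 0 dvd coeff h k"
proof -
  have "content f dvd 1" using f0 content_dvd_coeff dvd_trans by blast
  then have cf: "content f = 1" by simp
  have "primitive_part h * primitive_part q = primitive_part (Polynomial.smult e f)"
    by (simp add: eq primitive_part_mult)
  also have "\<dots> = Polynomial.smult (unit_factor e) f"
    by (simp add: primitive_part_smult primitive_part_prim[OF cf])
  finally have "coeff (primitive_part h * primitive_part q) 0 = coeff (Polynomial.smult (unit_factor e) f) 0" by simp
  then have "coeff (primitive_part h) 0 * coeff (primitive_part q) 0 = unit_factor e * coeff f 0"
    by (simp add: coeff_mult)
  moreover have "is_unit (unit_factor e * coeff f 0)" using f0 e by (metis is_unit_mult_iff unit_factor_is_unit)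
  ultimately have u: "is_unit (coeff (primitive_part h) 0)" by (metis dvd_mult_left)
  have "coeff h 0 = content h * coeff (primitive_part h) 0"
    by (metis coeff_smult content_times_primitive_part)
  moreover have "content h dvd coeff h k" by simp
  ultimately show ?thesis using u by (simp add: mult_unit_dvd_iff)
qed

lemma generic_line:
  assumes "c \<noteq> (0::('n::finite) cpoly)"
  obtains v where "eval_poly c v \<noteq> 0"
  using assms eval_eq_0_imp by blast

text \<open>
  A greatest common divisor on the generic line through the origin, spread out over all lines. Among
  the elements of the ideal generated by \<open>F1 (t v)\<close> and \<open>F2 (t v)\<close> take a nonzero \<open>h\<close> of least degree
  in \<open>t\<close>; by pseudo-division it divides both generators up to powers of its leading
  coefficient \<open>c\<close>. If it has degree 0, then \<open>F1\<close> and \<open>F2\<close> are coprime on each line where \<open>c\<close> is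
  nonzero. Otherwise \<open>complex_poly_gauss\<close> on planes together with \<open>line_test\<close> shows that the constant
  coefficient of \<open>h\<close> divides the others. Dividing by it gives \<open>P\<close> with constant coefficient 1, and
  on a generic line \<open>P\<close> is the greatest common divisor normalised at \<open>t = 0\<close>. Replacing
  \<open>v\<close> by \<open>s v\<close> amounts to replacing \<open>t\<close> by \<open>s t\<close>, so by uniqueness \<open>P\<close> has the form \<open>p (t v)\<close>, and by \<open>line_test\<close> the polynomial \<open>p\<close> divides \<open>F1\<close> and \<open>F2\<close>.
\<close>

lemma common_factor_dichotomy:
  fixes F1 F2 :: "('n::finite) cpoly"
  assumes F1: "eval_poly F1 0 \<noteq> 0"
  obtains (coprime) c where "c \<noteq> 0"
      "\<And>v. eval_poly c v \<noteq> 0 \<Longrightarrow> coprime (along 0 v F1) (along 0 v F2)"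
    | (common) c p where "c \<noteq> 0" "\<And>v. eval_poly c v \<noteq> 0 \<Longrightarrow> degree (along 0 v p) > 0"
      "p dvd F1" "p dvd F2"
proof -
  define f1 f2 where "f1 = line F1" and "f2 = line F2"
  define J where "J = {A * f1 + B * f2 | A B. True}"
  have J_lin: "a * x + b * y \<in> J" if x: "x \<in> J" and y: "y \<in> J" for a b x y
  proof -
    obtain A B where "x = A * f1 + B * f2" using x by (auto simp: J_def)
    moreover obtain A' B' where "y = A' * f1 + B' * f2" using y by (auto simp: J_def)
    ultimately have "a * x + b * y = (a * A + b * A') * f1 + (a * B + b * B') * f2"
      by (simp add: algebra_simps)
    then show ?thesis unfolding J_def by blast
  qed
  have f1J: "f1 \<in> J" unfolding J_def by (rule CollectI, rule exI[of _ 1], rule exI[of _ 0]) simp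
  have f2J: "f2 \<in> J" unfolding J_def by (rule CollectI, rule exI[of _ 0], rule exI[of _ 1]) simp
  have "f1 \<noteq> 0"
    using coeff_line_0[of F1] F1 by (metis coeff_0 eval_cst eval_zero f1_def)
  then have "\<exists>h. h \<in> J \<and> h \<noteq> 0" using f1J by blast
  then obtain h where hJ: "h \<in> J" "h \<noteq> 0" and hmin: "\<And>g. g \<in> J \<Longrightarrow> g \<noteq> 0 \<Longrightarrow> degree h \<le> degree g"
    using ex_has_least_nat[of "\<lambda>h. h \<in> J \<and> h \<noteq> 0" _ degree] by blast
  define c where "c = lead_coeff h"
  have c: "c \<noteq> 0" using hJ by (simp add: c_def)
  have div: "\<exists>N q. Polynomial.smult (c ^ N) f = h * q" if f: "f \<in> J" for f
  proof -
    obtain q r where qr: "pseudo_divmod f h = (q, r)" by fastforce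
    define N where "N = Suc (degree f) - degree h"
    from pseudo_divmod[OF hJ(2) qr] have 1: "Polynomial.smult (c ^ N) f = h * q + r"
      and 2: "r = 0 \<or> degree r < degree h" by (auto simp: c_def N_def)
    have "r = [:c ^ N:] * f + (- q) * h" using 1 by (simp add: algebra_simps)
    then have "r \<in> J" using J_lin f hJ by blast
    then have "r = 0" using hmin 2 by fastforce
    then show ?thesis using 1 by auto
  qed
  obtain N1 q1 where q1: "Polynomial.smult (c ^ N1) f1 = h * q1" using div f1J by blast
  obtain N2 q2 where q2: "Polynomial.smult (c ^ N2) f2 = h * q2" using div f2J by blast
  obtain A B where AB: "h = A * f1 + B * f2" using hJ by (auto simp: J_def)
  define h0 where "h0 = coeff h 0"
  have "coeff (Polynomial.smult (c ^ N1) f1) 0 = h0 * coeff q1 0"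
    unfolding q1 h0_def by (simp add: coeff_mult)
  then have h0': "c ^ N1 * cst (eval_poly F1 0) = h0 * coeff q1 0"
    by (simp add: f1_def coeff_line_0)
  have h0: "eval_poly h0 v \<noteq> 0" if "eval_poly c v \<noteq> 0" for v
  proof
    assume "eval_poly h0 v = 0"
    then have "eval_poly (c ^ N1 * cst (eval_poly F1 0)) v = 0" unfolding h0' by simp
    then show False using that F1 by simp
  qed
  have evh: "ev v h = ev v A * along 0 v F1 + ev v B * along 0 v F2" for v
    unfolding AB by (simp add: ring_hom_simps[OF ev_hom] f1_def f2_def ev_line)
  show thesis
  proof (cases "degree h = 0")
    case True
    show thesis
    proof (rule coprime[OF c])
      fix v assume v: "eval_poly c v \<noteq> 0"
      have "h = [:c:]" using True by (metis c_def degree_0_id lead_coeff_pCons(2) coeff_pCons_0)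
      then have e: "ev v h = [:eval_poly c v:]"
        by (simp add: map_poly_pCons)
      show "coprime (along 0 v F1) (along 0 v F2)"
      proof (rule coprimeI)
        fix x assume "x dvd along 0 v F1" "x dvd along 0 v F2"
        then have "x dvd ev v h" unfolding evh by simp
        moreover have "is_unit (ev v h)" unfolding e using v by (simp add: is_unit_pCons_iff)
        ultimately show "is_unit x" using dvd_trans by blast
      qed
    qed
  next
    case False
    have "h0 dvd coeff h k" for k
    proof -
      obtain v0 where v0: "eval_poly c v0 \<noteq> 0" using generic_line c by blast
      show ?thesis
      proof (rule line_test[of _ v0 1])
        show "eval_poly h0 v0 \<noteq> 0" using h0 v0 by simp
        fix w
        define R where "R = map_poly (along v0 w)"
        have Rh: "ring_hom R" unfolding R_def by (rule ring_hom_map_poly[OF along_hom])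
        have "R (Polynomial.smult (c ^ N1) f1) = R h * R q1"
          by (simp add: q1 ring_hom_simps[OF Rh])
        moreover have "R (Polynomial.smult (c ^ N1) f1) = Polynomial.smult (along v0 w (c ^ N1)) (R f1)"
          unfolding R_def by (rule poly_eqI) (simp add: coeff_map_poly ring_hom_simps[OF along_hom])
        ultimately have "Polynomial.smult (along v0 w (c ^ N1)) (R f1) = R h * R q1" by simp
        moreover have "along v0 w (c ^ N1) \<noteq> 0"
          using poly_along[of v0 w "c ^ N1" 0] v0 by auto
        moreover have "is_unit (coeff (R f1) 0)"
        proof -
          have "coeff (R f1) 0 = along v0 w (cst (eval_poly F1 0))"
            by (simp add: R_def coeff_map_poly f1_def coeff_line_0 ring_hom_simps[OF along_hom])
          also have "\<dots> = [:eval_poly F1 0:]"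
            by (rule poly_eqI_fun) (simp add: poly_along)
          finally show ?thesis using F1 by (simp add: is_unit_pCons_iff)
        qed
        ultimately have "coeff (R h) 0 dvd coeff (R h) k" by (rule complex_poly_gauss)
        then show "along v0 w h0 dvd along v0 w (coeff h k)"
          by (simp add: R_def coeff_map_poly h0_def ring_hom_simps[OF along_hom])
      qed auto
    qed
    then have "\<exists>pk. coeff h k = h0 * pk" for k by (auto elim: dvdE)
    then obtain pk where pk: "\<And>k. coeff h k = h0 * pk k" by metis
    define P where "P = (\<Sum>k\<le>degree h. monom (pk k) k)"
    have hP: "h = Polynomial.smult h0 P"
      by (rule poly_eqI) (auto simp: P_def coeff_sum coeff_monom pk[symmetric] coeff_eq_0)
    have evhP: "ev v h = Polynomial.smult (eval_poly h0 v) (ev v P)" for v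
      by (simp add: hP ev_smult)
    have P0: "coeff (ev v P) 0 = 1" if "eval_poly c v \<noteq> 0" for v
    proof -
      have "eval_poly h0 v * coeff (ev v P) 0 = eval_poly h0 v"
        using arg_cong[OF evhP[of v], of "\<lambda>p. coeff p 0"] by (simp add: coeff_ev h0_def)
      then show ?thesis using h0[OF that] by simp
    qed
    have degP: "degree (ev v P) = degree h" if v: "eval_poly c v \<noteq> 0" for v
    proof -
      have "degree (ev v h) \<le> degree h" by (rule map_poly_degree_leq)
      moreover have "coeff (ev v h) (degree h) \<noteq> 0" using v by (simp add: coeff_ev c_def)
      ultimately have "degree (ev v h) = degree h" by (simp add: le_antisym le_degree)
      then show ?thesis using h0[OF v] by (simp add: evhP)
    qed
    have Pdvd: "ev v P dvd along 0 v F" if v: "eval_poly c v \<noteq> 0" and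
       q: "Polynomial.smult (c ^ N) (line F) = h * q" for v N F q
    proof -
      have "ev v (Polynomial.smult (c ^ N) (line F)) = ev v h * ev v q"
        by (simp add: q ring_hom_simps[OF ev_hom])
      then have "Polynomial.smult (eval_poly c v ^ N) (along 0 v F) = ev v P * Polynomial.smult (eval_poly h0 v) (ev v q)"
        by (simp add: ev_smult ev_line evhP)
      then have "ev v P dvd Polynomial.smult (eval_poly c v ^ N) (along 0 v F)" by (metis dvd_triv_left)
      then show ?thesis using v by (simp add: dvd_smult_iff)
    qed
    have Pdvd1: "ev v P dvd along 0 v F1" if "eval_poly c v \<noteq> 0" for v
      using Pdvd[OF that q1[unfolded f1_def]] .
    have Pdvd2: "ev v P dvd along 0 v F2" if "eval_poly c v \<noteq> 0" for v
      using Pdvd[OF that q2[unfolded f2_def]] .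
    define p where "p = poly P 1"
    have scale: "along 0 (s *s v) F = pcompose (along 0 v F) [:0, s:]" for s v and F :: "'n cpoly"
      by (rule poly_eqI_fun) (simp add: poly_along poly_pcompose vector_smult_assoc)
    have Pscale: "ev (s *s v) P = pcompose (ev v P) [:0, s:]"
      if v: "eval_poly c v \<noteq> 0" and sv: "eval_poly c (s *s v) \<noteq> 0" and s: "s \<noteq> 0" for s v
    proof -
      define X where "X = pcompose (ev v P) [:0, s:]"
      have "X dvd along 0 (s *s v) F1"
        unfolding X_def scale using Pdvd1[OF v] by (metis dvdE dvd_triv_left pcompose_mult)
      moreover have "X dvd along 0 (s *s v) F2"
        unfolding X_def scale using Pdvd2[OF v] by (metis dvdE dvd_triv_left pcompose_mult)
      ultimately have "X dvd ev (s *s v) h" unfolding evh by simp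
      then have "X dvd ev (s *s v) P" using h0[OF sv] by (simp add: evhP dvd_smult_iff)
      then obtain Y where Y: "ev (s *s v) P = X * Y" by (elim dvdE)
      have dX: "degree X = degree h" using s by (simp add: X_def degree_pcompose degP[OF v])
      have "ev (s *s v) P \<noteq> 0" using P0[OF sv] by auto
      then have "degree Y = 0" using Y dX degP[OF sv] by (simp add: degree_mult_eq)
      then obtain y where y: "Y = [:y:]" by (metis degree_eq_zeroE)
      have "coeff X 0 = 1"
        using P0[OF v] by (simp add: X_def coeff_pcompose_0 poly_0_coeff_0)
      then have "y = 1" using P0[OF sv] by (simp add: Y y)
      then show ?thesis using Y y by (simp add: X_def)
    qed
    \<comment> \<open>Two polynomials in \<open>s\<close> agree unless \<open>s = 0\<close> or the direction \<open>s v\<close> is exceptional; the last two factors of \<open>?Z\<close> vanish in these cases.\<close>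
    have rp: "along 0 v p = ev v P" if v: "eval_poly c v \<noteq> 0" for v
    proof -
      let ?Z = "(along 0 v p - ev v P) * along 0 v c * [:0,1:]"
      have "poly ?Z s = 0" for s
      proof (cases "s = 0 \<or> eval_poly c (s *s v) = 0")
        case True
        then show ?thesis by (auto simp: poly_along)
      next
        case False
        have "poly (along 0 v p) s = poly (ev (s *s v) P) 1"
          by (simp add: poly_along p_def poly_ev_1)
        also have "\<dots> = poly (ev v P) s"
          using Pscale[OF v] False by (simp add: poly_pcompose)
        finally show ?thesis by simp
      qed
      then have "?Z = 0" by (metis poly_all_0_iff_0)
      moreover have "along 0 v c \<noteq> 0" using poly_along[of 0 v c 1] v by auto
      ultimately show ?thesis by simp
    qed
    have p0: "eval_poly p 0 \<noteq> 0"
    proof -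
      obtain v where v: "eval_poly c v \<noteq> 0" using generic_line c by blast
      have "eval_poly p 0 = poly (along 0 v p) 0" by (simp add: poly_along)
      then show ?thesis using P0[OF v] by (simp add: rp[OF v] poly_0_coeff_0)
    qed
    show thesis
    proof (rule common[OF c])
      show "degree (along 0 v p) > 0" if "eval_poly c v \<noteq> 0" for v
        using False degP[OF that] rp[OF that] by simp
      show "p dvd F1" by (rule line_test[OF p0 c]) (use Pdvd1 rp in auto)
      show "p dvd F2" by (rule line_test[OF p0 c]) (use Pdvd2 rp in auto)
    qed
  qed
qed

text \<open>
  The derivative along the Euler vector field, which on each line through the origin is
  \<open>t d/dt\<close> (\<open>along_euler\<close>).
\<close>

definition euler :: "('n::finite) cpoly \<Rightarrow> 'n cpoly" where
  "euler F = (\<Sum>m\<in>keys F.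
     Poly_Mapping.single m (of_nat (\<Sum>i\<in>UNIV. lookup m i) * lookup F m))"

lemma along_0_single:
  "along 0 v (Poly_Mapping.single m a) = monom (a * (\<Prod>i\<in>UNIV. v $ i ^ lookup m i)) (\<Sum>i\<in>UNIV. lookup m i)"
  by (rule poly_eqI_fun)
    (simp add: poly_along eval_poly_substitute substitute_single poly_monom power_mult_distrib prod.distrib power_sum)

lemma pderiv_sum: "pderiv (\<Sum>i\<in>A. f i) = (\<Sum>i\<in>A. pderiv (f i))"
  by (induction A rule: infinite_finite_induct) (auto simp: pderiv_add)

lemma eval_single: "eval_poly (Poly_Mapping.single m a) v = a * (\<Prod>i\<in>UNIV. v $ i ^ lookup m i)"
  by (simp add: eval_poly_substitute substitute_single)

lemma along_euler: "along 0 v (euler F) = [:0, 1:] * pderiv (along 0 v F)"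
proof -
  have 1: "along 0 v F = (\<Sum>m\<in>keys F. along 0 v (Poly_Mapping.single m (lookup F m)))"
    by (subst cpoly_sum_single) (simp add: ring_hom_simps[OF along_hom])
  have 2: "[:0, 1:] * pderiv (monom a n) = monom (of_nat n * a) n" for a :: complex and n
    by (rule poly_eqI) (auto simp: pderiv_monom coeff_pCons coeff_monom split: nat.split)
  show ?thesis
    unfolding euler_def ring_hom_simps(6)[OF along_hom] 1 along_0_single pderiv_sum sum_distrib_left 2
    by (simp only: mult.assoc)
qed

text \<open>
  Apply the dichotomy to \<open>D\<close> and its Euler derivative, with \<open>x0\<close> moved to the origin. A common factor
  \<open>p\<close> gives \<open>D = p B\<close>. If \<open>p\<close> and \<open>B\<close> were coprime on generic lines, then the product rule would make
  \<open>p\<close> divide its own derivative there, although it is not constant; so \<open>p\<close> and \<open>B\<close> have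
  a common factor, whose square divides \<open>D\<close>.
\<close>

lemma squarefree_generic_line:
  fixes D :: "('n::finite) cpoly"
  assumes sf: "squarefree D" and D0: "eval_poly D x0 \<noteq> 0"
  obtains c where "c \<noteq> 0" "\<And>v. eval_poly c v \<noteq> 0 \<Longrightarrow> coprime (along x0 v D) (pderiv (along x0 v D))"
proof -
  define Dt where "Dt = shift x0 D"
  have al: "along 0 v Dt = along x0 v D" for v by (simp add: Dt_def along_shift)
  have Dt0: "eval_poly Dt 0 \<noteq> 0" using D0 by (simp add: Dt_def eval_shift)
  show thesis
  proof (cases rule: common_factor_dichotomy[OF Dt0, of "euler Dt"])
    case (1 c)
    then show ?thesis using that[of c] by (simp add: al along_euler coprime_mult_right_iff del: mult_pCons_left)
  next
    case (2 c p)
    then obtain B where B: "Dt = p * B" by (elim dvdE)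
    have p0: "eval_poly p 0 \<noteq> 0" using Dt0 B by auto
    show ?thesis
    proof (cases rule: common_factor_dichotomy[OF p0, of B])
      case (1 c')
      have "c * c' \<noteq> 0" using 1 2 cpoly_mult_neq_0 by blast
      then obtain v where "eval_poly (c * c') v \<noteq> 0" using generic_line by blast
      then have v: "eval_poly c v \<noteq> 0" "eval_poly c' v \<noteq> 0" by auto
      define P Q where "P = along 0 v p" and "Q = along 0 v B"
      have deg: "degree P > 0" using 2 v by (simp add: P_def)
      have PQ: "coprime P Q" using 1 v by (simp add: P_def Q_def)
      have "P dvd along 0 v (euler Dt)"
        using 2(4) unfolding P_def by (metis along_hom dvdE dvd_triv_left ring_hom_simps(4))
      also have "along 0 v (euler Dt) = [:0,1:] * pderiv (P * Q)"
        by (simp add: along_euler B ring_hom_simps[OF along_hom] P_def Q_def)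
      also have "\<dots> = P * ([:0,1:] * pderiv Q) + Q * ([:0,1:] * pderiv P)"
        by (simp add: pderiv_mult algebra_simps del: mult_pCons_left mult_pCons_right)
      finally have "P dvd Q * ([:0,1:] * pderiv P)"
        by (metis dvd_add_right_iff dvd_triv_left)
      then have "P dvd [:0,1:] * pderiv P" using PQ coprime_dvd_mult_right_iff by blast
      moreover have "coprime P [:0,1:]"
      proof -
        have "\<not> [:0,1:] dvd P"
          using p0 poly_eq_0_iff_dvd[of P 0] by (simp add: P_def poly_along)
        moreover have "prime_elem [:0,1::complex:]" by (rule prime_elem_linear_field_poly) simp
        ultimately show ?thesis by (metis coprime_commute prime_elem_imp_coprime)
      qed
      ultimately have "P dvd pderiv P" using \<open>P dvd [:0,1:] * pderiv P\<close> coprime_dvd_mult_right_iff by blast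
      then have "pderiv P = 0 \<or> degree P \<le> degree (pderiv P)" by (metis dvd_imp_degree_le)
      then have False using deg by (auto simp: degree_pderiv pderiv_eq_0_iff)
      then show ?thesis ..
    next
      case (2 c' p')
      have "p' ^ 2 dvd Dt" unfolding B power2_eq_square by (rule mult_dvd_mono) (use 2 in auto)
      then have "shift (-x0) p' ^ 2 dvd shift (-x0) Dt"
        by (metis (no_types) dvdE dvd_triv_left ring_hom_simps(4,5) shift_hom)
      then have "shift (-x0) p' ^ 2 dvd D" by (simp add: Dt_def shift_shift)
      then have "shift (-x0) p' dvd 1" using sf by (rule squarefreeD[rotated])
      then obtain q where q: "1 = shift (-x0) p' * q" by (elim dvdE)
      obtain v where v: "eval_poly c' v \<noteq> 0" using generic_line 2 by blast
      have "eval_poly p' x * eval_poly q (x + x0) = 1" for x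
        using arg_cong[OF q, of "\<lambda>F. eval_poly F (x + x0)"] by (simp add: eval_shift)
      then have nz: "poly (along 0 v p') t \<noteq> 0" for t
        by (metis mult_zero_left poly_along zero_neq_one)
      have "constant (poly (along 0 v p'))"
        using fundamental_theorem_of_algebra nz by blast
      then have "degree (along 0 v p') = 0" by (simp add: constant_degree)
      then show ?thesis using 2(2)[OF v] by simp
    qed
  qed
qed

lemma power_quotient_inverse:
  assumes "t \<noteq> (0::complex)" "k \<le> n"
  shows "q * inverse t ^ (n - k) = t ^ k * q / t ^ n"
proof -
  have "t ^ n = t ^ k * t ^ (n - k)" using assms by (simp flip: power_add)
  then show ?thesis using assms by (simp add: power_inverse divide_simps)
qed

text \<open>
  The limit is the homogeneous component of \<open>D\<close> of top degree, evaluated at the direction \<open>v\<close>.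
\<close>

lemma generic_leading_term:
  fixes D :: "('n::finite) cpoly"
  assumes N: "total_degree D = N" "N > 0"
  obtains c where "c \<noteq> 0"
    "\<And>v x0. eval_poly c v \<noteq> 0 \<Longrightarrow> ((\<lambda>t. eval_poly D (x0 + t *s v) / t ^ N) \<longlongrightarrow> eval_poly c v) at_infinity"
proof -
  let ?d = "\<lambda>m. \<Sum>i\<in>UNIV. lookup m (i::'n)"
  define K where "K = {m\<in>keys D. ?d m = N}"
  define c where "c = (\<Sum>m\<in>K. Poly_Mapping.single m (lookup D m))"
  have fin: "finite K" by (simp add: K_def)
  have le: "?d m \<le> N" if "m \<in> keys D" for m
    unfolding N(1)[symmetric] total_degree_def using that by (intro Max_ge) auto
  have "N \<in> insert 0 (?d ` keys D)"
    unfolding N(1)[symmetric] total_degree_def by (rule Max_in) auto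
  then obtain m where m: "m \<in> K" using N(2) by (auto simp: K_def)
  have "lookup c m = lookup D m"
    using m fin by (simp add: c_def lookup_sum lookup_single when_def)
  then have c: "c \<noteq> 0" using m by (auto simp: K_def in_keys_iff)
  have ec: "eval_poly c v = (\<Sum>m\<in>K. lookup D m * (\<Prod>i\<in>UNIV. v $ i ^ lookup m i))" for v
    by (simp add: c_def eval_sum eval_single)
  have "((\<lambda>t. eval_poly D (x0 + t *s v) / t ^ N) \<longlongrightarrow> eval_poly c v) at_infinity" for v x0
  proof -
    have inv: "((\<lambda>t::complex. inverse t) \<longlongrightarrow> 0) at_infinity" by (rule tendsto_inverse_0)
    have mono: "((\<lambda>t. lookup D m * (\<Prod>i\<in>UNIV. (x0 $ i * inverse t + v $ i) ^ lookup m i) * inverse t ^ (N - ?d m))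
        \<longlongrightarrow> (if m \<in> K then lookup D m * (\<Prod>i\<in>UNIV. v $ i ^ lookup m i) else 0)) at_infinity"
      if "m \<in> keys D" for m
    proof -
      have "((\<lambda>t. lookup D m * (\<Prod>i\<in>UNIV. (x0 $ i * inverse t + v $ i) ^ lookup m i) * inverse t ^ (N - ?d m))
        \<longlongrightarrow> lookup D m * (\<Prod>i\<in>UNIV. (x0 $ i * 0 + v $ i) ^ lookup m i) * 0 ^ (N - ?d m)) at_infinity"
        by (intro tendsto_intros inv)
      moreover have "lookup D m * (\<Prod>i\<in>UNIV. (x0 $ i * 0 + v $ i) ^ lookup m i) * 0 ^ (N - ?d m) =
        (if m \<in> K then lookup D m * (\<Prod>i\<in>UNIV. v $ i ^ lookup m i) else 0)"
        using le[OF that] that by (auto simp: K_def power_0_left)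
      ultimately show ?thesis by simp
    qed
    have "((\<lambda>t. \<Sum>m\<in>keys D. lookup D m * (\<Prod>i\<in>UNIV. (x0 $ i * inverse t + v $ i) ^ lookup m i) * inverse t ^ (N - ?d m))
       \<longlongrightarrow> (\<Sum>m\<in>keys D. if m \<in> K then lookup D m * (\<Prod>i\<in>UNIV. v $ i ^ lookup m i) else 0)) at_infinity"
      by (intro tendsto_sum mono)
    also have "(\<Sum>m\<in>keys D. if m \<in> K then lookup D m * (\<Prod>i\<in>UNIV. v $ i ^ lookup m i) else 0) = eval_poly c v"
      unfolding ec by (rule sum.mono_neutral_cong_right) (auto simp: K_def)
    finally show ?thesis
    proof (rule Lim_transform_eventually)
      show "\<forall>\<^sub>F t in at_infinity. (\<Sum>m\<in>keys D. lookup D m * (\<Prod>i\<in>UNIV. (x0 $ i * inverse t + v $ i) ^ lookup m i) * inverse t ^ (N - ?d m)) =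
        eval_poly D (x0 + t *s v) / t ^ N"
      proof (rule eventually_mono[OF eventually_not_equal_at_infinity[of 0]])
        fix t :: complex assume t: "t \<noteq> 0"
        have "(\<Prod>i\<in>UNIV. (x0 $ i * inverse t + v $ i) ^ lookup m i) * inverse t ^ (N - ?d m)
          = (\<Prod>i\<in>UNIV. (x0 $ i + t * v $ i) ^ lookup m i) / t ^ N" if "m \<in> keys D" for m
        proof -
          have "(\<Prod>i\<in>UNIV. (x0 $ i + t * v $ i) ^ lookup m i) =
            (\<Prod>i\<in>UNIV. (t * (x0 $ i * inverse t + v $ i)) ^ lookup m i)"
          proof -
            have "t * (x0 $ i * inverse t + v $ i) = x0 $ i + t * v $ i" for i
              using t by (simp add: distrib_left mult.left_commute[of t])
            then show ?thesis by (simp only:)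
          qed
          also have "\<dots> = t ^ ?d m * (\<Prod>i\<in>UNIV. (x0 $ i * inverse t + v $ i) ^ lookup m i)"
            by (simp only: power_mult_distrib prod.distrib power_sum)
          finally have *: "(\<Prod>i\<in>UNIV. (x0 $ i + t * v $ i) ^ lookup m i) =
            t ^ ?d m * (\<Prod>i\<in>UNIV. (x0 $ i * inverse t + v $ i) ^ lookup m i)" .
          show ?thesis by (subst *) (rule power_quotient_inverse[OF t le[OF that]])
        qed
        then show "(\<Sum>m\<in>keys D. lookup D m * (\<Prod>i\<in>UNIV. (x0 $ i * inverse t + v $ i) ^ lookup m i) * inverse t ^ (N - ?d m)) =
          eval_poly D (x0 + t *s v) / t ^ N"
          by (simp add: eval_poly_def sum_divide_distrib mult.assoc)
      qed
    qed
  qed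
  then show thesis using that c by blast
qed

section \<open>Polynomial functions and their partial derivatives\<close>

text \<open>
  Unlike formal polynomials these functions are obviously preserved by linear changes of
  coordinates.
\<close>

inductive polyfun :: "nat \<Rightarrow> (complex ^ ('n::finite) \<Rightarrow> complex) \<Rightarrow> bool" where
  const: "polyfun 0 (\<lambda>x. a)"
| coord: "polyfun 1 (\<lambda>x. x $ i)"
| add: "polyfun k f \<Longrightarrow> polyfun k g \<Longrightarrow> polyfun k (\<lambda>x. f x + g x)"
| mult: "polyfun k f \<Longrightarrow> polyfun l g \<Longrightarrow> polyfun (k + l) (\<lambda>x. f x * g x)"
| weaken: "polyfun k f \<Longrightarrow> k \<le> l \<Longrightarrow> polyfun l f"

lemma polyfun_const: "polyfun k (\<lambda>x. a)"
  using polyfun.weaken[OF polyfun.const] by auto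

lemma polyfun_cmult: "polyfun k f \<Longrightarrow> polyfun k (\<lambda>x. a * f x)"
  using polyfun.mult[OF polyfun.const[of a], of k f] by simp

lemma polyfun_mult_le: "polyfun k f \<Longrightarrow> polyfun l g \<Longrightarrow> k + l \<le> n \<Longrightarrow> polyfun n (\<lambda>x. f x * g x)"
  using polyfun.mult polyfun.weaken by blast

lemma polyfun_diff: "polyfun k f \<Longrightarrow> polyfun k g \<Longrightarrow> polyfun k (\<lambda>x. f x - g x)"
  using polyfun.add[OF _ polyfun_cmult[of k g "-1"], of f] by simp

lemma polyfun_sum: "(\<And>i. i \<in> A \<Longrightarrow> polyfun k (f i)) \<Longrightarrow> polyfun k (\<lambda>x. \<Sum>i\<in>A. f i x)"
  by (induction A rule: infinite_finite_induct) (auto simp: polyfun_const intro: polyfun.add)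

lemma polyfun_prod: "(\<And>i. i \<in> A \<Longrightarrow> polyfun (k i) (f i)) \<Longrightarrow> polyfun (\<Sum>i\<in>A. k i) (\<lambda>x. \<Prod>i\<in>A. f i x)"
  by (induction A rule: infinite_finite_induct) (auto simp: polyfun_const intro: polyfun.mult)

lemma polyfun_power: "polyfun k f \<Longrightarrow> polyfun (n * k) (\<lambda>x. f x ^ n)"
  by (induction n) (auto simp: polyfun_const intro: polyfun.mult)

lemma polyfun_eval:
  assumes "total_degree p \<le> k"
  shows "polyfun k (eval_poly p)"
  unfolding eval_poly_def
proof (intro polyfun_sum polyfun_cmult)
  fix m assume m: "m \<in> keys p"
  have "(\<Sum>i\<in>UNIV. lookup m i) \<le> total_degree p"
    unfolding total_degree_def using m by (intro Max_ge) auto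
  moreover have "polyfun (\<Sum>i\<in>UNIV. lookup m i * 1) (\<lambda>x. \<Prod>i\<in>UNIV. x $ i ^ lookup m i)"
    by (intro polyfun_prod polyfun_power polyfun.coord)
  ultimately show "polyfun k (\<lambda>x. \<Prod>i\<in>UNIV. x $ i ^ lookup m i)"
    using assms by (auto intro: polyfun.weaken)
qed

lemma polyfun_linear:
  assumes "polyfun k f"
  shows "polyfun k (\<lambda>x. f (A *v x))"
  using assms
proof induction
  case (coord i)
  show ?case unfolding matrix_vector_mult_def vec_lambda_beta
    by (intro polyfun_sum polyfun_cmult polyfun.coord)
qed (auto intro: polyfun.intros)

lemma polyfun_on_line:
  assumes "polyfun k f"
  shows "\<exists>p. degree p \<le> k \<and> (\<forall>z. f (x + z *s v) = poly p z)"
  using assms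
proof induction
  case (const a)
  show ?case by (rule exI[of _ "[:a:]"]) simp
next
  case (coord i)
  show ?case by (rule exI[of _ "[:x $ i, v $ i:]"]) simp
next
  case (add k f g)
  then obtain p q where "degree p \<le> k" "degree q \<le> k" "\<forall>z. f (x + z *s v) = poly p z" "\<forall>z. g (x + z *s v) = poly q z" by blast
  then show ?case by (intro exI[of _ "p + q"]) (auto intro: degree_add_le)
next
  case (mult k f l g)
  then obtain p q where "degree p \<le> k" "degree q \<le> l" "\<forall>z. f (x + z *s v) = poly p z" "\<forall>z. g (x + z *s v) = poly q z" by blast
  then show ?case by (intro exI[of _ "p * q"]) (auto intro: degree_mult_le[THEN order_trans])
next
  case (weaken k f l)
  then show ?case by (meson order_trans)
qed

text \<open>
  Complex differentiability with gradient \<open>a\<close>. Only differentiable functions obey the calculus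
  of \<open>cpartial\<close>, which is a derivative along a single line.
\<close>

definition has_grad :: "(complex ^ 'n \<Rightarrow> complex) \<Rightarrow> complex ^ 'n \<Rightarrow> complex ^ ('n::finite) \<Rightarrow> bool" where
  "has_grad f a x \<longleftrightarrow> (f has_derivative (\<lambda>v. \<Sum>i\<in>UNIV. a $ i * v $ i)) (at x)"

lemma bounded_linear_smult: "bounded_linear (\<lambda>h::complex. h *s (v::complex^'n::finite))"
  unfolding linear_conv_bounded_linear[symmetric]
  by (rule linearI) (auto simp: vec_eq_iff distrib_right)

lemma has_grad_direction:
  assumes "has_grad f a (x + z *s v)"
  shows "((\<lambda>z. f (x + z *s v)) has_field_derivative (\<Sum>i\<in>UNIV. a $ i * v $ i)) (at z)"
proof -
  have "((\<lambda>z. x + z *s v) has_derivative (\<lambda>h. 0 + h *s v)) (at z)"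
    by (intro has_derivative_add has_derivative_const bounded_linear.has_derivative[OF bounded_linear_smult] has_derivative_ident)
  then have "((\<lambda>z. f (x + z *s v)) has_derivative (\<lambda>h. \<Sum>i\<in>UNIV. a $ i * (0 + h *s v) $ i)) (at z)"
    using assms unfolding has_grad_def by (rule has_derivative_compose)
  moreover have "(\<lambda>h. \<Sum>i\<in>UNIV. a $ i * (0 + h *s v) $ i) = (*) (\<Sum>i\<in>UNIV. a $ i * v $ i)"
    by (auto simp: sum_distrib_right sum_distrib_left mult_ac)
  ultimately show ?thesis by (simp add: has_field_derivative_def)
qed

lemma has_grad_cpartial: "has_grad f a x \<Longrightarrow> cpartial k f x = a $ k"
proof -
  assume "has_grad f a x"
  then have "((\<lambda>z. f (x + z *s axis k 1)) has_field_derivative (\<Sum>i\<in>UNIV. a $ i * axis k 1 $ i)) (at 0)"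
    by (intro has_grad_direction) simp
  then show ?thesis unfolding cpartial_def
    by (simp add: DERIV_imp_deriv axis_def if_distrib cong: if_cong)
qed

definition cdiff where "cdiff f x \<longleftrightarrow> (\<exists>a. has_grad f a x)"

lemma cdiffD: "cdiff f x \<Longrightarrow> has_grad f (\<chi> i. cpartial i f x) x"
proof -
  assume "cdiff f x"
  then obtain a where a: "has_grad f a x" by (auto simp: cdiff_def)
  have "(\<chi> i. cpartial i f x) = a" using has_grad_cpartial[OF a] by (simp add: vec_eq_iff)
  with a show ?thesis by simp
qed

lemma cdiffI: "has_grad f a x \<Longrightarrow> cdiff f x" by (auto simp: cdiff_def)

lemma has_grad_const: "has_grad (\<lambda>x. a) 0 x"
  by (simp add: has_grad_def)

lemma has_grad_coord: "has_grad (\<lambda>x. x $ i) (axis i 1) x"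
proof -
  have "(\<lambda>v. \<Sum>j\<in>UNIV. axis i 1 $ j * v $ j) = (\<lambda>v::complex^'a. v $ i)"
    by (auto simp: axis_def if_distrib[of "\<lambda>x. x * _"] cong: if_cong)
  then show ?thesis unfolding has_grad_def
    by (metis bounded_linear_vec_nth bounded_linear_imp_has_derivative)
qed

lemma has_grad_add: "has_grad f a x \<Longrightarrow> has_grad g b x \<Longrightarrow> has_grad (\<lambda>x. f x + g x) (a + b) x"
  unfolding has_grad_def by (drule (1) has_derivative_add) (simp add: distrib_right sum.distrib)

lemma has_grad_mult: "has_grad f a x \<Longrightarrow> has_grad g b x \<Longrightarrow> has_grad (\<lambda>x. f x * g x) (g x *s a + f x *s b) x"
  unfolding has_grad_def
  by (drule (1) has_derivative_mult) (simp add: distrib_left distrib_right sum.distrib sum_distrib_left sum_distrib_right mult_ac add.commute)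

lemma has_grad_inverse:
  assumes "has_grad f a x" "f x \<noteq> 0"
  shows "has_grad (\<lambda>x. inverse (f x)) ((- (inverse (f x) ^ 2)) *s a) x"
proof -
  have "((\<lambda>x. inverse (f x)) has_derivative (\<lambda>h. - (inverse (f x) * (\<Sum>i\<in>UNIV. a $ i * h $ i) * inverse (f x)))) (at x)"
    using assms unfolding has_grad_def by (intro Deriv.has_derivative_inverse) auto
  then show ?thesis unfolding has_grad_def
    by (simp add: sum_distrib_left sum_distrib_right sum_negf mult_ac power2_eq_square)
qed

lemma has_grad_transform:
  assumes "has_grad f a x" "open S" "x \<in> S" "\<And>y. y \<in> S \<Longrightarrow> f y = g y"
  shows "has_grad g a x"
  using assms has_derivative_transform_within_open unfolding has_grad_def by blast

lemma cdiff_const [simp]: "cdiff (\<lambda>x. a) x" using has_grad_const cdiffI by blast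
lemma cdiff_coord [simp]: "cdiff (\<lambda>x. x $ i) x" using has_grad_coord cdiffI by blast
lemma cdiff_add: "cdiff f x \<Longrightarrow> cdiff g x \<Longrightarrow> cdiff (\<lambda>x. f x + g x) x" using has_grad_add cdiffI cdiffD by blast
lemma cdiff_mult: "cdiff f x \<Longrightarrow> cdiff g x \<Longrightarrow> cdiff (\<lambda>x. f x * g x) x" using has_grad_mult cdiffI cdiffD by blast
lemma cdiff_sum: "(\<And>i. i \<in> A \<Longrightarrow> cdiff (f i) x) \<Longrightarrow> cdiff (\<lambda>x. \<Sum>i\<in>A. f i x) x"
  by (induction A rule: infinite_finite_induct) (auto intro: cdiff_add)

lemma cpartial_const [simp]: "cpartial k (\<lambda>x. a) x = 0"
  using has_grad_cpartial[OF has_grad_const] by simp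
lemma cpartial_coord: "cpartial k (\<lambda>x. x $ i) x = (if k = i then 1 else 0)"
  by (subst has_grad_cpartial[OF has_grad_coord]) (simp add: axis_def)
lemma cpartial_add: "cdiff f x \<Longrightarrow> cdiff g x \<Longrightarrow> cpartial k (\<lambda>x. f x + g x) x = cpartial k f x + cpartial k g x"
  using has_grad_cpartial[OF has_grad_add[OF cdiffD cdiffD]] by simp
lemma cpartial_mult: "cdiff f x \<Longrightarrow> cdiff g x \<Longrightarrow> cpartial k (\<lambda>x. f x * g x) x = cpartial k f x * g x + f x * cpartial k g x"
  using has_grad_cpartial[OF has_grad_mult[OF cdiffD cdiffD]] by (simp add: mult_ac)
lemma cpartial_cmult: "cdiff f x \<Longrightarrow> cpartial k (\<lambda>x. a * f x) x = a * cpartial k f x"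
  by (subst cpartial_mult) auto
lemma cpartial_sum: "(\<And>i. i \<in> A \<Longrightarrow> cdiff (f i) x) \<Longrightarrow> cpartial k (\<lambda>x. \<Sum>i\<in>A. f i x) x = (\<Sum>i\<in>A. cpartial k (f i) x)"
  by (induction A rule: infinite_finite_induct) (auto simp: cpartial_add cdiff_sum)

lemma cpartial_transform:
  assumes "open S" "x \<in> S" "\<And>y. y \<in> S \<Longrightarrow> f y = g y"
  shows "cpartial k f x = cpartial k g x"
proof -
  have "\<forall>\<^sub>F z in nhds 0. f (x + z *s axis k 1) = g (x + z *s axis k 1)"
  proof -
    have "continuous_on UNIV (\<lambda>z::complex. x + z *s axis k 1)"
      by (intro continuous_intros linear_continuous_on bounded_linear_smult)
    then have "open ((\<lambda>z::complex. x + z *s axis k 1) -` S)" using assms(1) by (simp add: open_vimage)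
    then have "\<forall>\<^sub>F z in nhds 0. z \<in> (\<lambda>z::complex. x + z *s axis k 1) -` S"
      using assms(2) by (intro eventually_nhds_in_open) auto
    then show ?thesis by (rule eventually_mono) (use assms in auto)
  qed
  then show ?thesis unfolding cpartial_def by (intro deriv_cong_ev refl)
qed

lemma polyfun_cdiff: "polyfun k f \<Longrightarrow> cdiff f x"
  by (induction rule: polyfun.induct) (auto intro: cdiff_add cdiff_mult)

lemma polyfun_cpartial_aux:
  "polyfun k f \<Longrightarrow> polyfun (k - 1) (cpartial i f) \<and> (k = 0 \<longrightarrow> cpartial i f = (\<lambda>x. 0))"
proof (induction rule: polyfun.induct)
  case (const a)
  have "cpartial i (\<lambda>x. a) = (\<lambda>x. 0)" by auto
  then show ?case by (simp add: polyfun_const)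
next
  case (coord j)
  have "cpartial i (\<lambda>x. x $ j) = (\<lambda>x. if i = j then 1 else 0)" by (auto simp: cpartial_coord)
  then show ?case by (simp add: polyfun_const)
next
  case (add k f g)
  have "cpartial i (\<lambda>x. f x + g x) = (\<lambda>x. cpartial i f x + cpartial i g x)"
    using add polyfun_cdiff by (intro ext cpartial_add) blast+
  then show ?case using add by (auto intro: polyfun.add)
next
  case (mult k f l g)
  have e: "cpartial i (\<lambda>x. f x * g x) = (\<lambda>x. cpartial i f x * g x + f x * cpartial i g x)"
    using mult polyfun_cdiff by (intro ext cpartial_mult) blast+
  have "polyfun (k + l - 1) (\<lambda>x. cpartial i f x * g x)"
    using mult by (cases "k = 0") (auto simp: polyfun_const intro: polyfun_mult_le)
  moreover have "polyfun (k + l - 1) (\<lambda>x. f x * cpartial i g x)"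
    using mult by (cases "l = 0") (auto simp: polyfun_const intro: polyfun_mult_le)
  ultimately show ?case unfolding e using mult by (auto intro: polyfun.add)
next
  case (weaken k f l)
  then show ?case by (auto intro: polyfun.weaken)
qed

lemma polyfun_cpartial: "polyfun k f \<Longrightarrow> polyfun (k - 1) (cpartial i f)"
  using polyfun_cpartial_aux by blast

lemma polyfun_mixed_partials: "polyfun k f \<Longrightarrow> cpartial i (cpartial j f) x = cpartial j (cpartial i f) x"
proof (induction arbitrary: x rule: polyfun.induct)
  case (const a)
  have "cpartial i (\<lambda>x. a) = (\<lambda>x. 0)" for i by auto
  then show ?case by simp
next
  case (coord l)
  have "cpartial j (\<lambda>x. x $ l) = (\<lambda>x. if j = l then 1 else 0)" for j by (auto simp: cpartial_coord)
  then show ?case by simp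
next
  case (add k f g)
  have e: "cpartial i (\<lambda>x. f x + g x) = (\<lambda>x. cpartial i f x + cpartial i g x)" for i
    using add polyfun_cdiff by (intro ext cpartial_add) blast+
  have d: "cdiff (cpartial i f) x" "cdiff (cpartial i g) x" for x i
    using add polyfun_cdiff polyfun_cpartial by blast+
  show ?case unfolding e
    by (simp add: cpartial_add d add.IH)
next
  case (mult k f l g)
  have d: "cdiff f x" "cdiff g x" "cdiff (cpartial i f) x" "cdiff (cpartial i g) x" for x i
    using mult polyfun_cdiff polyfun_cpartial by blast+
  have e: "cpartial i (\<lambda>x. f x * g x) = (\<lambda>x. cpartial i f x * g x + f x * cpartial i g x)" for i
    by (intro ext cpartial_mult d)
  show ?case unfolding e
    by (simp add: cpartial_add cpartial_mult cdiff_mult d mult.IH)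
qed auto

lemma polyfun_cont: "polyfun k f \<Longrightarrow> isCont f x"
  by (induction rule: polyfun.induct) (auto intro!: continuous_intros)

section \<open>Orders of growth and a Liouville theorem\<close>

text \<open>
  \<open>f = O(\<phi> ^ k)\<close> along the filter \<open>F\<close>, where \<open>\<phi>\<close> tends to infinity. Taking \<open>\<phi> = z\<close> at infinity and
  \<open>\<phi> = 1 / (z - a)\<close> at \<open>a\<close> treats degrees of growth and orders of poles by the same rules.
\<close>

definition ord_le :: "complex filter \<Rightarrow> (complex \<Rightarrow> complex) \<Rightarrow> int \<Rightarrow> (complex \<Rightarrow> complex) \<Rightarrow> bool" where
  "ord_le F \<phi> k f \<longleftrightarrow> (\<exists>B. \<forall>\<^sub>F z in F. norm (f z) \<le> B * norm (\<phi> z) powi k)"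

locale growth_scale =
  fixes F :: "complex filter" and \<phi> :: "complex \<Rightarrow> complex"
  assumes scale_lim: "filterlim \<phi> at_infinity F"
begin

lemma scale_ge_1: "\<forall>\<^sub>F z in F. norm (\<phi> z) \<ge> 1"
  using scale_lim unfolding filterlim_at_infinity[of 0, simplified] by (auto dest: spec[of _ 1])

lemma ord_const: "ord_le F \<phi> 0 (\<lambda>z. a)"
  unfolding ord_le_def by (rule exI[of _ "norm a"]) simp

lemma ord_add:
  assumes "ord_le F \<phi> k f" "ord_le F \<phi> k g" shows "ord_le F \<phi> k (\<lambda>z. f z + g z)"
proof -
  obtain A B where "\<forall>\<^sub>F z in F. norm (f z) \<le> A * norm (\<phi> z) powi k" "\<forall>\<^sub>F z in F. norm (g z) \<le> B * norm (\<phi> z) powi k"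
    using assms by (auto simp: ord_le_def)
  then have "\<forall>\<^sub>F z in F. norm (f z + g z) \<le> (A + B) * norm (\<phi> z) powi k"
    by eventually_elim (simp add: distrib_right norm_triangle_mono)
  then show ?thesis by (auto simp: ord_le_def)
qed

lemma ord_mult:
  assumes "ord_le F \<phi> k f" "ord_le F \<phi> l g" shows "ord_le F \<phi> (k + l) (\<lambda>z. f z * g z)"
proof -
  obtain A B where "\<forall>\<^sub>F z in F. norm (f z) \<le> A * norm (\<phi> z) powi k" "\<forall>\<^sub>F z in F. norm (g z) \<le> B * norm (\<phi> z) powi l"
    using assms by (auto simp: ord_le_def)
  then have "\<forall>\<^sub>F z in F. norm (f z * g z) \<le> (A * B) * norm (\<phi> z) powi (k + l)"
    using scale_ge_1
  proof eventually_elim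
    case (elim z)
    have "norm (f z) * norm (g z) \<le> (A * norm (\<phi> z) powi k) * (B * norm (\<phi> z) powi l)"
      using elim by (intro mult_mono) (auto intro: order_trans[OF norm_ge_zero])
    moreover have "norm (\<phi> z) powi (k + l) = norm (\<phi> z) powi k * norm (\<phi> z) powi l"
      using elim by (intro power_int_add) auto
    ultimately show ?case by (simp add: norm_mult mult_ac)
  qed
  then show ?thesis by (auto simp: ord_le_def)
qed

lemma ord_mono:
  assumes "ord_le F \<phi> k f" "k \<le> l" shows "ord_le F \<phi> l f"
proof -
  obtain A where "\<forall>\<^sub>F z in F. norm (f z) \<le> A * norm (\<phi> z) powi k"
    using assms by (auto simp: ord_le_def)
  then have "\<forall>\<^sub>F z in F. norm (f z) \<le> \<bar>A\<bar> * norm (\<phi> z) powi l"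
    using scale_ge_1
  proof eventually_elim
    case (elim z)
    have "A * norm (\<phi> z) powi k \<le> \<bar>A\<bar> * norm (\<phi> z) powi l"
      using elim assms(2) by (intro mult_mono power_int_increasing) auto
    with elim show ?case by linarith
  qed
  then show ?thesis by (auto simp: ord_le_def)
qed

lemma ord_mult': "ord_le F \<phi> k f \<Longrightarrow> ord_le F \<phi> l g \<Longrightarrow> k + l \<le> n \<Longrightarrow> ord_le F \<phi> n (\<lambda>z. f z * g z)"
  using ord_mult ord_mono by blast

lemma ord_cmult: "ord_le F \<phi> k f \<Longrightarrow> ord_le F \<phi> k (\<lambda>z. a * f z)"
  using ord_mult[OF ord_const] by simp

lemma ord_uminus: "ord_le F \<phi> k f \<Longrightarrow> ord_le F \<phi> k (\<lambda>z. - f z)"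
  using ord_cmult[of k f "-1"] by simp

lemma ord_0: "ord_le F \<phi> k (\<lambda>z. 0)"
  unfolding ord_le_def by (rule exI[of _ 0]) simp

lemma ord_sum: "(\<And>i. i \<in> A \<Longrightarrow> ord_le F \<phi> k (f i)) \<Longrightarrow> ord_le F \<phi> k (\<lambda>z. \<Sum>i\<in>A. f i z)"
  by (induction A rule: infinite_finite_induct) (auto simp: ord_0 intro: ord_add)

lemma ord_cong:
  assumes "\<forall>\<^sub>F z in F. f z = g z" "ord_le F \<phi> k f" shows "ord_le F \<phi> k g"
proof -
  obtain A where "\<forall>\<^sub>F z in F. norm (f z) \<le> A * norm (\<phi> z) powi k"
    using assms by (auto simp: ord_le_def)
  with assms(1) have "\<forall>\<^sub>F z in F. norm (g z) \<le> A * norm (\<phi> z) powi k"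
    by eventually_elim simp
  then show ?thesis by (auto simp: ord_le_def)
qed

end

interpretation inf: growth_scale at_infinity "\<lambda>z. z"
  by unfold_locales (rule filterlim_ident)

lemma growth_scale_at: "growth_scale (at a) (\<lambda>z. 1 / (z - a))"
proof
  have "filterlim (\<lambda>z. z - a) (at 0) (at a)"
    by (simp add: filterlim_at tendsto_diff[where b=a and a=a, simplified] eventually_at_filter LIM_zero)
  then show "filterlim (\<lambda>z. 1 / (z - a)) at_infinity (at a)"
    using filterlim_compose[OF filterlim_inverse_at_infinity] by (simp add: divide_inverse)
qed

interpretation pt: growth_scale "at a" "\<lambda>z. 1 / (z - a)" for a
  by (rule growth_scale_at)

abbreviation "ord_inf \<equiv> ord_le at_infinity (\<lambda>z. z)"
abbreviation "ord_at a \<equiv> ord_le (at a) (\<lambda>z. 1 / (z - a))"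

lemma ord_inf_poly: "degree p \<le> k \<Longrightarrow> ord_inf (int k) (poly p)"
proof (induction p arbitrary: k)
  case 0
  then show ?case using inf.ord_0 by simp
next
  case (pCons a p)
  have id: "ord_inf 1 (\<lambda>z. z)" unfolding ord_le_def by (rule exI[of _ 1]) simp
  show ?case
  proof (cases "p = 0")
    case True
    then show ?thesis using inf.ord_mono[OF inf.ord_const, of "int k" a] by simp
  next
    case False
    then obtain l where l: "k = Suc l" "degree p \<le> l" using pCons.prems by (cases k) auto
    have "ord_inf (int k) (\<lambda>z. z * poly p z)"
      by (rule inf.ord_mult'[OF id pCons.IH[OF l(2)]]) (use l in auto)
    then show ?thesis using inf.ord_add[OF inf.ord_mono[OF inf.ord_const, of "int k" a]] by simp
  qed
qed

lemma ord_inf_poly_degree: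
  assumes "ord_inf k (poly p)" shows "p = 0 \<or> int (degree p) \<le> k"
proof (rule ccontr)
  assume "\<not> ?thesis"
  then have p: "p \<noteq> 0" "k \<le> int (degree p) - 1" by auto
  from inf.ord_mono[OF assms this(2)] obtain B where
    "\<forall>\<^sub>F z in at_infinity. norm (poly p z) \<le> B * norm z powi (int (degree p) - 1)"
    by (auto simp: ord_le_def)
  moreover have "\<forall>\<^sub>F z in at_infinity. z \<noteq> (0::complex)" by (rule eventually_not_equal_at_infinity)
  ultimately have ev: "\<forall>\<^sub>F z in at_infinity. norm (poly p z / z ^ degree p) \<le> B * norm (inverse z)"
  proof eventually_elim
    case (elim z)
    have "norm z powi (int (degree p) - 1) = norm z ^ degree p / norm z"
      using elim by (simp add: power_int_diff)
    then have "norm (poly p z) / norm z ^ degree p \<le> (B * (norm z ^ degree p / norm z)) / norm z ^ degree p"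
      using elim by (intro divide_right_mono) auto
    also have "(B * (norm z ^ degree p / norm z)) / norm z ^ degree p = B * norm (inverse z)"
      using elim by (simp add: norm_inverse divide_inverse)
    finally show ?case by (simp add: norm_divide norm_power)
  qed
  have "((\<lambda>z::complex. B * norm (inverse z)) \<longlongrightarrow> B * norm (0::complex)) at_infinity"
    by (intro tendsto_intros tendsto_inverse_0)
  then have "((\<lambda>z. poly p z / z ^ degree p) \<longlongrightarrow> 0) at_infinity"
    by (intro Lim_null_comparison[OF ev]) simp
  then have "lead_coeff p = 0"
    using poly_divide_tendsto_aux tendsto_unique trivial_limit_at_infinity by blast
  then show False using p by simp
qed

lemma ord_at_isCont: "isCont f a \<Longrightarrow> ord_at a 0 f"
proof -
  assume "isCont f a"
  then have "((\<lambda>z. norm (f z)) \<longlongrightarrow> norm (f a)) (at a)" by (intro tendsto_norm) (simp add: isCont_def)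
  then have "\<forall>\<^sub>F z in at a. norm (f z) < norm (f a) + 1" by (rule order_tendstoD) simp
  then show ?thesis unfolding ord_le_def
    by (intro exI[of _ "norm (f a) + 1"]) (auto elim: eventually_mono)
qed

lemma poly_root_factor: "poly p a = 0 \<Longrightarrow> \<exists>q. p = [:- a, 1:] * (q::complex poly)"
  by (metis dvdE poly_eq_0_iff_dvd)

lemma ord_at_linear: "ord_at a (-1) (\<lambda>z. z - a)"
  unfolding ord_le_def by (rule exI[of _ 1]) (simp add: power_int_minus norm_divide)

lemma ord_at_poly_root:
  assumes "poly p a = 0" shows "ord_at a (-1) (poly p)"
proof -
  obtain q where q: "p = [:- a, 1:] * q" using poly_root_factor[OF assms] by blast
  have "ord_at a (-1) (\<lambda>z. (z - a) * poly q z)"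
    by (rule pt.ord_mult'[OF ord_at_linear ord_at_isCont[OF poly_isCont]]) auto
  moreover have "(\<lambda>z. (z - a) * poly q z) = poly p" by (auto simp: q algebra_simps)
  ultimately show ?thesis by simp
qed

lemma ord_at_inverse_simple_root:
  assumes "poly p a = 0" "poly (pderiv p) a \<noteq> 0" shows "ord_at a 1 (\<lambda>z. 1 / poly p z)"
proof -
  obtain q where q: "p = [:- a, 1:] * q" using poly_root_factor[OF assms(1)] by blast
  have "pderiv p = [:- a, 1:] * pderiv q + q"
    by (simp add: q pderiv_mult pderiv_pCons del: mult_pCons_left)
  then have "poly q a \<noteq> 0" using assms(2) by simp
  then have "ord_at a 0 (\<lambda>z. 1 / poly q z)" by (intro ord_at_isCont continuous_intros) auto
  moreover have "ord_at a 1 (\<lambda>z. 1 / (z - a))" unfolding ord_le_def by (rule exI[of _ 1]) simp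
  ultimately have "ord_at a 1 (\<lambda>z. 1 / (z - a) * (1 / poly q z))" by (intro pt.ord_mult') auto
  moreover have "(\<lambda>z. 1 / (z - a) * (1 / poly q z)) = (\<lambda>z. 1 / poly p z)" by (auto simp: q algebra_simps)
  ultimately show ?thesis by simp
qed

lemma ord_at_0_tendsto_0:
  assumes "ord_at a 0 f" "ord_at a (-1) g" shows "((\<lambda>z. f z * g z) \<longlongrightarrow> 0) (at a)"
proof -
  have "ord_at a (-1) (\<lambda>z. f z * g z)" using pt.ord_mult'[OF assms] by simp
  then obtain B where B: "\<forall>\<^sub>F z in at a. norm (f z * g z) \<le> B * norm (z - a)"
    by (auto simp: ord_le_def power_int_minus norm_divide)
  have "((\<lambda>z. B * norm (z - a)) \<longlongrightarrow> B * norm (a - a)) (at a)" by (intro tendsto_intros)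
  then show ?thesis using Lim_null_comparison[OF B] by simp
qed

lemma poly_finite_roots_ev: "p \<noteq> 0 \<Longrightarrow> \<forall>\<^sub>F z in at a. poly p z \<noteq> (0::complex)"
  using poly_roots_finite[of p] by (metis (mono_tags, lifting) eventually_at_filter eventually_mono finite_imp_closed islimpt_finite islimpt_iff_eventually mem_Collect_eq)

lemma poly_finite_roots_inf: "p \<noteq> 0 \<Longrightarrow> \<forall>\<^sub>F z in at_infinity. poly p z \<noteq> (0::complex)"
proof -
  assume "p \<noteq> 0"
  then have "bounded {z. poly p z = 0}" by (intro finite_imp_bounded poly_roots_finite)
  then obtain b where b: "\<And>z. poly p z = 0 \<Longrightarrow> norm z \<le> b" by (auto simp: bounded_iff)
  show ?thesis unfolding eventually_at_infinity
    by (rule exI[of _ "b + 1"]) (use b in force)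
qed

text \<open>
  Boundedness of \<open>P / Q = f\<close> at a zero of \<open>Q\<close> forces \<open>P\<close> to vanish there, so a linear factor cancels;
  induction on the degree. The exceptional set \<open>X\<close> absorbs the cancelled zeros, at which nothing
  is known about the values of \<open>f\<close>.
\<close>

lemma bounded_quotient_dvd:
  assumes "Q \<noteq> 0" "finite X" "\<And>z. z \<notin> X \<Longrightarrow> f z * poly Q z = poly P z"
    "\<And>a. poly Q a = 0 \<Longrightarrow> ord_at a 0 f"
  shows "Q dvd (P :: complex poly)"
  using assms
proof (induction "degree Q" arbitrary: P Q X)
  case 0
  then have "is_unit Q" by (metis is_unit_iff_degree)
  then show ?case by (rule unit_imp_dvd)
next
  case (Suc n)
  have "\<not> constant (poly Q)" using Suc.hyps(2) by (simp add: constant_degree)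
  then obtain a where a: "poly Q a = 0" using fundamental_theorem_of_algebra by blast
  have ev: "\<forall>\<^sub>F z in at a. z \<notin> X"
    using Suc.prems(2) by (metis (mono_tags, lifting) islimpt_finite islimpt_iff_eventually)
  have "((\<lambda>z. f z * poly Q z) \<longlongrightarrow> 0) (at a)"
    using ord_at_0_tendsto_0 Suc.prems(4)[OF a] ord_at_poly_root[OF a] by blast
  then have "(poly P \<longlongrightarrow> 0) (at a)"
    by (rule Lim_transform_eventually) (use ev Suc.prems(3) in \<open>auto elim: eventually_mono\<close>)
  moreover have "(poly P \<longlongrightarrow> poly P a) (at a)" by (rule isContD[OF poly_isCont])
  ultimately have Pa: "poly P a = 0" using tendsto_unique trivial_limit_at by blast
  obtain Q' P' where Q': "Q = [:- a, 1:] * Q'" and P': "P = [:- a, 1:] * P'"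
    using poly_root_factor a Pa by blast
  have "Q' \<noteq> 0" using Q' Suc.prems(1) by auto
  have "Q' dvd P'"
  proof (rule Suc.hyps(1))
    have "degree Q = degree [:- a, 1:] + degree Q'"
      unfolding Q' using \<open>Q' \<noteq> 0\<close> by (intro degree_mult_eq) auto
    then show "n = degree Q'" using Suc.hyps(2) by simp
    show "Q' \<noteq> 0" by fact
    show "ord_at b 0 f" if "poly Q' b = 0" for b using Suc.prems(4) that Q' by simp
    show "finite (insert a X)" using Suc.prems(2) by simp
  next
    fix z assume z: "z \<notin> insert a X"
    then have "f z * poly Q z = poly P z" using Suc.prems(3) by blast
    then have "(z - a) * (f z * poly Q' z) = (z - a) * poly P' z"
      by (simp add: Q' P' algebra_simps)
    then show "f z * poly Q' z = poly P' z" using z by simp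
  qed
  then show ?case unfolding P' Q' by (intro mult_dvd_mono) auto
qed

lemma rational_liouville:
  assumes Q: "Q \<noteq> 0" and eq: "\<And>z. poly Q z \<noteq> 0 \<Longrightarrow> f z = poly P z / poly Q z"
    and pole: "\<And>a. poly Q a = 0 \<Longrightarrow> ord_at a 0 f" and inf: "ord_inf k f"
  obtains S where "\<And>z. poly Q z \<noteq> 0 \<Longrightarrow> f z = poly S z" "S = 0 \<or> int (degree S) \<le> k"
proof -
  have "Q dvd P"
    by (rule bounded_quotient_dvd[OF Q poly_roots_finite[OF Q], of f])
      (use eq pole in \<open>auto simp: field_simps\<close>)
  then obtain S where S: "P = Q * S" by (elim dvdE)
  have f: "f z = poly S z" if "poly Q z \<noteq> 0" for z using eq[OF that] that by (simp add: S)
  have "ord_inf k (poly S)"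
    by (rule inf.ord_cong[OF _ inf]) (use poly_finite_roots_inf[OF Q] f in \<open>auto elim: eventually_mono\<close>)
  then show thesis using that f ord_inf_poly_degree by blast
qed

section \<open>Determinants, adjugates and kernels\<close>

definition adjugate :: "complex ^ 'n ^ 'n \<Rightarrow> complex ^ 'n ^ ('n::finite)" where
  "adjugate A = (\<chi> k m. det (\<chi> i j. if j = k then axis m 1 $ i else A $ i $ j))"

lemma matrix_inv_unique:
  assumes "A ** B = mat 1" shows "matrix_inv A = (B :: complex ^ 'n ^ ('n::finite))"
proof -
  have B: "B ** A = mat 1" using assms matrix_left_right_inverse by blast
  then have "\<exists>A'. A ** A' = mat 1 \<and> A' ** A = mat 1" using assms by blast
  then have "A ** matrix_inv A = mat 1 \<and> matrix_inv A ** A = mat 1"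
    unfolding matrix_inv_def by (rule someI_ex)
  then have "B ** A ** matrix_inv A = B" by (simp flip: matrix_mul_assoc)
  then show ?thesis using B by simp
qed

lemma matrix_inv_inverse:
  assumes "det A \<noteq> 0"
  shows "A ** matrix_inv A = mat 1" "matrix_inv A ** A = (mat 1 :: complex ^ 'n ^ ('n::finite))"
proof -
  obtain B where B: "A ** B = mat 1" "B ** A = mat 1"
    using assms invertible_det_nz invertible_def by blast
  then show "A ** matrix_inv A = mat 1" "matrix_inv A ** A = mat 1"
    using matrix_inv_unique[OF B(1)] by auto
qed

lemma matrix_inv_adjugate:
  fixes A :: "complex ^ 'n ^ ('n::finite)"
  assumes "det A \<noteq> 0" shows "matrix_inv A $ k $ m = adjugate A $ k $ m / det A"
proof -
  have "A *v (matrix_inv A *v axis m 1) = axis m 1"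
    using matrix_inv_inverse[OF assms] by (simp add: matrix_vector_mul_assoc)
  then have "matrix_inv A *v axis m 1 = (\<chi> k. det (\<chi> i j. if j = k then axis m 1 $ i else A $ i $ j) / det A)"
    using cramer[OF assms] by blast
  then have "(matrix_inv A *v axis m 1) $ k = adjugate A $ k $ m / det A" by (simp add: adjugate_def)
  then show ?thesis by (simp add: matrix_vector_mult_def axis_def if_distrib cong: if_cong)
qed

text \<open>
  A nonzero entry of the adjugate means that replacing column \<open>k\<close> of \<open>A\<close> by a unit vector gives an
  invertible matrix \<open>B\<close>. It maps every \<open>x\<close> in the kernel of \<open>A\<close> to \<open>x $ k\<close> times a fixed vector, so
  the kernel is at most one-dimensional.
\<close>

lemma kernel_proportional:
  fixes A :: "complex ^ 'n ^ ('n::finite)"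
  assumes M: "adjugate A $ k $ l \<noteq> 0" and u: "A *v u = 0" and w: "A *v w = 0"
  shows "w $ k * u $ j = u $ k * w $ j"
proof -
  define B where "B = (\<chi> i j. if j = k then axis l 1 $ i else A $ i $ j)"
  have detB: "det B \<noteq> 0" using M by (simp add: adjugate_def B_def)
  have Bv: "B *v x = x $ k *s (axis l 1 - column k A)" if "A *v x = 0" for x
  proof -
    have "(B *v x) $ i = (A *v x) $ i + x $ k * (axis l 1 $ i - A $ i $ k)" for i
    proof -
      have "(B *v x) $ i = (\<Sum>j\<in>UNIV. A $ i $ j * x $ j + (if j = k then (axis l 1 $ i - A $ i $ k) * x $ k else 0))"
        unfolding matrix_vector_mult_def B_def by (auto intro!: sum.cong simp: algebra_simps)
      then show ?thesis by (simp add: sum.distrib matrix_vector_mult_def mult_ac)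
    qed
    then show ?thesis using that by (simp add: vec_eq_iff column_def algebra_simps)
  qed
  let ?y = "w $ k *s u - u $ k *s w"
  have "B *v ?y = 0"
    by (simp add: matrix_vector_mult_diff_distrib vector_scalar_commute Bv[OF u] Bv[OF w] vec_eq_iff)
  then have "?y = 0"
    using detB by (metis invertible_det_nz invertible_left_inverse matrix_left_invertible_ker)
  then show ?thesis by (simp add: vec_eq_iff)
qed

lemma cpartial_prod:
  assumes "finite A" "\<And>i. i \<in> A \<Longrightarrow> cdiff (f i) x"
  shows "cdiff (\<lambda>x. \<Prod>i\<in>A. f i x) x \<and>
    cpartial k (\<lambda>x. \<Prod>i\<in>A. f i x) x = (\<Sum>i\<in>A. cpartial k (f i) x * (\<Prod>j\<in>A - {i}. f j x))"
  using assms
proof (induction A rule: finite_induct)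
  case (insert a A)
  have IH: "cdiff (\<lambda>x. \<Prod>i\<in>A. f i x) x"
    "cpartial k (\<lambda>x. \<Prod>i\<in>A. f i x) x = (\<Sum>i\<in>A. cpartial k (f i) x * (\<Prod>j\<in>A - {i}. f j x))"
    using insert by auto
  have "(\<Sum>i\<in>A. cpartial k (f i) x * (\<Prod>j\<in>insert a A - {i}. f j x)) =
    f a x * (\<Sum>i\<in>A. cpartial k (f i) x * (\<Prod>j\<in>A - {i}. f j x))"
    unfolding sum_distrib_left
  proof (rule sum.cong)
    fix i assume i: "i \<in> A"
    then have "insert a A - {i} = insert a (A - {i})" using insert by auto
    then show "cpartial k (f i) x * (\<Prod>j\<in>insert a A - {i}. f j x) = f a x * (cpartial k (f i) x * (\<Prod>j\<in>A - {i}. f j x))"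
      using insert by simp
  qed simp
  moreover have "insert a A - {a} = A" using insert by auto
  ultimately show ?case using insert.hyps insert.prems IH by (simp add: cdiff_mult cpartial_mult)
qed auto

text \<open>
  Jacobi's formula. By the product rule the derivative is the sum over \<open>i\<close> of the determinants with
  row \<open>i\<close> differentiated; the differentiated row is a combination of the rows of \<open>G x\<close>, and Cramer's
  rule reads off the coefficient of row \<open>i\<close>.
\<close>

lemma cpartial_det:
  fixes G :: "complex ^ 'n \<Rightarrow> complex ^ 'n ^ ('n::finite)"
  assumes d: "\<And>i j. cdiff (\<lambda>x. G x $ i $ j) x" and nz: "det (G x) \<noteq> 0"
  shows "cpartial k (\<lambda>x. det (G x)) x =
    det (G x) * (\<Sum>i\<in>UNIV. \<Sum>j\<in>UNIV. cpartial k (\<lambda>x. G x $ i $ j) x * matrix_inv (G x) $ j $ i)"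
proof -
  let ?d = "\<lambda>i j. cpartial k (\<lambda>x. G x $ i $ j) x"
  let ?m = "matrix_inv (G x)"
  have "cpartial k (\<lambda>x. det (G x)) x = (\<Sum>p | p permutes UNIV. of_int (sign p) *
     (\<Sum>i\<in>UNIV. ?d i (p i) * (\<Prod>j\<in>UNIV - {i}. G x $ j $ p j)))"
    unfolding det_def
    by (simp add: cpartial_sum cpartial_cmult cdiff_mult cpartial_prod[of UNIV, OF _ d])
  also have "\<dots> = (\<Sum>i\<in>UNIV. \<Sum>p | p permutes UNIV. of_int (sign p) * (?d i (p i) * (\<Prod>j\<in>UNIV - {i}. G x $ j $ p j)))"
    unfolding sum_distrib_left by (rule sum.swap)
  also have "\<dots> = (\<Sum>i\<in>UNIV. det (\<chi> a b. if a = i then ?d i b else G x $ a $ b))"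
  proof (rule sum.cong[OF refl])
    fix i :: 'n
    have "(\<Prod>j\<in>UNIV. if j = i then ?d i (p j) else G x $ j $ p j) = ?d i (p i) * (\<Prod>j\<in>UNIV - {i}. G x $ j $ p j)" for p
      by (subst prod.remove[of _ i]) (auto intro!: prod.cong)
    then show "(\<Sum>p | p permutes UNIV. of_int (sign p) * (?d i (p i) * (\<Prod>j\<in>UNIV - {i}. G x $ j $ p j))) =
      det (\<chi> a b. if a = i then ?d i b else G x $ a $ b)"
      by (simp add: det_def)
  qed
  also have "\<dots> = (\<Sum>i\<in>UNIV. (\<Sum>j\<in>UNIV. ?d i j * ?m $ j $ i) * det (G x))"
  proof (rule sum.cong[OF refl])
    fix i :: 'n
    define y :: "complex ^ 'n" where "y = (\<chi> l. \<Sum>j\<in>UNIV. ?d i j * ?m $ j $ l)"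
    have "(\<Sum>l\<in>UNIV. y $ l * G x $ l $ b) = ?d i b" for b
    proof -
      have "(\<Sum>l\<in>UNIV. y $ l * G x $ l $ b) = (\<Sum>j\<in>UNIV. ?d i j * (\<Sum>l\<in>UNIV. ?m $ j $ l * G x $ l $ b))"
        by (simp add: y_def sum_distrib_left sum_distrib_right mult.assoc) (rule sum.swap)
      also have "\<dots> = (\<Sum>j\<in>UNIV. ?d i j * (?m ** G x) $ j $ b)" by (simp add: matrix_matrix_mult_def)
      also have "\<dots> = ?d i b" by (simp add: matrix_inv_inverse[OF nz] mat_def if_distrib cong: if_cong)
      finally show ?thesis .
    qed
    then have "(\<chi> a b. if a = i then ?d i b else G x $ a $ b) =
        (\<chi> a. if a = i then \<Sum>l\<in>UNIV. y $ l *s row l (G x) else row a (G x))"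
      by (auto simp: vec_eq_iff row_def)
    then show "det (\<chi> a b. if a = i then ?d i b else G x $ a $ b) = (\<Sum>j\<in>UNIV. ?d i j * ?m $ j $ i) * det (G x)"
      using cramer_lemma_transpose[where x=y and A="G x" and k=i] by (simp add: y_def)
  qed
  finally show ?thesis by (simp add: sum_distrib_left mult_ac)
qed

lemma polyfun_det:
  fixes G :: "complex ^ 'm::finite \<Rightarrow> complex ^ 'n ^ ('n::finite)"
  assumes "\<And>i j. polyfun (k j) (\<lambda>x. G x $ i $ j)"
  shows "polyfun (\<Sum>j\<in>UNIV. k j) (\<lambda>x. det (G x))"
  unfolding det_def
proof (intro polyfun_sum polyfun_cmult)
  fix p :: "'n \<Rightarrow> 'n" assume "p \<in> {p. p permutes UNIV}"
  then have p: "bij p" by (simp add: permutes_bij)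
  have "polyfun (\<Sum>i\<in>UNIV. k (p i)) (\<lambda>x. \<Prod>i\<in>UNIV. G x $ i $ p i)"
    by (intro polyfun_prod assms)
  moreover have "(\<Sum>i\<in>UNIV. k (p i)) = (\<Sum>j\<in>UNIV. k j)"
    using sum.reindex_bij_betw[of p UNIV UNIV k] p by simp
  ultimately show "polyfun (\<Sum>j\<in>UNIV. k j) (\<lambda>x. \<Prod>i\<in>UNIV. G x $ i $ p i)" by simp
qed

section \<open>Cometrics with tangential boundary\<close>

text \<open>
  The hypotheses in a form that survives linear changes of coordinates. In \<open>generic\<close>, the polynomial
  \<open>c\<close> describes the exceptional directions at the base point \<open>x0\<close>: on the other lines \<open>D\<close> has only
  simple zeros, and \<open>2 n\<close> of them.
\<close>

locale cometric =
  fixes G :: "complex ^ 'n \<Rightarrow> complex ^ 'n ^ ('n::finite)" and L :: "complex ^ 'n \<Rightarrow> complex ^ 'n"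
  fixes D :: "complex ^ 'n \<Rightarrow> complex" and d :: "complex ^ 'n \<Rightarrow> complex ^ 'n"
  defines D_def: "D \<equiv> \<lambda>x. det (G x)" and d_def: "d \<equiv> \<lambda>x. \<chi> i. cpartial i D x"
  assumes sym: "G x $ i $ j = G x $ j $ i"
    and polyG: "polyfun 2 (\<lambda>x. G x $ i $ j)"
    and polyL: "\<exists>k. polyfun k (\<lambda>x. L x $ i)"
    and tangent: "G x *v d x = D x *s L x"
    and generic: "\<exists>x0 c k. D x0 \<noteq> 0 \<and> polyfun k c \<and> (\<exists>v. c v \<noteq> 0) \<and>
      (\<forall>v. c v \<noteq> 0 \<longrightarrow> (\<forall>z. D (x0 + z *s v) = 0 \<longrightarrow> (\<Sum>i\<in>UNIV. d (x0 + z *s v) $ i * v $ i) \<noteq> 0) \<and>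
        (\<exists>l. l \<noteq> 0 \<and> ((\<lambda>z. D (x0 + z *s v) / z ^ (2 * CARD('n))) \<longlongrightarrow> l) at_infinity))"
begin

definition E :: "complex ^ 'n \<Rightarrow> complex" where "E x = (\<Sum>i\<in>UNIV. L x $ i * d x $ i)"
definition m :: "complex ^ 'n \<Rightarrow> complex ^ 'n ^ 'n" where "m x = matrix_inv (G x)"
definition M :: "complex ^ 'n \<Rightarrow> complex ^ 'n ^ 'n" where "M x = adjugate (G x)"

lemma polyD: "polyfun (2 * CARD('n)) D"
  using polyfun_det[of "\<lambda>_. 2" G] polyG by (simp add: D_def mult.commute)

lemma polyd: "polyfun (2 * CARD('n) - 1) (\<lambda>x. d x $ i)"
  using polyfun_cpartial[OF polyD] by (simp add: d_def)

lemma polyM: "polyfun (2 * (CARD('n) - 1)) (\<lambda>x. M x $ i $ j)"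
proof -
  have "polyfun (\<Sum>l\<in>UNIV. if l = i then 0 else 2) (\<lambda>x. det (\<chi> k l. if l = i then axis j 1 $ k else G x $ k $ l))"
    by (rule polyfun_det) (use polyG polyfun_const in auto)
  moreover have "(\<Sum>l\<in>(UNIV::'n set). if l = i then 0 else 2) = (2 * (CARD('n) - 1) :: nat)"
    by (simp add: sum.If_cases Compl_eq_Diff_UNIV card_Diff_singleton)
  ultimately show ?thesis by (simp add: M_def adjugate_def)
qed

lemma polyE: "\<exists>k. polyfun k E"
proof -
  obtain k where k: "\<And>i. polyfun (k i) (\<lambda>x. L x $ i)" using polyL by metis
  have "polyfun (Max (range k) + (2 * CARD('n) - 1)) (\<lambda>x. \<Sum>i\<in>UNIV. L x $ i * d x $ i)"
    by (intro polyfun_sum polyfun.mult polyd polyfun.weaken[OF k]) auto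
  then show ?thesis by (auto simp: E_def[abs_def])
qed

lemma D_line: "\<exists>p. \<forall>z. D (x + z *s v) = poly p z"
  using polyfun_on_line[OF polyD] by blast

lemma dense_eq:
  assumes f: "polyfun k f" and h: "polyfun l h" and eq: "\<And>x. D x \<noteq> 0 \<Longrightarrow> f x = h x"
  shows "f x = h x"
proof -
  obtain x0 where x0: "D x0 \<noteq> 0" using generic by blast
  let ?v = "x0 - x"
  obtain p where p: "\<And>z. D (x + z *s ?v) = poly p z" using D_line by blast
  obtain q where q: "\<And>z. f (x + z *s ?v) = poly q z" using polyfun_on_line[OF f] by blast
  obtain r where r: "\<And>z. h (x + z *s ?v) = poly r z" using polyfun_on_line[OF h] by blast
  have "poly ((q - r) * p) z = 0" for z
    using eq[of "x + z *s ?v", unfolded p q r] by auto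
  then have "(q - r) * p = 0" by (metis poly_all_0_iff_0)
  moreover have "p \<noteq> 0" using p[of 1] x0 by auto
  ultimately have "q = r" by simp
  then show ?thesis using q[of 0] r[of 0] by simp
qed

lemma m_inv: assumes "D x \<noteq> 0"
  shows "G x ** m x = mat 1" "m x ** G x = mat 1"
  using matrix_inv_inverse assms by (auto simp: m_def D_def)

lemma m_M: "D x \<noteq> 0 \<Longrightarrow> m x $ i $ j = M x $ i $ j / D x"
  using matrix_inv_adjugate by (simp add: m_def M_def D_def)

lemma m_sym: assumes "D x \<noteq> 0" shows "m x $ i $ j = m x $ j $ i"
proof -
  have "transpose (G x) = G x" by (simp add: vec_eq_iff transpose_def sym)
  then have "G x ** transpose (m x) = transpose (m x ** G x)" by (simp add: matrix_transpose_mul)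
  then have "G x ** transpose (m x) = mat 1" by (simp add: m_inv[OF assms] transpose_mat)
  then have "m x = transpose (m x)" unfolding m_def by (rule matrix_inv_unique)
  from arg_cong[OF this, of "\<lambda>A. A $ i $ j"] show ?thesis by (simp add: transpose_def)
qed

lemma G_M: "(\<Sum>k\<in>UNIV. G x $ i $ k * M x $ k $ j) = (if i = j then D x else 0)"
proof (rule dense_eq)
  show "polyfun (2 + 2 * (CARD('n) - 1)) (\<lambda>x. \<Sum>k\<in>UNIV. G x $ i $ k * M x $ k $ j)"
    by (intro polyfun_sum polyfun.mult polyG polyM)
  show "polyfun (2 * CARD('n)) (\<lambda>x. if i = j then D x else 0)"
    by (cases "i = j") (use polyD polyfun_const in auto)
  fix x assume D: "D x \<noteq> 0"
  have "(\<Sum>k\<in>UNIV. G x $ i $ k * M x $ k $ j) = D x * (G x ** m x) $ i $ j"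
    using D by (simp add: matrix_matrix_mult_def m_M sum_distrib_left)
  then show "(\<Sum>k\<in>UNIV. G x $ i $ k * M x $ k $ j) = (if i = j then D x else 0)"
    by (simp add: m_inv[OF D] mat_def)
qed

lemma M_sym: "M x $ i $ j = M x $ j $ i"
  by (rule dense_eq[OF polyM polyM]) (use m_sym m_M in force)

lemma d_ML: "d x = M x *v L x"
proof -
  obtain k where k: "\<And>i. polyfun (k i) (\<lambda>x. L x $ i)" using polyL by metis
  have "d x $ i = (\<Sum>j\<in>UNIV. M x $ i $ j * L x $ j)" for i
  proof (rule dense_eq[OF polyd])
    show "polyfun (2 * (CARD('n) - 1) + Max (range k)) (\<lambda>x. \<Sum>j\<in>UNIV. M x $ i $ j * L x $ j)"
      by (intro polyfun_sum polyfun.mult polyM polyfun.weaken[OF k]) auto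
    fix x assume D: "D x \<noteq> 0"
    have "d x = m x *v (D x *s L x)"
      by (metis D m_inv(2) matrix_vector_mul_assoc matrix_vector_mul_lid tangent)
    then show "d x $ i = (\<Sum>j\<in>UNIV. M x $ i $ j * L x $ j)"
      using D by (simp add: matrix_vector_mult_def m_M)
  qed
  then show ?thesis by (simp add: vec_eq_iff matrix_vector_mult_def)
qed

text \<open>
  From \<open>G d = D L\<close> one gets \<open>d = M L\<close> for the adjugate \<open>M\<close> of \<open>G\<close>. So \<open>M\<close> is nonzero at \<open>x\<close>, the
  kernel of \<open>G x\<close> is one-dimensional, and \<open>d\<close> spans it. The columns of the symmetric matrix \<open>M\<close> lie in
  this kernel, hence \<open>M = a d d\<^sup>T\<close>; inserting this into \<open>d = M L\<close> gives \<open>a E = 1\<close>.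
\<close>

lemma boundary_kernel:
  assumes "D x = 0" "d x \<noteq> 0"
  shows "E x \<noteq> 0" "E x * M x $ i $ j = d x $ i * d x $ j" "G x *v u = 0 \<Longrightarrow> \<exists>c. u = c *s d x"
proof -
  have "M x \<noteq> 0" using assms(2) d_ML[of x] by auto
  then obtain k l where kl: "M x $ k $ l \<noteq> 0" by (auto simp: vec_eq_iff)
  have Gd: "G x *v d x = 0" using tangent[of x] assms(1) by simp
  note kp = kernel_proportional[OF kl[unfolded M_def]]
  have dk: "d x $ k \<noteq> 0"
  proof
    assume "d x $ k = 0"
    have "G x *v column l (M x) = 0"
      using G_M[of x _ l] assms(1) by (simp add: vec_eq_iff matrix_vector_mult_def column_def)
    then have "M x $ k $ l * d x $ j = d x $ k * M x $ j $ l" for j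
      using kp[OF Gd, of "column l (M x)" j] by (simp add: column_def)
    then show False using kl assms(2) \<open>d x $ k = 0\<close> by (simp add: vec_eq_iff)
  qed
  show ker: "\<exists>c. u = c *s d x" if "G x *v u = 0" for u
  proof
    have "u $ k * d x $ j = d x $ k * u $ j" for j using kp[OF Gd that] .
    then show "u = (u $ k / d x $ k) *s d x" using dk by (simp add: vec_eq_iff field_simps)
  qed
  have col: "\<exists>c. \<forall>i. M x $ i $ j = c * d x $ i" for j
  proof -
    have "G x *v column j (M x) = 0"
      using G_M[of x _ j] assms(1) by (simp add: vec_eq_iff matrix_vector_mult_def column_def)
    then obtain c where "column j (M x) = c *s d x" using ker by blast
    then show ?thesis by (auto simp: vec_eq_iff column_def)
  qed
  then obtain c where c: "\<And>i j. M x $ i $ j = c j * d x $ i" by metis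
  define a where "a = c k / d x $ k"
  have Ma: "M x $ i $ j = a * d x $ i * d x $ j" for i j
  proof -
    have "c j * d x $ k = c k * d x $ j" using c[of k j] c[of j k] M_sym[of x k j] by simp
    then have "c j = a * d x $ j" using dk by (simp add: a_def field_simps)
    then show ?thesis using c by simp
  qed
  have "d x $ k = (\<Sum>j\<in>UNIV. M x $ k $ j * L x $ j)"
    by (subst d_ML) (simp add: matrix_vector_mult_def)
  also have "\<dots> = a * E x * d x $ k"
    by (simp add: Ma E_def sum_distrib_left sum_distrib_right mult_ac)
  finally have aE: "a * E x = 1" using dk by simp
  then show "E x \<noteq> 0" by auto
  show "E x * M x $ i $ j = d x $ i * d x $ j" using aE by (simp add: Ma mult_ac)
qed

text \<open>
  Regular functions on the complement of the boundary \<open>D = 0\<close>. Values on the boundary are arbitrary.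
\<close>

definition regular :: "(complex ^ 'n \<Rightarrow> complex) \<Rightarrow> bool" where
  "regular f \<longleftrightarrow> (\<exists>k a N. polyfun k a \<and> (\<forall>x. D x \<noteq> 0 \<longrightarrow> f x = a x / D x ^ N))"

lemma regular_poly: "polyfun k f \<Longrightarrow> regular f"
  unfolding regular_def by (rule exI[of _ k], rule exI[of _ f], rule exI[of _ 0]) simp

lemma regular_const: "regular (\<lambda>x. a)" by (rule regular_poly[OF polyfun.const])

lemma regular_add: assumes "regular f" "regular g" shows "regular (\<lambda>x. f x + g x)"
proof -
  obtain k a N where "polyfun k a" "\<forall>x. D x \<noteq> 0 \<longrightarrow> f x = a x / D x ^ N"
    using assms(1) by (auto simp: regular_def)
  moreover obtain l b K where "polyfun l b" "\<forall>x. D x \<noteq> 0 \<longrightarrow> g x = b x / D x ^ K"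
    using assms(2) by (auto simp: regular_def)
  ultimately have "polyfun (k + K * (2 * CARD('n)) + (l + N * (2 * CARD('n)))) (\<lambda>x. a x * D x ^ K + b x * D x ^ N)"
    "\<forall>x. D x \<noteq> 0 \<longrightarrow> f x + g x = (a x * D x ^ K + b x * D x ^ N) / D x ^ (N + K)"
    by (auto intro!: polyfun.add polyfun.weaken[OF polyfun.mult[OF _ polyfun_power[OF polyD]]] simp: power_add field_simps)
  then show ?thesis unfolding regular_def by blast
qed

lemma regular_mult: assumes "regular f" "regular g" shows "regular (\<lambda>x. f x * g x)"
proof -
  obtain k a N where "polyfun k a" "\<forall>x. D x \<noteq> 0 \<longrightarrow> f x = a x / D x ^ N"
    using assms(1) by (auto simp: regular_def)
  moreover obtain l b K where "polyfun l b" "\<forall>x. D x \<noteq> 0 \<longrightarrow> g x = b x / D x ^ K"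
    using assms(2) by (auto simp: regular_def)
  ultimately have "polyfun (k + l) (\<lambda>x. a x * b x)"
    "\<forall>x. D x \<noteq> 0 \<longrightarrow> f x * g x = (a x * b x) / D x ^ (N + K)"
    by (auto intro!: polyfun.mult simp: power_add)
  then show ?thesis unfolding regular_def by blast
qed

lemma regular_sum: "(\<And>i. i \<in> A \<Longrightarrow> regular (f i)) \<Longrightarrow> regular (\<lambda>x. \<Sum>i\<in>A. f i x)"
  by (induction A rule: infinite_finite_induct) (auto simp: regular_const intro: regular_add)

lemma regular_m: "regular (\<lambda>x. m x $ i $ j)"
  unfolding regular_def
  by (intro exI[of _ "2 * (CARD('n) - 1)"] exI[of _ "\<lambda>x. M x $ i $ j"] exI[of _ 1] conjI polyM) (simp add: m_M)

lemma regular_cong: "regular f \<Longrightarrow> (\<And>x. D x \<noteq> 0 \<Longrightarrow> f x = g x) \<Longrightarrow> regular g"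
  unfolding regular_def by metis

lemma open_U: "open {x. D x \<noteq> 0}"
proof -
  have "continuous_on UNIV D" using polyfun_cont[OF polyD] by (simp add: continuous_at_imp_continuous_on)
  then have "open (D -` (- {0}))" by (intro open_vimage) auto
  then show ?thesis by (simp add: vimage_def)
qed

lemma cpartial_cong_U: "D x \<noteq> 0 \<Longrightarrow> (\<And>y. D y \<noteq> 0 \<Longrightarrow> f y = g y) \<Longrightarrow> cpartial k f x = cpartial k g x"
  by (rule cpartial_transform[OF open_U]) auto

lemma regular_cdiff: assumes "regular f" "D x \<noteq> 0" shows "cdiff f x"
proof -
  obtain k a N where a: "polyfun k a" and f: "\<And>x. D x \<noteq> 0 \<Longrightarrow> f x = a x * inverse (D x ^ N)"
    using assms by (auto simp: regular_def divide_inverse)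
  have "cdiff (\<lambda>x. inverse (D x ^ N)) x"
    using has_grad_inverse[OF cdiffD[OF polyfun_cdiff[OF polyfun_power[OF polyD, of N]]]] assms(2)
    by (auto intro: cdiffI)
  then have "cdiff (\<lambda>x. a x * inverse (D x ^ N)) x"
    using polyfun_cdiff[OF a] by (intro cdiff_mult)
  then have "has_grad (\<lambda>x. a x * inverse (D x ^ N)) (\<chi> i. cpartial i (\<lambda>x. a x * inverse (D x ^ N)) x) x"
    by (rule cdiffD)
  then have "has_grad f (\<chi> i. cpartial i (\<lambda>x. a x * inverse (D x ^ N)) x) x"
    by (rule has_grad_transform[OF _ open_U]) (use assms f in auto)
  then show ?thesis by (rule cdiffI)
qed

definition line_ok :: "complex ^ 'n \<Rightarrow> complex ^ 'n \<Rightarrow> bool" where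
  "line_ok x v \<longleftrightarrow> D x \<noteq> 0 \<and>
     (\<forall>z. D (x + z *s v) = 0 \<longrightarrow> (\<Sum>i\<in>UNIV. d (x + z *s v) $ i * v $ i) \<noteq> 0) \<and>
     (\<exists>l. l \<noteq> 0 \<and> ((\<lambda>z. D (x + z *s v) / z ^ (2 * CARD('n))) \<longlongrightarrow> l) at_infinity)"

text \<open>
  \<open>pole k f\<close> bounds the order of the pole of \<open>f\<close> along the boundary, on the lines where \<open>D\<close> has only
  simple zeros; \<open>growth k f\<close> bounds its degree at infinity on the same lines.
\<close>

definition pole :: "int \<Rightarrow> (complex ^ 'n \<Rightarrow> complex) \<Rightarrow> bool" where
  "pole k f \<longleftrightarrow> (\<forall>x v a. line_ok x v \<longrightarrow> D (x + a *s v) = 0 \<longrightarrow> ord_at a k (\<lambda>z. f (x + z *s v)))"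

definition growth :: "int \<Rightarrow> (complex ^ 'n \<Rightarrow> complex) \<Rightarrow> bool" where
  "growth k f \<longleftrightarrow> (\<forall>x v. line_ok x v \<longrightarrow> ord_inf k (\<lambda>z. f (x + z *s v)))"

lemma pole_add: "pole k f \<Longrightarrow> pole k g \<Longrightarrow> pole k (\<lambda>x. f x + g x)"
  unfolding pole_def using pt.ord_add by blast
lemma pole_mult: "pole k f \<Longrightarrow> pole l g \<Longrightarrow> k + l \<le> n \<Longrightarrow> pole n (\<lambda>x. f x * g x)"
  unfolding pole_def using pt.ord_mult' by blast
lemma pole_sum: "(\<And>i. i \<in> A \<Longrightarrow> pole k (f i)) \<Longrightarrow> pole k (\<lambda>x. \<Sum>i\<in>A. f i x)"
  unfolding pole_def by (intro allI impI pt.ord_sum) blast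
lemma growth_add: "growth k f \<Longrightarrow> growth k g \<Longrightarrow> growth k (\<lambda>x. f x + g x)"
  unfolding growth_def using inf.ord_add by blast
lemma growth_mult: "growth k f \<Longrightarrow> growth l g \<Longrightarrow> k + l \<le> n \<Longrightarrow> growth n (\<lambda>x. f x * g x)"
  unfolding growth_def using inf.ord_mult' by blast
lemma growth_mono: "growth k f \<Longrightarrow> k \<le> l \<Longrightarrow> growth l f"
  unfolding growth_def using inf.ord_mono by blast
lemma growth_sum: "(\<And>i. i \<in> A \<Longrightarrow> growth k (f i)) \<Longrightarrow> growth k (\<lambda>x. \<Sum>i\<in>A. f i x)"
  unfolding growth_def by (intro allI impI inf.ord_sum) blast

lemma pole_poly: assumes "polyfun k f" shows "pole 0 f"
  unfolding pole_def
proof (intro allI impI)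
  fix x v a
  obtain p where "\<And>z. f (x + z *s v) = poly p z" using polyfun_on_line[OF assms] by blast
  then show "ord_at a 0 (\<lambda>z. f (x + z *s v))" using ord_at_isCont[OF poly_isCont] by simp
qed

text \<open>
  On these lines the points of the boundary are simple zeros of \<open>D\<close>, so \<open>d\<close> does not vanish there.
  A polynomial that vanishes at all boundary points with \<open>d \<noteq> 0\<close> therefore vanishes along them to
  first order, as \<open>D\<close> does. Divisibility by \<open>D\<close> is thus checked pointwise.
\<close>

lemma pole_boundary_zero:
  assumes f: "polyfun k f" and z: "\<And>x. D x = 0 \<Longrightarrow> d x \<noteq> 0 \<Longrightarrow> f x = 0"
  shows "pole (- 1) f"
  unfolding pole_def
proof (intro allI impI)
  fix x v a assume ok: "line_ok x v" and D: "D (x + a *s v) = 0"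
  obtain p where p: "\<And>z. f (x + z *s v) = poly p z" using polyfun_on_line[OF f] by blast
  have "d (x + a *s v) \<noteq> 0" using ok D by (auto simp: line_ok_def)
  then have "poly p a = 0" using z D p by metis
  then show "ord_at a (- 1) (\<lambda>z. f (x + z *s v))" unfolding p by (rule ord_at_poly_root)
qed

lemma D_line_deriv: "((\<lambda>z. D (x + z *s v)) has_field_derivative (\<Sum>i\<in>UNIV. d (x + z *s v) $ i * v $ i)) (at z)"
  unfolding d_def by (rule has_grad_direction[OF cdiffD[OF polyfun_cdiff[OF polyD]]])

lemma pole_inverse_D: "pole 1 (\<lambda>x. 1 / D x)"
  unfolding pole_def
proof (intro allI impI)
  fix x v a assume ok: "line_ok x v" and D: "D (x + a *s v) = 0"
  obtain p where p: "\<And>z. D (x + z *s v) = poly p z" using D_line by blast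
  have "(\<Sum>i\<in>UNIV. d (x + a *s v) $ i * v $ i) \<noteq> 0" using ok D by (auto simp: line_ok_def)
  moreover have "(\<Sum>i\<in>UNIV. d (x + a *s v) $ i * v $ i) = poly (pderiv p) a"
    using D_line_deriv[of x v a] poly_DERIV[of p a] unfolding p by (rule DERIV_unique)
  ultimately show "ord_at a 1 (\<lambda>z. 1 / D (x + z *s v))"
    unfolding p using D p by (intro ord_at_inverse_simple_root) auto
qed

lemma pole_inverse_E: "pole 0 (\<lambda>x. 1 / E x)"
  unfolding pole_def
proof (intro allI impI)
  fix x v a assume ok: "line_ok x v" and D: "D (x + a *s v) = 0"
  obtain k where "polyfun k E" using polyE by blast
  then obtain p where p: "\<And>z. E (x + z *s v) = poly p z" using polyfun_on_line by blast
  have "d (x + a *s v) \<noteq> 0" using ok D by (auto simp: line_ok_def)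
  then have "poly p a \<noteq> 0" using boundary_kernel(1)[OF D] p by metis
  then show "ord_at a 0 (\<lambda>z. 1 / E (x + z *s v))" unfolding p
    by (intro ord_at_isCont continuous_intros) auto
qed

lemma growth_poly: assumes "polyfun k f" shows "growth (int k) f"
  unfolding growth_def
proof (intro allI impI)
  fix x v
  obtain p where "degree p \<le> k" "\<And>z. f (x + z *s v) = poly p z" using polyfun_on_line[OF assms] by blast
  then show "ord_inf (int k) (\<lambda>z. f (x + z *s v))" using ord_inf_poly[of p k] by simp
qed

lemma growth_inverse_D: "growth (- 2 * int CARD('n)) (\<lambda>x. 1 / D x)"
  unfolding growth_def
proof (intro allI impI)
  fix x v assume "line_ok x v"
  then obtain l where l: "l \<noteq> 0" "((\<lambda>z. D (x + z *s v) / z ^ (2 * CARD('n))) \<longlongrightarrow> l) at_infinity"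
    by (auto simp: line_ok_def)
  let ?N = "2 * CARD('n)"
  have "((\<lambda>z. norm (inverse (D (x + z *s v) / z ^ ?N))) \<longlongrightarrow> norm (inverse l)) at_infinity"
    using l by (intro tendsto_intros)
  then have "\<forall>\<^sub>F z in at_infinity. norm (inverse (D (x + z *s v) / z ^ ?N)) < norm (inverse l) + 1"
    by (rule order_tendstoD) simp
  then have "\<forall>\<^sub>F z in at_infinity. norm (1 / D (x + z *s v)) \<le> (norm (inverse l) + 1) * norm z powi (- 2 * int CARD('n))"
    using eventually_not_equal_at_infinity[of "0::complex"]
  proof eventually_elim
    case (elim z)
    have "norm z powi (- 2 * int CARD('n)) = inverse (norm z ^ ?N)"
      using power_int_minus[of "norm z" "int ?N"] by (simp only: power_int_of_nat) (simp add: power_int_minus)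
    moreover have "norm (1 / D (x + z *s v)) = norm (inverse (D (x + z *s v) / z ^ ?N)) * inverse (norm z ^ ?N)"
      using elim by (simp add: norm_divide norm_mult norm_power divide_simps)
    ultimately show ?case using elim by (simp add: mult_right_mono)
  qed
  then show "ord_inf (- 2 * int CARD('n)) (\<lambda>z. 1 / D (x + z *s v))" unfolding ord_le_def by blast
qed

lemma growth_congU:
  assumes "growth k f" "\<And>x. D x \<noteq> 0 \<Longrightarrow> f x = g x" shows "growth k g"
  unfolding growth_def
proof (intro allI impI)
  fix x v assume ok: "line_ok x v"
  obtain p where p: "\<And>z. D (x + z *s v) = poly p z" using D_line by blast
  have "p \<noteq> 0" using p[of 0] ok by (auto simp: line_ok_def)
  from poly_finite_roots_inf[OF this] have "\<forall>\<^sub>F z in at_infinity. f (x + z *s v) = g (x + z *s v)"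
    by eventually_elim (use assms(2) p in simp)
  then show "ord_inf k (\<lambda>z. g (x + z *s v))" by (rule inf.ord_cong) (use assms(1) ok in \<open>auto simp: growth_def\<close>)
qed

lemma pole_cong:
  assumes "pole k f" "\<And>x. D x \<noteq> 0 \<Longrightarrow> E x \<noteq> 0 \<Longrightarrow> f x = g x" shows "pole k g"
  unfolding pole_def
proof (intro allI impI)
  fix x v a assume ok: "line_ok x v" and D: "D (x + a *s v) = 0"
  obtain p where p: "\<And>z. D (x + z *s v) = poly p z" using D_line by blast
  have "p \<noteq> 0" using p[of 0] ok by (auto simp: line_ok_def)
  obtain j where "polyfun j E" using polyE by blast
  then obtain q where q: "\<And>z. E (x + z *s v) = poly q z" using polyfun_on_line by blast
  have "d (x + a *s v) \<noteq> 0" using ok D by (auto simp: line_ok_def)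
  then have "q \<noteq> 0" using boundary_kernel(1)[OF D] q[of a] by auto
  from poly_finite_roots_ev[OF \<open>p \<noteq> 0\<close>] poly_finite_roots_ev[OF this]
  have "\<forall>\<^sub>F z in at a. f (x + z *s v) = g (x + z *s v)"
    by eventually_elim (use assms(2) p q in simp)
  then show "ord_at a k (\<lambda>z. g (x + z *s v))" by (rule pt.ord_cong) (use assms(1) ok D in \<open>auto simp: pole_def\<close>)
qed

text \<open>
  Here the maximality of the degree of \<open>D\<close> enters: the adjugate has degree \<open>2 (n - 1)\<close> and \<open>D\<close> has
  degree exactly \<open>2 n\<close>.
\<close>

lemma growth_m: "growth (- 2) (\<lambda>x. m x $ i $ j)"
proof (rule growth_congU)
  show "growth (- 2) (\<lambda>x. M x $ i $ j * (1 / D x))"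
  proof (rule growth_mult[OF growth_poly[OF polyM] growth_inverse_D])
    have "CARD('n) \<ge> 1" by (simp add: Suc_leI)
    then show "int (2 * (CARD('n) - 1)) + - 2 * int CARD('n) \<le> - 2" by linarith
  qed
qed (simp add: m_M)

text \<open>
  On a generic line through \<open>x0\<close>, \<open>f\<close> is a rational function without poles, hence a polynomial of
  the degree allowed by its growth. If the degree is at most 1, its two coefficients are
  \<open>f x0\<close> and the derivative of \<open>f\<close> at \<open>x0\<close> in the direction \<open>v\<close>, which is linear in \<open>v\<close>. So \<open>f\<close> agrees with an
  affine function on a dense set, hence everywhere off the boundary by continuity.
\<close>

lemma rigid:
  assumes f: "regular f" and l: "pole 0 f" and g: "growth 1 f"
  obtains x0 where "D x0 \<noteq> 0" "\<And>x. D x \<noteq> 0 \<Longrightarrow> f x = f x0 + (\<Sum>i\<in>UNIV. cpartial i f x0 * (x - x0) $ i)"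
    "growth 0 f \<Longrightarrow> \<forall>x. D x \<noteq> 0 \<longrightarrow> f x = f x0"
    "growth (- 1) f \<Longrightarrow> \<forall>x. D x \<noteq> 0 \<longrightarrow> f x = 0"
proof -
  obtain x0 c k where x0: "D x0 \<noteq> 0" and c: "polyfun k c" "\<exists>v. c v \<noteq> 0" and ok: "\<And>v. c v \<noteq> 0 \<Longrightarrow> line_ok x0 v"
    using generic unfolding line_ok_def by blast
  obtain j a N where a: "polyfun j a" and fa: "\<And>x. D x \<noteq> 0 \<Longrightarrow> f x = a x / D x ^ N"
    using f by (auto simp: regular_def)
  have on_line: "\<exists>S. (\<forall>z. D (x0 + z *s v) \<noteq> 0 \<longrightarrow> f (x0 + z *s v) = poly S z) \<and> (S = 0 \<or> int (degree S) \<le> n)"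
    if n: "growth n f" and v: "c v \<noteq> 0" for n v
  proof -
    obtain p where p: "\<And>z. D (x0 + z *s v) = poly p z" using D_line by blast
    obtain P where P: "\<And>z. a (x0 + z *s v) = poly P z" using polyfun_on_line[OF a] by blast
    have "p \<noteq> 0" using p[of 0] x0 by auto
    show ?thesis
    \<comment> \<open>The exponent \<open>Suc N\<close> ensures that the denominator vanishes at every zero of \<open>D\<close>, even if \<open>N = 0\<close>: at such points the values of \<open>f\<close> are arbitrary.\<close>
    proof (rule rational_liouville[of "p ^ Suc N" "\<lambda>z. f (x0 + z *s v)" "P * p" n])
      show "p ^ Suc N \<noteq> 0" using \<open>p \<noteq> 0\<close> by simp
      show "f (x0 + z *s v) = poly (P * p) z / poly (p ^ Suc N) z" if "poly (p ^ Suc N) z \<noteq> 0" for z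
        using that fa[of "x0 + z *s v"] by (simp add: p P poly_power)
      show "ord_at b 0 (\<lambda>z. f (x0 + z *s v))" if "poly (p ^ Suc N) b = 0" for b
      proof -
        have "poly p b = 0" using that by (auto simp: poly_power)
        then show ?thesis using l ok[OF v] p[of b] unfolding pole_def by simp
      qed
      show "ord_inf n (\<lambda>z. f (x0 + z *s v))" using n ok[OF v] by (simp add: growth_def)
    qed (use p in \<open>auto simp: poly_power\<close>)
  qed
  have extend: "f x = h x" if D: "D x \<noteq> 0" and h: "\<And>x. isCont h x" and eq: "\<And>v. c v \<noteq> 0 \<Longrightarrow> D (x0 + v) \<noteq> 0 \<Longrightarrow> f (x0 + v) = h (x0 + v)" for x h
  proof -
    obtain w where w: "c w \<noteq> 0" using c by blast
    define u where "u = w - (x - x0)"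
    have "polyfun k (\<lambda>y. c y)" using c by simp
    then obtain q where q: "\<And>z. c ((x - x0) + z *s u) = poly q z" using polyfun_on_line by blast
    have "q \<noteq> 0" using q[of 1] w by (auto simp: u_def)
    have lim: "((\<lambda>z. x + z *s u) \<longlongrightarrow> x) (at 0)"
      using tendsto_add[OF tendsto_const bounded_linear.tendsto[OF bounded_linear_smult tendsto_ident_at[of 0 UNIV], of u], of x] by simp
    have fc: "isCont f x"
      using cdiffD[OF regular_cdiff[OF f D]] unfolding has_grad_def by (rule has_derivative_continuous)
    have lf: "((\<lambda>z. f (x + z *s u)) \<longlongrightarrow> f x) (at 0)" by (rule isCont_tendsto_compose[OF fc lim])
    have lh: "((\<lambda>z. h (x + z *s u)) \<longlongrightarrow> h x) (at 0)" by (rule isCont_tendsto_compose[OF h lim])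
    have ev: "\<forall>\<^sub>F z in at 0. f (x + z *s u) = h (x + z *s u)"
    proof -
      have "((\<lambda>z. D (x + z *s u)) \<longlongrightarrow> D x) (at 0)" by (rule isCont_tendsto_compose[OF polyfun_cont[OF polyD] lim])
      then have "\<forall>\<^sub>F z in at 0. D (x + z *s u) \<noteq> 0" using D by (rule tendsto_imp_eventually_ne)
      moreover have "\<forall>\<^sub>F z in at 0. poly q z \<noteq> 0" by (rule poly_finite_roots_ev) fact
      ultimately show ?thesis
      proof eventually_elim
        case (elim z)
        have "c ((x - x0) + z *s u) \<noteq> 0" using elim q by simp
        from eq[OF this] elim show ?case by simp
      qed
    qed
    have "((\<lambda>z. h (x + z *s u)) \<longlongrightarrow> f x) (at 0)"
      using lf ev by (rule Lim_transform_eventually)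
    then show ?thesis by (rule tendsto_unique[OF trivial_limit_at _ lh])
  qed
  define h where "h = (\<lambda>x. f x0 + (\<Sum>i\<in>UNIV. cpartial i f x0 * (x - x0) $ i))"
  show thesis
  proof (rule that[OF x0])
    have "f x = h x" if D: "D x \<noteq> 0" for x
    proof (rule extend[OF D])
      show "isCont h x" for x unfolding h_def by (intro continuous_intros)
      fix v assume v: "c v \<noteq> 0" and Dv: "D (x0 + v) \<noteq> 0"
      obtain S where S: "\<And>z. D (x0 + z *s v) \<noteq> 0 \<Longrightarrow> f (x0 + z *s v) = poly S z" "S = 0 \<or> int (degree S) \<le> 1"
        using on_line[OF g v] by blast
      have "degree S \<le> 1" using S(2) by auto
      then obtain \<alpha> \<beta> where ab: "S = [:\<alpha>, \<beta>:]"
      proof -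
        have "S = [:coeff S 0, coeff S 1:]"
          by (rule poly_eqI) (use \<open>degree S \<le> 1\<close> in \<open>auto simp: coeff_pCons coeff_eq_0 split: nat.split\<close>)
        then show ?thesis using that by blast
      qed
      have "\<alpha> = f x0" using S(1)[of 0] x0 by (simp add: ab)
      have ev: "\<forall>\<^sub>F z in nhds 0. f (x0 + z *s v) = poly S z"
      proof -
        obtain p where p: "\<And>z. D (x0 + z *s v) = poly p z" using D_line by blast
        have "open (poly p -` (- {0}))" by (intro open_vimage continuous_on_poly continuous_on_id) auto
        then have "\<forall>\<^sub>F z in nhds 0. z \<in> poly p -` (- {0})" using x0 p[of 0] by (intro eventually_nhds_in_open) auto
        then show ?thesis by eventually_elim (use S p in auto)
      qed
      have "((\<lambda>z. f (x0 + z *s v)) has_field_derivative (\<Sum>i\<in>UNIV. (\<chi> i. cpartial i f x0) $ i * v $ i)) (at 0)"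
        by (rule has_grad_direction) (use cdiffD[OF regular_cdiff[OF f x0]] in simp)
      then have "(poly S has_field_derivative (\<Sum>i\<in>UNIV. cpartial i f x0 * v $ i)) (at 0)"
        using DERIV_cong_ev[OF refl ev refl] by simp
      then have "poly (pderiv S) 0 = (\<Sum>i\<in>UNIV. cpartial i f x0 * v $ i)"
        using DERIV_unique poly_DERIV by blast
      moreover have "poly (pderiv S) 0 = \<beta>" by (simp add: ab pderiv_pCons)
      ultimately have "\<beta> = (\<Sum>i\<in>UNIV. cpartial i f x0 * v $ i)" by simp
      then show "f (x0 + v) = h (x0 + v)"
        using S(1)[of 1] Dv \<open>\<alpha> = f x0\<close> by (simp add: ab h_def)
    qed
    then show "f x = f x0 + (\<Sum>i\<in>UNIV. cpartial i f x0 * (x - x0) $ i)" if "D x \<noteq> 0" for x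
      using that by (simp add: h_def)
    show "\<forall>x. D x \<noteq> 0 \<longrightarrow> f x = f x0" if g0: "growth 0 f"
    proof (intro allI impI, rule extend)
      fix v assume v: "c v \<noteq> 0" and Dv: "D (x0 + v) \<noteq> 0"
      obtain S where S: "\<And>z. D (x0 + z *s v) \<noteq> 0 \<Longrightarrow> f (x0 + z *s v) = poly S z" "S = 0 \<or> int (degree S) \<le> 0"
        using on_line[OF g0 v] by blast
      have "degree S = 0" using S(2) by auto
      then have "poly S 1 = poly S 0" by (metis degree_eq_zeroE poly_const_conv)
      then show "f (x0 + v) = f x0" using S(1)[of 0] S(1)[of 1] Dv x0 by simp
    qed auto
    show "\<forall>x. D x \<noteq> 0 \<longrightarrow> f x = 0" if g0: "growth (- 1) f"
    proof (intro allI impI, rule extend)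
      fix v assume v: "c v \<noteq> 0" and Dv: "D (x0 + v) \<noteq> 0"
      obtain S where S: "\<And>z. D (x0 + z *s v) \<noteq> 0 \<Longrightarrow> f (x0 + z *s v) = poly S z" "S = 0 \<or> int (degree S) \<le> - 1"
        using on_line[OF g0 v] by blast
      then show "f (x0 + v) = 0" using S(1)[of 1] Dv by simp
    qed auto
  qed
qed

lemma affine_const_partial:
  assumes "regular f" "pole 0 f" "growth 1 f"
  shows "\<exists>a. \<forall>x. D x \<noteq> 0 \<longrightarrow> cpartial k f x = a"
proof -
  obtain x0 where x0: "D x0 \<noteq> 0" and f: "\<And>x. D x \<noteq> 0 \<Longrightarrow> f x = f x0 + (\<Sum>i\<in>UNIV. cpartial i f x0 * (x - x0) $ i)"
    using rigid[OF assms] by metis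
  have "cpartial k f x = cpartial k f x0" if "D x \<noteq> 0" for x
  proof -
    have "cpartial k f x = cpartial k (\<lambda>x. f x0 + (\<Sum>i\<in>UNIV. cpartial i f x0 * (x $ i + - x0 $ i))) x"
      by (rule cpartial_cong_U[OF that]) (subst f, auto)
    also have "\<dots> = (\<Sum>i\<in>UNIV. cpartial i f x0 * (if k = i then 1 else 0))"
      by (simp add: cpartial_add cpartial_sum cpartial_cmult cpartial_coord cdiff_sum cdiff_mult cdiff_add del: add_uminus_conv_diff)
    also have "\<dots> = cpartial k f x0" by (simp add: if_distrib cong: if_cong)
    finally show ?thesis .
  qed
  then show ?thesis by blast
qed

lemma bounded_const:
  assumes "regular f" "pole 0 f" "growth 0 f"
  shows "\<exists>a. \<forall>x. D x \<noteq> 0 \<longrightarrow> f x = a"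
  using rigid[OF assms(1,2) growth_mono[OF assms(3)]] assms(3) by (metis zero_le_one)

lemma decaying_zero:
  assumes "regular f" "pole 0 f" "growth (- 1) f" "D x \<noteq> 0"
  shows "f x = 0"
  using rigid[OF assms(1,2) growth_mono[OF assms(3)]] assms(3,4) by (metis (no_types, opaque_lifting) neg_le_0_iff_le order_trans zero_le_one)

end

section \<open>Christoffel symbols and the Ricci tensor of a cometric\<close>

lemma matrix_mult_add_left: "(A + B) ** C = A ** C + B ** (C :: complex ^ 'n ^ ('n::finite))"
  by (simp add: vec_eq_iff matrix_matrix_mult_def sum.distrib distrib_right)
lemma matrix_mult_add_right: "C ** (A + B) = C ** A + C ** (B :: complex ^ 'n ^ ('n::finite))"
  by (simp add: vec_eq_iff matrix_matrix_mult_def sum.distrib distrib_left)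
lemma matrix_mult_minus_left: "(- A) ** B = - (A ** (B :: complex ^ 'n ^ ('n::finite)))"
  by (simp add: vec_eq_iff matrix_matrix_mult_def sum_negf)
lemma matrix_mult_minus_right: "A ** (- B) = - (A ** (B :: complex ^ 'n ^ ('n::finite)))"
  by (simp add: vec_eq_iff matrix_matrix_mult_def sum_negf)

context cometric
begin

lemma metric_of_UNIV: "metric_of UNIV G x = m x"
proof -
  have "block UNIV (G x) = G x" by (simp add: block_def vec_eq_iff)
  then show ?thesis by (simp add: metric_of_def m_def)
qed

definition dG :: "'n \<Rightarrow> complex ^ 'n \<Rightarrow> complex ^ 'n ^ 'n" where
  "dG l x = (\<chi> i j. cpartial l (\<lambda>y. G y $ i $ j) x)"
definition dm :: "'n \<Rightarrow> complex ^ 'n \<Rightarrow> complex ^ 'n ^ 'n" where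
  "dm l x = (\<chi> i j. cpartial l (\<lambda>y. m y $ i $ j) x)"

lemma cdiff_G: "cdiff (\<lambda>y. G y $ i $ j) x" by (rule polyfun_cdiff[OF polyG])
lemma cdiff_m: "D x \<noteq> 0 \<Longrightarrow> cdiff (\<lambda>y. m y $ i $ j) x" by (rule regular_cdiff[OF regular_m])
lemma cdiff_L: "cdiff (\<lambda>y. L y $ i) x" using polyL polyfun_cdiff by blast
lemma cdiff_D: "cdiff D x" by (rule polyfun_cdiff[OF polyD])
lemma cdiff_d: "cdiff (\<lambda>y. d y $ i) x" by (rule polyfun_cdiff[OF polyd])

lemma dG_sym: "dG l x $ i $ j = dG l x $ j $ i"
  unfolding dG_def by (simp, subst sym, rule refl)

lemma dm_sym: "D x \<noteq> 0 \<Longrightarrow> dm l x $ i $ j = dm l x $ j $ i"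
  unfolding dm_def vec_lambda_beta by (rule cpartial_cong_U) (auto simp: m_sym)

lemma dm_dG: assumes D: "D x \<noteq> 0" shows "dG l x = - (G x ** dm l x ** G x)"
proof -
  have "dG l x ** m x + G x ** dm l x = 0"
  proof -
    have "(dG l x ** m x + G x ** dm l x) $ i $ j = 0" for i j
    proof -
      have "(dG l x ** m x + G x ** dm l x) $ i $ j = cpartial l (\<lambda>y. \<Sum>k\<in>UNIV. G y $ i $ k * m y $ k $ j) x"
        by (simp add: matrix_matrix_mult_def dG_def dm_def cpartial_sum cpartial_mult cdiff_mult cdiff_G cdiff_m[OF D] sum.distrib)
      also have "\<dots> = cpartial l (\<lambda>y. mat 1 $ i $ j) x"
      proof (rule cpartial_cong_U[OF D])
        fix y assume "D y \<noteq> 0"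
        then have "(G y ** m y) $ i $ j = mat 1 $ i $ j" by (simp add: m_inv)
        then show "(\<Sum>k\<in>UNIV. G y $ i $ k * m y $ k $ j) = mat 1 $ i $ j" by (simp add: matrix_matrix_mult_def)
      qed
      finally show ?thesis by simp
    qed
    then show ?thesis by (simp add: vec_eq_iff)
  qed
  then have "(dG l x ** m x + G x ** dm l x) ** G x = 0" by simp
  then have "dG l x ** m x ** G x + G x ** dm l x ** G x = 0" by (simp add: matrix_mult_add_left)
  then have "dG l x + G x ** dm l x ** G x = 0" by (simp add: m_inv(2)[OF D] flip: matrix_mul_assoc)
  then show ?thesis by (simp add: eq_neg_iff_add_eq_0)
qed

text \<open>
  \<open>Gam i x $ k $ j\<close> is the Christoffel symbol with upper index \<open>k\<close> and lower indices \<open>i j\<close>,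
  \<open>Lam i\<close> is the same with the index lowered, and \<open>C j x $ k $ a\<close> is the Christoffel symbol with upper index
  \<open>k\<close>, lower index \<open>j\<close> and the other lower index raised to \<open>a\<close>.
\<close>

definition Gam :: "'n \<Rightarrow> complex ^ 'n \<Rightarrow> complex ^ 'n ^ 'n" where
  "Gam i x = (\<chi> k j. christoffel UNIV G k i j x)"
definition Lam :: "'n \<Rightarrow> complex ^ 'n \<Rightarrow> complex ^ 'n ^ 'n" where
  "Lam i x = (\<chi> l j. 1/2 * (dm i x $ j $ l + dm j x $ i $ l - dm l x $ i $ j))"
definition C :: "'n \<Rightarrow> complex ^ 'n \<Rightarrow> complex ^ 'n ^ 'n" where
  "C j x = Gam j x ** G x"

lemma Gam_Lam: "Gam i x = G x ** Lam i x"
  by (simp add: vec_eq_iff Gam_def Lam_def christoffel_def metric_of_UNIV matrix_matrix_mult_def dm_def sum_distrib_left mult.left_commute)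

lemma Gam_sym: "D x \<noteq> 0 \<Longrightarrow> Gam i x $ k $ j = Gam j x $ k $ i"
  unfolding Gam_Lam matrix_matrix_mult_def Lam_def vec_lambda_beta
  by (intro sum.cong refl) (simp add: dm_sym[of x _ i j] algebra_simps)

lemma Gam_C: "D x \<noteq> 0 \<Longrightarrow> Gam j x = C j x ** m x"
  unfolding C_def by (simp add: m_inv(1) flip: matrix_mul_assoc)

lemma transpose_G: "transpose (G x) = G x"
  by (simp add: vec_eq_iff transpose_def sym)

text \<open>
  The metric is parallel: \<open>Lam l\<close> is half of \<open>dm l\<close> plus an antisymmetric matrix.
\<close>

lemma dG_C: assumes D: "D x \<noteq> 0" shows "dG l x = - (C l x + transpose (C l x))"
proof -
  have "dm l x = Lam l x + transpose (Lam l x)"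
    using dm_sym[OF D] by (simp add: vec_eq_iff Lam_def transpose_def field_simps)
  then have "dG l x = - (G x ** Lam l x ** G x + G x ** transpose (Lam l x) ** G x)"
    by (simp add: dm_dG[OF D] matrix_mult_add_left matrix_mult_add_right)
  moreover have "G x ** transpose (Lam l x) ** G x = transpose (G x ** Lam l x ** G x)"
    by (simp add: matrix_transpose_mul transpose_G matrix_mul_assoc)
  ultimately show ?thesis by (simp add: C_def Gam_Lam)
qed

lemma dG_C': "D x \<noteq> 0 \<Longrightarrow> dG l x $ a $ b = - C l x $ a $ b - C l x $ b $ a"
  by (simp add: dG_C transpose_def)

text \<open>
  Minus the Christoffel symbols with both lower indices raised: the Hessian of the coordinate
  function \<open>x $ k\<close> as a contravariant tensor. It is a polynomial in the cometric and its derivatives.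
\<close>

definition H :: "'n \<Rightarrow> complex ^ 'n \<Rightarrow> complex ^ 'n ^ 'n" where
  "H k x = (\<chi> a c. 1/2 * (\<Sum>l\<in>UNIV. G x $ a $ l * dG l x $ k $ c + G x $ c $ l * dG l x $ k $ a - G x $ k $ l * dG l x $ a $ c))"

lemma H_sym: "H k x $ a $ c = H k x $ c $ a"
  by (simp add: H_def dG_sym[of _ x a c] add.commute)

text \<open>
  The same cyclic combination of derivatives that defines the Levi-Civita connection, for the cometric:
  each \<open>G dG\<close> is a sum of two raised Christoffel symbols \<open>h\<close> by \<open>dG_C\<close>, and all but two
  cancel by the symmetry of \<open>h\<close>.
\<close>

lemma C_H: assumes D: "D x \<noteq> 0" shows "C j x $ k $ a = - (\<Sum>c\<in>UNIV. H k x $ a $ c * m x $ c $ j)"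
proof -
  define h where "h k a c = - (\<Sum>l\<in>UNIV. C l x $ k $ a * G x $ l $ c)" for k a c
  have h_sym: "h k a c = h k c a" for k a c
  proof -
    have "(\<Sum>l\<in>UNIV. C l x $ k $ a * G x $ l $ c) = (\<Sum>l\<in>UNIV. \<Sum>i\<in>UNIV. Gam l x $ k $ i * G x $ i $ a * G x $ l $ c)" for a c
      by (simp add: C_def matrix_matrix_mult_def sum_distrib_right)
    moreover have "(\<Sum>l\<in>UNIV. \<Sum>i\<in>UNIV. Gam l x $ k $ i * G x $ i $ a * G x $ l $ c) = (\<Sum>i\<in>UNIV. \<Sum>l\<in>UNIV. Gam i x $ k $ l * G x $ l $ c * G x $ i $ a)"
      by (subst sum.swap) (simp add: Gam_sym[OF D, of _ k] mult_ac)
    ultimately show ?thesis by (simp add: h_def)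
  qed
  have e: "(\<Sum>l\<in>UNIV. G x $ a $ l * dG l x $ k $ c) = h k c a + h c k a" for a k c
  proof -
    have "(\<Sum>l\<in>UNIV. G x $ a $ l * dG l x $ k $ c) = (\<Sum>l\<in>UNIV. - (C l x $ k $ c * G x $ l $ a) - C l x $ c $ k * G x $ l $ a)"
      by (intro sum.cong refl) (simp add: dG_C'[OF D] sym[of x a] algebra_simps)
    then show ?thesis by (simp add: h_def sum_subtractf sum_negf)
  qed
  have Hh: "H k x $ a $ c = h k a c" for a c
    unfolding H_def vec_lambda_beta sum.distrib sum_subtractf e
    using h_sym[of k a c] h_sym[of a k c] h_sym[of c k a] by simp
  have "(\<Sum>c\<in>UNIV. H k x $ a $ c * m x $ c $ j) = - (\<Sum>c\<in>UNIV. \<Sum>l\<in>UNIV. C l x $ k $ a * (G x $ l $ c * m x $ c $ j))"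
    by (simp add: Hh h_def sum_distrib_right sum_negf mult.assoc)
  also have "\<dots> = - (\<Sum>l\<in>UNIV. C l x $ k $ a * (G x ** m x) $ l $ j)"
    by (subst sum.swap) (simp add: sum_distrib_left matrix_matrix_mult_def)
  also have "\<dots> = - C j x $ k $ a"
    by (simp add: m_inv[OF D] mat_def if_distrib cong: if_cong)
  finally show ?thesis by simp
qed

lemma trace_Gam: assumes D: "D x \<noteq> 0" shows "(\<Sum>k\<in>UNIV. Gam i x $ k $ k) = - d x $ i / (2 * D x)"
proof -
  have "d x $ i = D x * (\<Sum>a\<in>UNIV. \<Sum>b\<in>UNIV. dG i x $ a $ b * m x $ b $ a)"
    using cpartial_det[OF cdiff_G, of x i] D by (simp add: d_def D_def dG_def m_def)
  also have "(\<Sum>a\<in>UNIV. \<Sum>b\<in>UNIV. dG i x $ a $ b * m x $ b $ a) =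
     - (\<Sum>a\<in>UNIV. \<Sum>b\<in>UNIV. C i x $ a $ b * m x $ b $ a) - (\<Sum>a\<in>UNIV. \<Sum>b\<in>UNIV. C i x $ b $ a * m x $ b $ a)"
    by (simp add: dG_C'[OF D] algebra_simps sum_subtractf sum_negf sum.distrib)
  also have "(\<Sum>a\<in>UNIV. \<Sum>b\<in>UNIV. C i x $ b $ a * m x $ b $ a) = (\<Sum>a\<in>UNIV. \<Sum>b\<in>UNIV. C i x $ a $ b * m x $ b $ a)"
    by (subst sum.swap) (simp add: m_sym[OF D])
  also have "(\<Sum>a\<in>UNIV. \<Sum>b\<in>UNIV. C i x $ a $ b * m x $ b $ a) = (\<Sum>k\<in>UNIV. Gam i x $ k $ k)"
    by (simp add: Gam_C[OF D] matrix_matrix_mult_def)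
  finally have "d x $ i = - 2 * D x * (\<Sum>k\<in>UNIV. Gam i x $ k $ k)" by simp
  then show ?thesis using D by (simp add: field_simps)
qed

lemma regular_dm: "regular (\<lambda>x. dm l x $ i $ j)"
proof (rule regular_cong)
  show "regular (\<lambda>x. - 1 * (\<Sum>a\<in>UNIV. \<Sum>b\<in>UNIV. m x $ i $ a * dG l x $ a $ b * m x $ b $ j))"
    unfolding dG_def vec_lambda_beta
    by (intro regular_mult regular_sum regular_const regular_m regular_poly[OF polyfun_cpartial[OF polyG]])
  fix x assume D: "D x \<noteq> 0"
  have "m x ** dG l x ** m x = - (m x ** G x ** dm l x ** (G x ** m x))"
    by (simp add: dm_dG[OF D] matrix_mul_assoc matrix_mult_minus_left matrix_mult_minus_right)
  then have "dm l x = - (m x ** dG l x ** m x)" by (simp add: m_inv[OF D])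
  then show "- 1 * (\<Sum>a\<in>UNIV. \<Sum>b\<in>UNIV. m x $ i $ a * dG l x $ a $ b * m x $ b $ j) = dm l x $ i $ j"
    by (simp add: matrix_matrix_mult_def sum_distrib_right) (rule sum.swap)
qed

lemma regular_Gam: "regular (\<lambda>x. Gam i x $ k $ j)"
proof -
  have "regular (\<lambda>x. \<Sum>l\<in>UNIV. G x $ k $ l * (1/2 * (dm i x $ j $ l + (dm j x $ i $ l + - 1 * dm l x $ i $ j))))"
    by (intro regular_mult regular_sum regular_const regular_add regular_dm regular_poly[OF polyG])
  then show ?thesis by (simp add: Gam_Lam matrix_matrix_mult_def Lam_def add_diff_eq)
qed

lemma cdiff_Gam: "D x \<noteq> 0 \<Longrightarrow> cdiff (\<lambda>y. Gam i y $ k $ j) x"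
  by (rule regular_cdiff[OF regular_Gam])

definition dL :: "'n \<Rightarrow> 'n \<Rightarrow> complex ^ 'n \<Rightarrow> complex" where "dL l i x = cpartial l (\<lambda>y. L y $ i) x"
definition J :: "'n \<Rightarrow> 'n \<Rightarrow> complex ^ 'n \<Rightarrow> complex" where "J l i x = cpartial l (\<lambda>y. d y $ i) x"

lemma J_sym: "J l i x = J i l x"
  unfolding J_def d_def vec_lambda_beta by (rule polyfun_mixed_partials[OF polyD])

lemma tangent': "(\<Sum>c\<in>UNIV. G x $ a $ c * d x $ c) = D x * L x $ a"
  using tangent[of x] by (simp add: vec_eq_iff matrix_vector_mult_def)

lemma diff_tangent: "(\<Sum>c\<in>UNIV. dG l x $ a $ c * d x $ c + G x $ a $ c * J l c x) = d x $ l * L x $ a + D x * dL l a x"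
proof -
  have "cpartial l (\<lambda>y. \<Sum>c\<in>UNIV. G y $ a $ c * d y $ c) x = cpartial l (\<lambda>y. D y * L y $ a) x"
    by (simp add: tangent')
  then show ?thesis
    by (simp add: cpartial_sum cpartial_mult cdiff_mult cdiff_G cdiff_d cdiff_D cdiff_L dG_def J_def dL_def) (simp add: d_def)
qed

text \<open>
  The combination that multiplies the Christoffel symbols in \<open>raised_ricci\<close>. These have a pole in the
  direction \<open>d $ k * d $ l\<close> (\<open>Gam_singular\<close>); the contraction of \<open>T k l j\<close> with it vanishes on the
  boundary (\<open>pole_dd_T\<close>).
\<close>

definition T :: "'n \<Rightarrow> 'n \<Rightarrow> 'n \<Rightarrow> complex ^ 'n \<Rightarrow> complex" where
  "T k l j x = C j x $ k $ l + (if k = j then L x $ l / 2 else 0)"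
definition Z :: "'n \<Rightarrow> 'n \<Rightarrow> complex ^ 'n \<Rightarrow> complex" where
  "Z a j x = (\<Sum>k\<in>UNIV. \<Sum>l\<in>UNIV. Gam k x $ a $ l * T k l j x)"

lemma regular_d_over_D: "regular (\<lambda>x. d x $ i / D x)"
  unfolding regular_def
  by (intro exI[of _ "2 * CARD('n) - 1"] exI[of _ "\<lambda>x. d x $ i"] exI[of _ 1] conjI polyd) simp

lemma ricci_formula:
  assumes D: "D x \<noteq> 0"
  shows "ricci UNIV G i j x = (\<Sum>k\<in>UNIV. cpartial k (\<lambda>y. Gam i y $ k $ j) x) + 1/2 * cpartial j (\<lambda>y. d y $ i / D y) x
     - 1/2 * (\<Sum>l\<in>UNIV. d x $ l / D x * Gam i x $ l $ j) - (\<Sum>k\<in>UNIV. \<Sum>l\<in>UNIV. Gam j x $ k $ l * Gam i x $ l $ k)"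
proof -
  have ch: "christoffel UNIV G k i j = (\<lambda>x. Gam i x $ k $ j)" for k i j by (simp add: Gam_def)
  have "ricci UNIV G i j x = (\<Sum>k\<in>UNIV. cpartial k (\<lambda>y. Gam i y $ k $ j) x) - (\<Sum>k\<in>UNIV. cpartial j (\<lambda>y. Gam i y $ k $ k) x)
     + (\<Sum>k\<in>UNIV. \<Sum>l\<in>UNIV. Gam k x $ k $ l * Gam i x $ l $ j) - (\<Sum>k\<in>UNIV. \<Sum>l\<in>UNIV. Gam j x $ k $ l * Gam i x $ l $ k)"
    by (simp add: ricci_def ch sum.distrib sum_subtractf)
  also have "(\<Sum>k\<in>UNIV. cpartial j (\<lambda>y. Gam i y $ k $ k) x) = cpartial j (\<lambda>y. \<Sum>k\<in>UNIV. Gam i y $ k $ k) x"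
    by (simp add: cpartial_sum cdiff_Gam[OF D])
  also have "\<dots> = cpartial j (\<lambda>y. - 1/2 * (d y $ i / D y)) x"
    by (rule cpartial_cong_U[OF D]) (simp add: trace_Gam)
  also have "\<dots> = - 1/2 * cpartial j (\<lambda>y. d y $ i / D y) x"
  proof (rule cpartial_cmult)
    show "cdiff (\<lambda>y. d y $ i / D y) x"
      by (rule regular_cdiff[OF regular_d_over_D D])
  qed
  also have "(\<Sum>k\<in>UNIV. \<Sum>l\<in>UNIV. Gam k x $ k $ l * Gam i x $ l $ j) = (\<Sum>l\<in>UNIV. (\<Sum>k\<in>UNIV. Gam l x $ k $ k) * Gam i x $ l $ j)"
    by (subst sum.swap) (simp add: Gam_sym[OF D] sum_distrib_right)
  also have "\<dots> = - 1/2 * (\<Sum>l\<in>UNIV. d x $ l / D x * Gam i x $ l $ j)"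
    by (simp add: trace_Gam[OF D] sum_distrib_left)
  finally show ?thesis by simp
qed

text \<open>
  The shape of this formula is what makes the poles at \<open>D = 0\<close> cancel. Moving the factor \<open>G\<close> inside
  the derivatives turns Christoffel symbols into \<open>C\<close> and the gradient of \<open>ln D\<close> into \<open>L\<close>. The
  derivatives of \<open>G\<close> that arise, written by \<open>dG_C\<close>, cancel the products of Christoffel symbols
  except for those in \<open>Z\<close>.
\<close>

lemma raised_ricci:
  assumes D: "D x \<noteq> 0"
  shows "(\<Sum>i\<in>UNIV. G x $ a $ i * ricci UNIV G i j x) = (\<Sum>k\<in>UNIV. cpartial k (\<lambda>y. C j y $ k $ a) x) + dL j a x / 2 + Z a j x"
proof -
  define w where "w i = d x $ i / D x" for i
  define dw where "dw i = cpartial j (\<lambda>y. d y $ i / D y) x" for i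
  define P where "P i k = cpartial k (\<lambda>y. Gam i y $ k $ j) x" for i k
  have Cs: "C k x $ b $ c = (\<Sum>l\<in>UNIV. Gam k x $ b $ l * G x $ l $ c)" for k b c
    by (simp add: C_def matrix_matrix_mult_def)
  have Cs': "C k x $ b $ c = (\<Sum>i\<in>UNIV. G x $ c $ i * Gam i x $ b $ k)" for k b c
    unfolding Cs by (intro sum.cong refl) (simp add: Gam_sym[OF D, of k] sym[of x _ c])
  have Gw: "(\<Sum>i\<in>UNIV. G y $ b $ i * (d y $ i / D y)) = L y $ b" if "D y \<noteq> 0" for y b
    using tangent'[of y b] that by (simp flip: sum_divide_distrib)
  have A1: "(\<Sum>k\<in>UNIV. cpartial k (\<lambda>y. C j y $ k $ a) x) =
     (\<Sum>i\<in>UNIV. G x $ a $ i * (\<Sum>k\<in>UNIV. P i k)) + (\<Sum>k\<in>UNIV. \<Sum>i\<in>UNIV. Gam j x $ k $ i * dG k x $ i $ a)"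
  proof -
    have "cpartial k (\<lambda>y. C j y $ k $ a) x = (\<Sum>i\<in>UNIV. P i k * G x $ i $ a + Gam j x $ k $ i * dG k x $ i $ a)" for k
    proof -
      have "cpartial k (\<lambda>y. Gam j y $ k $ i) x = P i k" for i
        unfolding P_def by (rule cpartial_cong_U[OF D]) (rule Gam_sym)
      then show ?thesis
        by (simp add: C_def matrix_matrix_mult_def cpartial_sum cpartial_mult cdiff_mult cdiff_Gam[OF D] cdiff_G dG_def)
    qed
    then have "(\<Sum>k\<in>UNIV. cpartial k (\<lambda>y. C j y $ k $ a) x) = (\<Sum>k\<in>UNIV. \<Sum>i\<in>UNIV. P i k * G x $ i $ a) + (\<Sum>k\<in>UNIV. \<Sum>i\<in>UNIV. Gam j x $ k $ i * dG k x $ i $ a)"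
      by (simp add: sum.distrib)
    also have "(\<Sum>k\<in>UNIV. \<Sum>i\<in>UNIV. P i k * G x $ i $ a) = (\<Sum>i\<in>UNIV. G x $ a $ i * (\<Sum>k\<in>UNIV. P i k))"
      unfolding sum_distrib_left by (subst sum.swap) (intro sum.cong refl, simp add: sym[of x a] mult.commute)
    finally show ?thesis .
  qed
  have A2: "(\<Sum>k\<in>UNIV. \<Sum>i\<in>UNIV. Gam j x $ k $ i * dG k x $ i $ a) =
    - (\<Sum>k\<in>UNIV. \<Sum>i\<in>UNIV. Gam j x $ k $ i * C k x $ i $ a) - (\<Sum>k\<in>UNIV. \<Sum>i\<in>UNIV. Gam j x $ k $ i * C k x $ a $ i)"
    by (simp add: dG_C'[OF D] right_diff_distrib sum_subtractf sum_negf)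
  have A3: "(\<Sum>k\<in>UNIV. \<Sum>i\<in>UNIV. Gam j x $ k $ i * C k x $ a $ i) = (\<Sum>k\<in>UNIV. \<Sum>l\<in>UNIV. Gam k x $ a $ l * C j x $ k $ l)"
  proof (rule sum.cong[OF refl])
    fix k
    have "(\<Sum>i\<in>UNIV. Gam j x $ k $ i * C k x $ a $ i) = (\<Sum>i\<in>UNIV. \<Sum>l\<in>UNIV. Gam k x $ a $ l * (Gam j x $ k $ i * G x $ i $ l))"
      unfolding Cs[of k] sum_distrib_left by (intro sum.cong refl) (simp add: sym[of x _ _] mult_ac)
    also have "\<dots> = (\<Sum>l\<in>UNIV. Gam k x $ a $ l * C j x $ k $ l)"
      by (subst sum.swap) (simp add: Cs[of j] sum_distrib_left)
    finally show "(\<Sum>i\<in>UNIV. Gam j x $ k $ i * C k x $ a $ i) = (\<Sum>l\<in>UNIV. Gam k x $ a $ l * C j x $ k $ l)" .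
  qed
  have A4: "(\<Sum>i\<in>UNIV. G x $ a $ i * (\<Sum>k\<in>UNIV. \<Sum>l\<in>UNIV. Gam j x $ k $ l * Gam i x $ l $ k)) = (\<Sum>k\<in>UNIV. \<Sum>i\<in>UNIV. Gam j x $ k $ i * C k x $ i $ a)"
  proof -
    have "(\<Sum>i\<in>UNIV. G x $ a $ i * (\<Sum>k\<in>UNIV. \<Sum>l\<in>UNIV. Gam j x $ k $ l * Gam i x $ l $ k)) =
      (\<Sum>i\<in>UNIV. \<Sum>k\<in>UNIV. \<Sum>l\<in>UNIV. Gam j x $ k $ l * (G x $ a $ i * Gam i x $ l $ k))"
      by (simp add: sum_distrib_left mult_ac)
    also have "\<dots> = (\<Sum>k\<in>UNIV. \<Sum>i\<in>UNIV. \<Sum>l\<in>UNIV. Gam j x $ k $ l * (G x $ a $ i * Gam i x $ l $ k))"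
      by (rule sum.swap)
    also have "\<dots> = (\<Sum>k\<in>UNIV. \<Sum>l\<in>UNIV. \<Sum>i\<in>UNIV. Gam j x $ k $ l * (G x $ a $ i * Gam i x $ l $ k))"
      by (intro sum.cong refl sum.swap)
    finally show ?thesis by (simp add: Cs' sum_distrib_left)
  qed
  have B1: "(\<Sum>i\<in>UNIV. G x $ a $ i * dw i) = dL j a x + (\<Sum>i\<in>UNIV. C j x $ a $ i * w i) + (\<Sum>i\<in>UNIV. C j x $ i $ a * w i)"
  proof -
    have "cpartial j (\<lambda>y. \<Sum>i\<in>UNIV. G y $ a $ i * (d y $ i / D y)) x = dL j a x"
      unfolding dL_def by (rule cpartial_cong_U[OF D]) (rule Gw)
    then have "(\<Sum>i\<in>UNIV. dG j x $ a $ i * w i + G x $ a $ i * dw i) = dL j a x"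
      by (simp add: cpartial_sum cpartial_mult cdiff_mult cdiff_G regular_cdiff[OF regular_d_over_D D] dG_def w_def dw_def del: times_divide_eq_right times_divide_eq_left)
    then show ?thesis
      by (simp add: dG_C'[OF D] sum.distrib left_diff_distrib sum_subtractf sum_negf algebra_simps)
  qed
  have B2: "(\<Sum>i\<in>UNIV. C j x $ a $ i * w i) = (\<Sum>l\<in>UNIV. Gam j x $ a $ l * L x $ l)"
  proof -
    have "(\<Sum>i\<in>UNIV. C j x $ a $ i * w i) = (\<Sum>i\<in>UNIV. \<Sum>l\<in>UNIV. Gam j x $ a $ l * (G x $ l $ i * w i))"
      by (simp add: Cs sum_distrib_right mult.assoc)
    also have "\<dots> = (\<Sum>l\<in>UNIV. Gam j x $ a $ l * (\<Sum>i\<in>UNIV. G x $ l $ i * w i))"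
      by (subst sum.swap) (simp add: sum_distrib_left)
    finally show ?thesis unfolding w_def Gw[OF D] .
  qed
  have B3: "(\<Sum>i\<in>UNIV. G x $ a $ i * (\<Sum>l\<in>UNIV. w l * Gam i x $ l $ j)) = (\<Sum>i\<in>UNIV. C j x $ i $ a * w i)"
  proof -
    have "(\<Sum>i\<in>UNIV. G x $ a $ i * (\<Sum>l\<in>UNIV. w l * Gam i x $ l $ j)) = (\<Sum>i\<in>UNIV. \<Sum>l\<in>UNIV. G x $ a $ i * Gam i x $ l $ j * w l)"
      by (simp add: sum_distrib_left mult_ac)
    also have "\<dots> = (\<Sum>l\<in>UNIV. (\<Sum>i\<in>UNIV. G x $ a $ i * Gam i x $ l $ j) * w l)"
      by (subst sum.swap) (simp add: sum_distrib_right)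
    finally show ?thesis by (simp add: Cs')
  qed
  have Zs: "Z a j x = (\<Sum>k\<in>UNIV. \<Sum>l\<in>UNIV. Gam k x $ a $ l * C j x $ k $ l) + (\<Sum>l\<in>UNIV. Gam j x $ a $ l * L x $ l) / 2"
  proof -
    have "(\<Sum>k\<in>UNIV. \<Sum>l\<in>UNIV. Gam k x $ a $ l * (if k = j then L x $ l / 2 else 0)) =
      (\<Sum>k\<in>UNIV. if k = j then \<Sum>l\<in>UNIV. Gam k x $ a $ l * (L x $ l / 2) else 0)"
      by (intro sum.cong refl) auto
    then show ?thesis by (simp add: Z_def T_def distrib_left sum.distrib sum_divide_distrib)
  qed
  have "(\<Sum>i\<in>UNIV. G x $ a $ i * ricci UNIV G i j x) = (\<Sum>i\<in>UNIV. G x $ a $ i * (\<Sum>k\<in>UNIV. P i k)) + 1/2 * (\<Sum>i\<in>UNIV. G x $ a $ i * dw i)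
    - 1/2 * (\<Sum>i\<in>UNIV. G x $ a $ i * (\<Sum>l\<in>UNIV. w l * Gam i x $ l $ j)) - (\<Sum>i\<in>UNIV. G x $ a $ i * (\<Sum>k\<in>UNIV. \<Sum>l\<in>UNIV. Gam j x $ k $ l * Gam i x $ l $ k))"
  proof -
    have "G x $ a $ i * ricci UNIV G i j x = G x $ a $ i * (\<Sum>k\<in>UNIV. P i k) + 1/2 * (G x $ a $ i * dw i)
      - 1/2 * (G x $ a $ i * (\<Sum>l\<in>UNIV. w l * Gam i x $ l $ j)) - G x $ a $ i * (\<Sum>k\<in>UNIV. \<Sum>l\<in>UNIV. Gam j x $ k $ l * Gam i x $ l $ k)" for i
      unfolding ricci_formula[OF D] P_def dw_def w_def by (simp only: algebra_simps)
    then show ?thesis by (simp only: sum.distrib sum_subtractf sum_distrib_left)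
  qed
  then show ?thesis using A1 A2 A3 A4 B1 B2 B3 Zs by (simp add: add_divide_distrib)
qed

lemma ricci_sym: assumes D: "D x \<noteq> 0" shows "ricci UNIV G i j x = ricci UNIV G j i x"
proof -
  have 1: "cpartial k (\<lambda>y. Gam i y $ k $ j) x = cpartial k (\<lambda>y. Gam j y $ k $ i) x" for k
    by (rule cpartial_cong_U[OF D]) (rule Gam_sym)
  have w: "cpartial j (\<lambda>y. d y $ i / D y) x = J j i x / D x - d x $ i * d x $ j / D x ^ 2" for i j
  proof -
    have hg: "has_grad (\<lambda>y. inverse (D y)) ((- (inverse (D x) ^ 2)) *s (\<chi> i. cpartial i D x)) x"
      by (rule has_grad_inverse[OF cdiffD[OF cdiff_D] D])
    have "cpartial j (\<lambda>y. d y $ i * inverse (D y)) x = J j i x * inverse (D x) + d x $ i * (- (inverse (D x) ^ 2) * d x $ j)"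
      using has_grad_cpartial[OF hg, of j]
      by (subst cpartial_mult[OF cdiff_d cdiffI[OF hg]]) (simp add: J_def d_def)
    then show ?thesis by (simp add: divide_inverse power_inverse mult_ac)
  qed
  have "(\<Sum>k\<in>UNIV. \<Sum>l\<in>UNIV. Gam j x $ k $ l * Gam i x $ l $ k) = (\<Sum>k\<in>UNIV. \<Sum>l\<in>UNIV. Gam i x $ k $ l * Gam j x $ l $ k)"
    by (subst sum.swap) (simp add: mult.commute)
  then show ?thesis
    unfolding ricci_formula[OF D] 1 w by (simp add: J_sym[of j i] Gam_sym[OF D, of i _ j] mult.commute)
qed

end

section \<open>The raised Ricci tensor is constant\<close>

context cometric
begin

definition pol :: "(complex ^ 'n \<Rightarrow> complex) \<Rightarrow> bool" where "pol f \<longleftrightarrow> (\<exists>k. polyfun k f)"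

lemma pol_poly: "polyfun k f \<Longrightarrow> pol f" by (auto simp: pol_def)
lemma pol_const: "pol (\<lambda>x. a)" by (rule pol_poly[OF polyfun.const])
lemma pol_mult: "pol f \<Longrightarrow> pol g \<Longrightarrow> pol (\<lambda>x. f x * g x)" unfolding pol_def by (blast intro: polyfun.mult)
lemma pol_add: "pol f \<Longrightarrow> pol g \<Longrightarrow> pol (\<lambda>x. f x + g x)"
  unfolding pol_def by (metis max.cobounded1 max.cobounded2 polyfun.add polyfun.weaken)
lemma pol_diff: "pol f \<Longrightarrow> pol g \<Longrightarrow> pol (\<lambda>x. f x - g x)"
  using pol_add[OF _ pol_mult[OF pol_const[of "-1"]], of f g] by simp
lemma pol_sum: "(\<And>i. i \<in> A \<Longrightarrow> pol (f i)) \<Longrightarrow> pol (\<lambda>x. \<Sum>i\<in>A. f i x)"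
  by (induction A rule: infinite_finite_induct) (auto simp: pol_const intro: pol_add)
lemma pol_G: "pol (\<lambda>x. G x $ i $ j)" by (rule pol_poly[OF polyG])
lemma pol_D: "pol D" by (rule pol_poly[OF polyD])
lemma pol_d: "pol (\<lambda>x. d x $ i)" by (rule pol_poly[OF polyd])
lemma pol_M: "pol (\<lambda>x. M x $ i $ j)" by (rule pol_poly[OF polyM])
lemma pol_L: "pol (\<lambda>x. L x $ i)" using polyL by (auto simp: pol_def)
lemma pol_E: "pol E" using polyE by (auto simp: pol_def)
lemma poly_dG: "polyfun 1 (\<lambda>x. dG l x $ i $ j)"
  using polyfun_cpartial[OF polyG, of l] by (simp add: dG_def)
lemma pol_dG: "pol (\<lambda>x. dG l x $ i $ j)" by (rule pol_poly[OF poly_dG])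
lemma pol_dL: "pol (dL l i)"
proof -
  obtain k where "polyfun k (\<lambda>x. L x $ i)" using polyL by blast
  from polyfun_cpartial[OF this, of l] show ?thesis by (auto simp: pol_def dL_def[abs_def])
qed
lemma poly_H: "polyfun 3 (\<lambda>x. H k x $ a $ c)"
proof -
  have "polyfun 3 (\<lambda>x. G x $ i $ j * dG l x $ p $ q)" for i j l p q
    using polyfun.mult[OF polyG poly_dG] by simp
  then show ?thesis unfolding H_def vec_lambda_beta
    by (intro polyfun_cmult polyfun_sum polyfun_diff polyfun.add)
qed
lemma pol_H: "pol (\<lambda>x. H k x $ a $ c)" by (rule pol_poly[OF poly_H])

lemma pole_pol: "pol f \<Longrightarrow> pole 0 f" using pole_poly by (auto simp: pol_def)
lemma regular_pol: "pol f \<Longrightarrow> regular f" using regular_poly by (auto simp: pol_def)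
lemma pole_zero: "pol f \<Longrightarrow> (\<And>x. D x = 0 \<Longrightarrow> d x \<noteq> 0 \<Longrightarrow> f x = 0) \<Longrightarrow> pole (- 1) f"
  using pole_boundary_zero by (auto simp: pol_def)
lemma pole_uminus: "pole k f \<Longrightarrow> pole k (\<lambda>x. - f x)"
  using pole_mult[OF pole_pol[OF pol_const[of "-1"]], of k f k] by simp
lemma growth_uminus: "growth k f \<Longrightarrow> growth k (\<lambda>x. - f x)"
  using growth_mult[OF growth_poly[OF polyfun.const[of "-1"]], of k f k] by simp
lemma regular_uminus: "regular f \<Longrightarrow> regular (\<lambda>x. - f x)"
  using regular_mult[OF regular_const[of "-1"], of f] by simp
lemma pole_D: "pole (- 1) D" by (rule pole_zero[OF pol_D])

text \<open>
  Contracting \<open>H\<close> with \<open>d\<close> produces a factor \<open>D\<close>, because \<open>G d = D L\<close>; \<open>S\<close> is the cofactor.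
\<close>

definition S :: "'n \<Rightarrow> 'n \<Rightarrow> complex ^ 'n \<Rightarrow> complex" where
  "S k a x = 1/2 * (\<Sum>l\<in>UNIV. G x $ a $ l * dL l k x + L x $ l * dG l x $ k $ a - G x $ k $ l * dL l a x)"

lemma pol_S: "pol (S k a)"
  unfolding S_def[abs_def] by (intro pol_mult pol_const pol_sum pol_add pol_diff pol_G pol_L pol_dG pol_dL)

text \<open>
  Differentiating \<open>G d = D L\<close> replaces \<open>dG d\<close> by \<open>d L + D dL\<close> minus a term with the second
  derivatives \<open>J\<close> of \<open>D\<close>. The terms with \<open>J\<close> cancel because \<open>J\<close> is symmetric.
\<close>

lemma H_d: "(\<Sum>c\<in>UNIV. H k x $ a $ c * d x $ c) = D x * S k a x"
proof -
  have dGd: "(\<Sum>c\<in>UNIV. dG l x $ i $ c * d x $ c) = d x $ l * L x $ i + D x * dL l i x - (\<Sum>c\<in>UNIV. G x $ i $ c * J l c x)" for l i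
    using diff_tangent[of l x i] by (simp add: sum.distrib algebra_simps)
  have "(\<Sum>c\<in>UNIV. H k x $ a $ c * d x $ c) = 1/2 * (\<Sum>c\<in>UNIV. \<Sum>l\<in>UNIV. G x $ a $ l * (dG l x $ k $ c * d x $ c)
      + dG l x $ k $ a * (G x $ l $ c * d x $ c) - G x $ k $ l * (dG l x $ a $ c * d x $ c))"
    by (simp add: H_def sum_distrib_left sum_distrib_right algebra_simps sym[of x _ _])
  also have "\<dots> = 1/2 * (\<Sum>l\<in>UNIV. G x $ a $ l * (\<Sum>c\<in>UNIV. dG l x $ k $ c * d x $ c)
      + dG l x $ k $ a * (\<Sum>c\<in>UNIV. G x $ l $ c * d x $ c) - G x $ k $ l * (\<Sum>c\<in>UNIV. dG l x $ a $ c * d x $ c))"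
    by (subst sum.swap) (simp add: sum.distrib sum_subtractf sum_distrib_left)
  also have "\<dots> = 1/2 * ((\<Sum>l\<in>UNIV. G x $ a $ l * d x $ l) * L x $ k - (\<Sum>l\<in>UNIV. G x $ k $ l * d x $ l) * L x $ a
      + D x * (\<Sum>l\<in>UNIV. G x $ a $ l * dL l k x + L x $ l * dG l x $ k $ a - G x $ k $ l * dL l a x)
      - (\<Sum>l\<in>UNIV. \<Sum>c\<in>UNIV. G x $ a $ l * G x $ k $ c * J l c x) + (\<Sum>l\<in>UNIV. \<Sum>c\<in>UNIV. G x $ k $ l * G x $ a $ c * J l c x))"
  proof -
    have "G x $ a $ l * (d x $ l * L x $ k + D x * dL l k x - p) + dG l x $ k $ a * (D x * L x $ l) - G x $ k $ l * (d x $ l * L x $ a + D x * dL l a x - q)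
      = G x $ a $ l * d x $ l * L x $ k - G x $ k $ l * d x $ l * L x $ a + D x * (G x $ a $ l * dL l k x + L x $ l * dG l x $ k $ a - G x $ k $ l * dL l a x)
       - G x $ a $ l * p + G x $ k $ l * q" for l p q
      by (simp add: algebra_simps)
    moreover have "(\<Sum>l\<in>UNIV. G x $ i $ l * (d x $ l * c)) = D x * (L x $ i * c)" for i c
      unfolding mult.assoc[symmetric] tangent'[symmetric] by (rule sum_distrib_right[symmetric])
    ultimately show ?thesis unfolding dGd tangent'
      by (simp only: sum.distrib sum_subtractf sum_distrib_left[symmetric] sum_distrib_right[symmetric] mult.assoc)
  qed
  also have "(\<Sum>l\<in>UNIV. \<Sum>c\<in>UNIV. G x $ k $ l * G x $ a $ c * J l c x) = (\<Sum>l\<in>UNIV. \<Sum>c\<in>UNIV. G x $ a $ l * G x $ k $ c * J l c x)"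
    by (subst sum.swap) (simp add: J_sym mult_ac)
  finally show ?thesis by (simp add: tangent' S_def)
qed

lemma H_d': "(\<Sum>b\<in>UNIV. H k x $ b $ c * d x $ b) = D x * S k c x"
  using H_d[of k x c] by (simp add: H_sym[of k x _ c])

definition SS :: "complex ^ 'n \<Rightarrow> complex" where
  "SS x = (\<Sum>k\<in>UNIV. \<Sum>a\<in>UNIV. S k a x * d x $ a * d x $ k)"

lemma pol_SS: "pol SS" unfolding SS_def[abs_def] by (intro pol_sum pol_mult pol_S pol_d)

text \<open>
  Contracted twice with \<open>d\<close>, two of the three terms of \<open>S\<close> contain \<open>G d\<close>, which is zero here; the third is
  evaluated by differentiating \<open>G d = D L\<close> along \<open>L\<close>.
\<close>

lemma SS_boundary: assumes D: "D x = 0" shows "SS x = E x ^ 2 / 2"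
proof -
  have Gd: "(\<Sum>l\<in>UNIV. G x $ a $ l * d x $ l) = 0" for a using tangent'[of x a] D by simp
  have Gd': "(\<Sum>l\<in>UNIV. G x $ l $ a * d x $ l) = 0" for a using Gd[of a] by (simp add: sym[of x a])
  have t1: "(\<Sum>k\<in>UNIV. \<Sum>a\<in>UNIV. \<Sum>l\<in>UNIV. G x $ a $ l * dL l k x * d x $ a * d x $ k) = 0"
  proof -
    have "(\<Sum>a\<in>UNIV. \<Sum>l\<in>UNIV. G x $ a $ l * dL l k x * d x $ a * d x $ k) = 0" for k
    proof -
      have "(\<Sum>a\<in>UNIV. \<Sum>l\<in>UNIV. G x $ a $ l * dL l k x * d x $ a * d x $ k) = (\<Sum>l\<in>UNIV. dL l k x * d x $ k * (\<Sum>a\<in>UNIV. G x $ a $ l * d x $ a))"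
        by (subst sum.swap) (simp add: sum_distrib_left mult_ac)
      then show ?thesis by (simp add: Gd')
    qed
    then show ?thesis by simp
  qed
  have t3: "(\<Sum>k\<in>UNIV. \<Sum>a\<in>UNIV. \<Sum>l\<in>UNIV. G x $ k $ l * dL l a x * d x $ a * d x $ k) = 0"
    using t1 by (subst sum.swap) (simp add: mult_ac)
  have t2: "(\<Sum>k\<in>UNIV. \<Sum>a\<in>UNIV. \<Sum>l\<in>UNIV. L x $ l * dG l x $ k $ a * d x $ a * d x $ k) = E x ^ 2"
  proof -
    have dGd: "(\<Sum>c\<in>UNIV. dG l x $ i $ c * d x $ c) = d x $ l * L x $ i - (\<Sum>c\<in>UNIV. G x $ i $ c * J l c x)" for l i
      using diff_tangent[of l x i] D by (simp add: sum.distrib algebra_simps)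
    have dd: "(\<Sum>k\<in>UNIV. \<Sum>a\<in>UNIV. dG l x $ k $ a * d x $ a * d x $ k) = d x $ l * E x" for l
    proof -
      have "(\<Sum>k\<in>UNIV. \<Sum>a\<in>UNIV. dG l x $ k $ a * d x $ a * d x $ k) = (\<Sum>k\<in>UNIV. (d x $ l * L x $ k - (\<Sum>c\<in>UNIV. G x $ k $ c * J l c x)) * d x $ k)"
        by (simp add: dGd flip: sum_distrib_right)
      also have "\<dots> = d x $ l * E x - (\<Sum>k\<in>UNIV. \<Sum>c\<in>UNIV. G x $ k $ c * J l c x * d x $ k)"
        unfolding E_def left_diff_distrib sum_subtractf sum_distrib_left sum_distrib_right by (simp add: mult_ac)
      also have "(\<Sum>k\<in>UNIV. \<Sum>c\<in>UNIV. G x $ k $ c * J l c x * d x $ k) = (\<Sum>c\<in>UNIV. J l c x * (\<Sum>k\<in>UNIV. G x $ k $ c * d x $ k))"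
        by (subst sum.swap) (simp add: sum_distrib_left mult_ac)
      finally show ?thesis by (simp add: Gd')
    qed
    have "(\<Sum>k\<in>UNIV. \<Sum>a\<in>UNIV. \<Sum>l\<in>UNIV. L x $ l * dG l x $ k $ a * d x $ a * d x $ k) =
      (\<Sum>k\<in>UNIV. \<Sum>l\<in>UNIV. \<Sum>a\<in>UNIV. L x $ l * dG l x $ k $ a * d x $ a * d x $ k)"
      by (intro sum.cong refl sum.swap)
    also have "\<dots> = (\<Sum>l\<in>UNIV. L x $ l * (\<Sum>k\<in>UNIV. \<Sum>a\<in>UNIV. dG l x $ k $ a * d x $ a * d x $ k))"
      by (subst sum.swap) (simp add: sum_distrib_left mult_ac)
    also have "\<dots> = E x * (\<Sum>l\<in>UNIV. L x $ l * d x $ l)" unfolding dd by (simp add: sum_distrib_left mult_ac)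
    finally show ?thesis by (simp add: E_def power2_eq_square)
  qed
  have "SS x = 1/2 * ((\<Sum>k\<in>UNIV. \<Sum>a\<in>UNIV. \<Sum>l\<in>UNIV. G x $ a $ l * dL l k x * d x $ a * d x $ k)
     + (\<Sum>k\<in>UNIV. \<Sum>a\<in>UNIV. \<Sum>l\<in>UNIV. L x $ l * dG l x $ k $ a * d x $ a * d x $ k)
     - (\<Sum>k\<in>UNIV. \<Sum>a\<in>UNIV. \<Sum>l\<in>UNIV. G x $ k $ l * dL l a x * d x $ a * d x $ k))"
    by (simp add: SS_def S_def sum.distrib sum_subtractf sum_distrib_left sum_distrib_right algebra_simps)
  then show ?thesis by (simp add: t1 t2 t3)
qed

text \<open>
  The remainder of the metric after its polar part \<open>d d\<^sup>T / (D E)\<close> is removed. Its numerator vanishes on the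
  boundary by \<open>boundary_kernel\<close>. At points with \<open>E = 0\<close> the formula is meaningless, but these stay
  away from the boundary points under consideration.
\<close>

definition r :: "complex ^ 'n \<Rightarrow> complex ^ 'n ^ 'n" where
  "r x = (\<chi> i j. (E x * M x $ i $ j - d x $ i * d x $ j) * (1 / D x) * (1 / E x))"

lemma pole_r: "pole 0 (\<lambda>x. r x $ i $ j)"
proof -
  have "pole (- 1) (\<lambda>x. E x * M x $ i $ j - d x $ i * d x $ j)"
    by (intro pole_zero pol_diff pol_mult pol_E pol_M pol_d) (use boundary_kernel(2) in auto)
  then have "pole 0 (\<lambda>x. (E x * M x $ i $ j - d x $ i * d x $ j) * (1 / D x))"
    by (rule pole_mult[OF _ pole_inverse_D]) simp
  then show ?thesis unfolding r_def vec_lambda_beta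
    by (rule pole_mult[OF _ pole_inverse_E]) simp
qed

lemma m_r: "D x \<noteq> 0 \<Longrightarrow> E x \<noteq> 0 \<Longrightarrow> m x $ i $ j = d x $ i * d x $ j / (D x * E x) + r x $ i $ j"
proof -
  assume "D x \<noteq> 0" "E x \<noteq> 0"
  moreover have "y / D' = p / (D' * e) + (e * y - p) * (1 / D') * (1 / e)" if "D' \<noteq> 0" "e \<noteq> 0" for y D' e p :: complex
    using that by (simp add: field_simps)
  ultimately have "M x $ i $ j / D x = d x $ i * d x $ j / (D x * E x) + (E x * M x $ i $ j - d x $ i * d x $ j) * (1 / D x) * (1 / E x)"
    by blast
  then show ?thesis using m_M[OF \<open>D x \<noteq> 0\<close>, of i j] unfolding r_def by simp
qed

lemma H_m:
  assumes "D x \<noteq> 0" "E x \<noteq> 0"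
  shows "(\<Sum>c\<in>UNIV. H k x $ a $ c * m x $ c $ j) = S k a x * d x $ j * (1 / E x) + (\<Sum>c\<in>UNIV. H k x $ a $ c * r x $ c $ j)"
proof -
  have "(\<Sum>c\<in>UNIV. H k x $ a $ c * m x $ c $ j) = (\<Sum>c\<in>UNIV. H k x $ a $ c * d x $ c) * d x $ j / (D x * E x) + (\<Sum>c\<in>UNIV. H k x $ a $ c * r x $ c $ j)"
    by (simp add: m_r[OF assms] distrib_left sum.distrib sum_distrib_left sum_distrib_right sum_divide_distrib mult_ac)
  then show ?thesis using assms by (simp add: H_d)
qed

lemma pole_Hr: "pole 0 (\<lambda>x. \<Sum>c\<in>UNIV. H k x $ a $ c * r x $ c $ j)"
  by (intro pole_sum pole_mult[OF pole_pol[OF pol_H] pole_r]) simp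

text \<open>
  The polar part of the metric meets \<open>H\<close> only through \<open>H d = D S\<close>, whose factor \<open>D\<close> cancels the pole.
\<close>

lemma pole_C: "pole 0 (\<lambda>x. C j x $ k $ a)"
proof (rule pole_cong)
  show "pole 0 (\<lambda>x. - (S k a x * d x $ j * (1 / E x) + (\<Sum>c\<in>UNIV. H k x $ a $ c * r x $ c $ j)))"
    by (intro pole_uminus pole_add pole_Hr pole_mult[OF pole_pol[OF pol_mult[OF pol_S pol_d]] pole_inverse_E]) simp
qed (simp add: C_H H_m)

lemma regular_C: "regular (\<lambda>x. C j x $ k $ a)"
  by (rule regular_cong[of "\<lambda>x. - (\<Sum>c\<in>UNIV. H k x $ a $ c * m x $ c $ j)"])
    (auto simp: C_H intro!: regular_uminus regular_sum regular_mult regular_pol[OF pol_H] regular_m)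

lemma growth_C: "growth 1 (\<lambda>x. C j x $ k $ a)"
proof (rule growth_congU)
  show "growth 1 (\<lambda>x. - (\<Sum>c\<in>UNIV. H k x $ a $ c * m x $ c $ j))"
    by (intro growth_uminus growth_sum growth_mult[OF growth_poly[OF poly_H] growth_m]) simp
qed (simp add: C_H)

lemma growth_L: "growth 1 (\<lambda>x. L x $ i)"
proof (rule growth_congU)
  have "CARD('n) \<ge> 1" by (simp add: Suc_leI)
  then show "growth 1 (\<lambda>x. (\<Sum>j\<in>UNIV. G x $ i $ j * d x $ j) * (1 / D x))"
    by (intro growth_mult[OF growth_sum[OF growth_mult[OF growth_poly[OF polyG] growth_poly[OF polyd] order_refl]] growth_inverse_D]) linarith
qed (simp add: tangent')

lemma dL_const: "\<exists>a. \<forall>x. D x \<noteq> 0 \<longrightarrow> dL l i x = a"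
  unfolding dL_def by (rule affine_const_partial[OF regular_pol[OF pol_L] pole_pol[OF pol_L] growth_L])

lemma dC_const: "\<exists>b. \<forall>x. D x \<noteq> 0 \<longrightarrow> cpartial l (\<lambda>y. C j y $ k $ a) x = b"
  by (rule affine_const_partial[OF regular_C pole_C growth_C])

definition X :: "'n \<Rightarrow> complex ^ 'n \<Rightarrow> complex" where
  "X a x = (\<Sum>b\<in>UNIV. S a b x * d x $ b) * (1 / E x) * (1 / E x)"
definition rho :: "'n \<Rightarrow> 'n \<Rightarrow> 'n \<Rightarrow> complex ^ 'n \<Rightarrow> complex" where
  "rho a k l x = - ((\<Sum>b\<in>UNIV. S a b x * d x $ k * r x $ b $ l) * (1 / E x) + (\<Sum>c\<in>UNIV. S a c x * r x $ c $ k) * d x $ l * (1 / E x)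
     + (\<Sum>b\<in>UNIV. (\<Sum>c\<in>UNIV. H a x $ b $ c * r x $ c $ k) * r x $ b $ l))"

lemma pole_X: "pole 0 (X a)"
  unfolding X_def[abs_def]
  by (intro pole_mult[OF _ pole_inverse_E, of 0] pole_pol pol_sum pol_mult pol_S pol_d) auto

lemma pole_rho: "pole 0 (rho a k l)"
  unfolding rho_def[abs_def]
proof (intro pole_uminus pole_add)
  show "pole 0 (\<lambda>x. (\<Sum>b\<in>UNIV. S a b x * d x $ k * r x $ b $ l) * (1 / E x))"
    by (intro pole_mult[OF _ pole_inverse_E, of 0] pole_sum pole_mult[OF pole_pol[OF pol_mult[OF pol_S pol_d]] pole_r]) auto
  show "pole 0 (\<lambda>x. (\<Sum>c\<in>UNIV. S a c x * r x $ c $ k) * d x $ l * (1 / E x))"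
    by (intro pole_mult[OF _ pole_inverse_E, of 0] pole_mult[OF _ pole_pol[OF pol_d], of 0] pole_sum pole_mult[OF pole_pol[OF pol_S] pole_r]) auto
  show "pole 0 (\<lambda>x. \<Sum>b\<in>UNIV. (\<Sum>c\<in>UNIV. H a x $ b $ c * r x $ c $ k) * r x $ b $ l)"
    by (intro pole_sum pole_mult[OF pole_Hr pole_r]) auto
qed

text \<open>
  Two contractions of \<open>H\<close> with the metric: only the product of both polar parts retains a pole,
  and this has the rank one form \<open>X a * d $ k * d $ l / D\<close>. All other terms are collected in \<open>rho\<close>.
\<close>

lemma Gam_singular:
  assumes D: "D x \<noteq> 0" and E: "E x \<noteq> 0"
  shows "Gam k x $ a $ l = - X a x * (1 / D x) * d x $ k * d x $ l + rho a k l x"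
proof -
  let ?Hr = "\<lambda>b. \<Sum>c\<in>UNIV. H a x $ b $ c * r x $ c $ k"
  have 1: "(\<Sum>b\<in>UNIV. ?Hr b * d x $ b) = D x * (\<Sum>c\<in>UNIV. S a c x * r x $ c $ k)"
  proof -
    have "(\<Sum>b\<in>UNIV. ?Hr b * d x $ b) = (\<Sum>c\<in>UNIV. (\<Sum>b\<in>UNIV. H a x $ b $ c * d x $ b) * r x $ c $ k)"
      unfolding sum_distrib_right by (subst sum.swap) (simp add: mult_ac)
    then show ?thesis by (simp add: H_d' sum_distrib_left mult.assoc)
  qed
  have "Gam k x $ a $ l = (\<Sum>b\<in>UNIV. C k x $ a $ b * m x $ b $ l)"
    by (simp add: Gam_C[OF D] matrix_matrix_mult_def)
  also have "\<dots> = - (\<Sum>b\<in>UNIV. (S a b x * d x $ k * (1 / E x) + ?Hr b) * (d x $ b * d x $ l / (D x * E x) + r x $ b $ l))"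
    unfolding C_H[OF D] H_m[OF D E] by (simp only: m_r[OF D E] sum_negf mult_minus_left)
  also have "(\<Sum>b\<in>UNIV. (S a b x * d x $ k * (1 / E x) + ?Hr b) * (d x $ b * d x $ l / (D x * E x) + r x $ b $ l)) =
     (\<Sum>b\<in>UNIV. S a b x * d x $ b) * (d x $ k * d x $ l / (D x * E x * E x)) + (\<Sum>b\<in>UNIV. S a b x * d x $ k * r x $ b $ l) * (1 / E x)
     + (\<Sum>b\<in>UNIV. ?Hr b * d x $ b) * (d x $ l / (D x * E x)) + (\<Sum>b\<in>UNIV. ?Hr b * r x $ b $ l)"
  proof -
    have "(S a b x * d x $ k * (1 / E x) + h) * (d x $ b * d x $ l / (D x * E x) + q) =
      S a b x * d x $ b * (d x $ k * d x $ l / (D x * E x * E x)) + S a b x * d x $ k * q * (1 / E x)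
      + h * d x $ b * (d x $ l / (D x * E x)) + h * q" for b h q
      by (simp add: algebra_simps)
    then show ?thesis by (simp only: sum.distrib sum_distrib_right)
  qed
  finally show ?thesis unfolding 1 using D E by (simp add: X_def rho_def algebra_simps)
qed

text \<open>
  By \<open>H d = D S\<close> and the form of the metric, contracting \<open>C j\<close> twice with \<open>d\<close> gives
  \<open>- SS * d $ j / E\<close> modulo \<open>D\<close>. On the boundary \<open>SS = E\<^sup>2 / 2\<close>, so this cancels the term
  \<open>d $ j * E / 2\<close> contributed by \<open>L\<close>.
\<close>

lemma pole_dd_T: "pole (- 1) (\<lambda>x. \<Sum>k\<in>UNIV. \<Sum>l\<in>UNIV. d x $ k * d x $ l * T k l j x)"
proof (rule pole_cong)
  let ?f = "\<lambda>x. (d x $ j * (1 / E x)) * (E x * E x * (1/2) - SS x) + D x * - (\<Sum>k\<in>UNIV. d x $ k * (\<Sum>c\<in>UNIV. S k c x * r x $ c $ j))"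
  have "pole (- 1) (\<lambda>x. E x * E x * (1/2) - SS x)"
    by (intro pole_zero pol_diff pol_mult pol_E pol_const pol_SS) (simp add: SS_boundary power2_eq_square)
  then show "pole (- 1) ?f"
    by (intro pole_add pole_mult[of 0 _ "-1" _ "-1"] pole_mult[OF pole_D, of 0] pole_mult[OF pole_pol[OF pol_d] pole_inverse_E]
       pole_uminus pole_sum pole_mult[OF pole_pol[OF pol_d], of 0] pole_mult[OF pole_pol[OF pol_S] pole_r]) auto
  fix x assume D: "D x \<noteq> 0" and E: "E x \<noteq> 0"
  have Cd: "(\<Sum>l\<in>UNIV. d x $ l * C j x $ k $ l) = - (\<Sum>c\<in>UNIV. S k c x * d x $ c) * d x $ j * (1 / E x) - D x * (\<Sum>c\<in>UNIV. S k c x * r x $ c $ j)" for k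
  proof -
    have "(\<Sum>l\<in>UNIV. d x $ l * C j x $ k $ l) = - (\<Sum>l\<in>UNIV. \<Sum>c\<in>UNIV. H k x $ l $ c * d x $ l * m x $ c $ j)"
      by (simp add: C_H[OF D] sum_negf sum_distrib_left mult_ac)
    also have "\<dots> = - (\<Sum>c\<in>UNIV. (\<Sum>l\<in>UNIV. H k x $ l $ c * d x $ l) * m x $ c $ j)"
      by (subst sum.swap) (simp add: sum_distrib_right)
    also have "\<dots> = - D x * (\<Sum>c\<in>UNIV. S k c x * m x $ c $ j)"
      by (simp add: H_d' sum_distrib_left sum_negf mult.assoc)
    also have "(\<Sum>c\<in>UNIV. S k c x * m x $ c $ j) = (\<Sum>c\<in>UNIV. S k c x * d x $ c) * d x $ j / (D x * E x) + (\<Sum>c\<in>UNIV. S k c x * r x $ c $ j)"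
      by (simp add: m_r[OF D E] distrib_left sum.distrib sum_distrib_left sum_distrib_right sum_divide_distrib mult_ac)
    finally have *: "(\<Sum>l\<in>UNIV. d x $ l * C j x $ k $ l) = - D x * ((\<Sum>c\<in>UNIV. S k c x * d x $ c) * d x $ j / (D x * E x) + (\<Sum>c\<in>UNIV. S k c x * r x $ c $ j))" .
    have "- D' * (A * j / (D' * e) + q) = - A * j * (1 / e) - D' * q" if "D' \<noteq> 0" for D' A j e q :: complex
      using that by (simp add: distrib_left)
    from this[OF D] show ?thesis unfolding * .
  qed
  have "(\<Sum>k\<in>UNIV. \<Sum>l\<in>UNIV. d x $ k * d x $ l * T k l j x) = (\<Sum>k\<in>UNIV. d x $ k * (\<Sum>l\<in>UNIV. d x $ l * C j x $ k $ l)) + (\<Sum>k\<in>UNIV. \<Sum>l\<in>UNIV. d x $ k * d x $ l * (if k = j then L x $ l / 2 else 0))"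
    by (simp add: T_def distrib_left sum.distrib sum_distrib_left mult.assoc)
  also have "(\<Sum>k\<in>UNIV. \<Sum>l\<in>UNIV. d x $ k * d x $ l * (if k = j then L x $ l / 2 else 0)) = d x $ j * E x / 2"
  proof -
    have "(\<Sum>k\<in>UNIV. \<Sum>l\<in>UNIV. d x $ k * d x $ l * (if k = j then L x $ l / 2 else 0)) = (\<Sum>k\<in>UNIV. if k = j then d x $ k * E x / 2 else 0)"
      by (intro sum.cong refl) (auto simp: E_def sum_distrib_left sum_divide_distrib mult_ac)
    then show ?thesis by simp
  qed
  also have "(\<Sum>k\<in>UNIV. d x $ k * (\<Sum>l\<in>UNIV. d x $ l * C j x $ k $ l)) =
     - SS x * (d x $ j * (1 / E x)) - D x * (\<Sum>k\<in>UNIV. d x $ k * (\<Sum>c\<in>UNIV. S k c x * r x $ c $ j))"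
  proof -
    have "d x $ k * (\<Sum>l\<in>UNIV. d x $ l * C j x $ k $ l) = - ((\<Sum>c\<in>UNIV. S k c x * d x $ c * d x $ k) * (d x $ j * (1 / E x))) - D x * (d x $ k * (\<Sum>c\<in>UNIV. S k c x * r x $ c $ j))" for k
      unfolding Cd sum_distrib_right[symmetric] by (simp add: algebra_simps)
    then show ?thesis by (simp only: sum_subtractf sum_negf SS_def sum_distrib_left[symmetric] sum_distrib_right[symmetric] mult_minus_left)
  qed
  finally show "?f x = (\<Sum>k\<in>UNIV. \<Sum>l\<in>UNIV. d x $ k * d x $ l * T k l j x)"
    using E by (simp add: field_simps)
qed

lemma pole_T: "pole 0 (T k l j)"
proof -
  have "pol (\<lambda>x. if k = j then L x $ l / 2 else 0)"
    using pol_mult[OF pol_L pol_const, of l "1/2"] pol_const[of 0] by (cases "k = j") auto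
  then have "pole 0 (\<lambda>x. if k = j then L x $ l / 2 else 0)" using pole_pol by simp
  then show ?thesis unfolding T_def[abs_def] by (intro pole_add pole_C)
qed

lemma pole_Z: "pole 0 (Z a j)"
proof (rule pole_cong)
  let ?W = "\<lambda>x. \<Sum>k\<in>UNIV. \<Sum>l\<in>UNIV. d x $ k * d x $ l * T k l j x"
  let ?f = "\<lambda>x. - (X a x * ((1 / D x) * ?W x)) + (\<Sum>k\<in>UNIV. \<Sum>l\<in>UNIV. rho a k l x * T k l j x)"
  show "pole 0 ?f"
    by (intro pole_add pole_uminus pole_mult[OF pole_X, of 0] pole_mult[OF pole_inverse_D pole_dd_T] pole_sum pole_mult[OF pole_rho pole_T]) auto
  fix x assume D: "D x \<noteq> 0" and E: "E x \<noteq> 0"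
  have "Z a j x = (\<Sum>k\<in>UNIV. \<Sum>l\<in>UNIV. - (X a x * (1 / D x)) * (d x $ k * d x $ l * T k l j x) + rho a k l x * T k l j x)"
  proof -
    have "(- p * q * a * b + c) * t = - (p * q) * (a * b * t) + c * t" for p q a b c t :: complex
      by (simp add: algebra_simps)
    then show ?thesis unfolding Z_def Gam_singular[OF D E] by (intro sum.cong refl)
  qed
  also have "\<dots> = - (X a x * (1 / D x)) * ?W x + (\<Sum>k\<in>UNIV. \<Sum>l\<in>UNIV. rho a k l x * T k l j x)"
    by (simp only: sum.distrib sum_distrib_left[symmetric])
  finally show "?f x = Z a j x" by (simp add: mult.assoc)
qed

lemma regular_T: "regular (T k l j)"
proof -
  have "pol (\<lambda>x. if k = j then L x $ l / 2 else 0)"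
    using pol_mult[OF pol_L pol_const, of l "1/2"] pol_const[of 0] by (cases "k = j") auto
  then have "regular (\<lambda>x. if k = j then L x $ l / 2 else 0)" using regular_pol by simp
  then show ?thesis unfolding T_def[abs_def] by (intro regular_add regular_C)
qed

lemma growth_T: "growth 1 (T k l j)"
proof -
  have "growth 1 (\<lambda>x. L x $ l * (1/2))" by (rule growth_mult[OF growth_L growth_poly[OF polyfun.const]]) simp
  then have "growth 1 (\<lambda>x. if k = j then L x $ l / 2 else 0)"
    using growth_mono[OF growth_poly[OF polyfun.const[of 0]], of 1] by (cases "k = j") auto
  then show ?thesis unfolding T_def[abs_def] by (intro growth_add growth_C)
qed

lemma growth_Gam: "growth (- 1) (\<lambda>x. Gam k x $ a $ l)"
proof (rule growth_congU)
  show "growth (- 1) (\<lambda>x. \<Sum>b\<in>UNIV. C k x $ a $ b * m x $ b $ l)"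
    by (intro growth_sum growth_mult[OF growth_C growth_m]) simp
qed (simp add: Gam_C matrix_matrix_mult_def)

lemma Z_const: "\<exists>b. \<forall>x. D x \<noteq> 0 \<longrightarrow> Z a j x = b"
proof (rule bounded_const[OF _ pole_Z])
  show "regular (Z a j)" unfolding Z_def[abs_def] by (intro regular_sum regular_mult regular_Gam regular_T)
  show "growth 0 (Z a j)" unfolding Z_def[abs_def] by (intro growth_sum growth_mult[OF growth_Gam growth_T]) simp
qed

text \<open>
  The first two terms of \<open>raised_ricci\<close> are derivatives of affine functions, and \<open>Z\<close> is bounded at
  the boundary and at infinity. The commutation relation is the symmetry of the Ricci tensor.
\<close>

theorem ricci_endomorphism_const:
  obtains R where "\<And>x i j. D x \<noteq> 0 \<Longrightarrow> ricci UNIV G i j x = (m x ** R) $ i $ j"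
    "\<And>x. R ** G x = G x ** transpose R"
proof -
  define a1 where "a1 = (\<lambda>k j a. SOME b. \<forall>x. D x \<noteq> 0 \<longrightarrow> cpartial k (\<lambda>y. C j y $ k $ a) x = b)"
  define a2 where "a2 = (\<lambda>j a. SOME b. \<forall>x. D x \<noteq> 0 \<longrightarrow> dL j a x = b)"
  define a3 where "a3 = (\<lambda>a j. SOME b. \<forall>x. D x \<noteq> 0 \<longrightarrow> Z a j x = b)"
  have a1: "\<forall>x. D x \<noteq> 0 \<longrightarrow> cpartial k (\<lambda>y. C j y $ k $ a) x = a1 k j a" for k j a
    unfolding a1_def by (rule someI_ex[OF dC_const])
  have a2: "\<forall>x. D x \<noteq> 0 \<longrightarrow> dL j a x = a2 j a" for j a
    unfolding a2_def by (rule someI_ex[OF dL_const])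
  have a3: "\<forall>x. D x \<noteq> 0 \<longrightarrow> Z a j x = a3 a j" for j a
    unfolding a3_def by (rule someI_ex[OF Z_const])
  define R where "R = (\<chi> a j. (\<Sum>k\<in>UNIV. a1 k j a) + a2 j a / 2 + a3 a j)"
  define Q where "Q x = (\<chi> i j. ricci UNIV G i j x)" for x
  have GQ: "G x ** Q x = R" if "D x \<noteq> 0" for x
    using raised_ricci[OF that] by (simp add: vec_eq_iff matrix_matrix_mult_def Q_def R_def a1[rule_format, OF that] a2[rule_format, OF that] a3[rule_format, OF that])
  have Qm: "Q x = m x ** R" if "D x \<noteq> 0" for x
    unfolding GQ[OF that, symmetric] by (simp add: matrix_mul_assoc m_inv[OF that])
  have RG: "(R ** G x) $ i $ j = (G x ** transpose R) $ i $ j" for x i j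
  proof (rule dense_eq[of 2 "\<lambda>x. (R ** G x) $ i $ j" 2 "\<lambda>x. (G x ** transpose R) $ i $ j"])
    show "polyfun 2 (\<lambda>x. (R ** G x) $ i $ j)" unfolding matrix_matrix_mult_def vec_lambda_beta
      by (intro polyfun_sum polyfun_cmult polyG)
    show "polyfun 2 (\<lambda>x. (G x ** transpose R) $ i $ j)" unfolding matrix_matrix_mult_def vec_lambda_beta
      by (subst mult.commute) (intro polyfun_sum polyfun_cmult polyG)
    fix x assume D: "D x \<noteq> 0"
    have "transpose (Q x) = Q x" using ricci_sym[OF D] by (simp add: vec_eq_iff transpose_def Q_def)
    then have "R ** G x = G x ** transpose R"
      unfolding GQ[OF D, symmetric] by (simp add: matrix_transpose_mul transpose_G matrix_mul_assoc)
    then show "(R ** G x) $ i $ j = (G x ** transpose R) $ i $ j" by simp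
  qed
  show thesis
  proof (rule that[of R])
    show "ricci UNIV G i j x = (m x ** R) $ i $ j" if "D x \<noteq> 0" for x i j
      using arg_cong[OF Qm[OF that], of "\<lambda>A. A $ i $ j"] by (simp add: Q_def)
    show "R ** G x = G x ** transpose R" for x
      using RG by (simp add: vec_eq_iff)
  qed
qed

end

section \<open>Splitting into Einstein blocks\<close>

context cometric
begin

text \<open>
  If \<open>u\<close> is annihilated by the boundary gradients, then the polar part of the metric does not
  contribute to \<open>G\<inverse> u\<close>, which is therefore bounded and decays, hence vanishes.
\<close>

lemma boundary_gradients_separate:
  assumes orth: "\<And>x. D x = 0 \<Longrightarrow> d x \<noteq> 0 \<Longrightarrow> (\<Sum>j\<in>UNIV. d x $ j * u $ j) = 0"
  shows "u = 0"
proof -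
  obtain x0 where x0: "D x0 \<noteq> 0" using generic by blast
  have "(m x0 *v u) $ i = 0" for i
  proof (rule decaying_zero[of "\<lambda>x. (m x *v u) $ i"])
    show "regular (\<lambda>x. (m x *v u) $ i)" unfolding matrix_vector_mult_def vec_lambda_beta
      by (intro regular_sum regular_mult regular_m regular_const)
    have "growth (- 2) (\<lambda>x. (m x *v u) $ i)" unfolding matrix_vector_mult_def vec_lambda_beta
      by (intro growth_sum growth_mult[OF growth_m growth_poly[OF polyfun.const]]) simp
    then show "growth (- 1) (\<lambda>x. (m x *v u) $ i)" by (rule growth_mono) simp
    have "pole (- 1) (\<lambda>x. \<Sum>j\<in>UNIV. d x $ j * u $ j)"
      by (intro pole_zero pol_sum pol_mult pol_d pol_const orth)
    then have "pole 0 (\<lambda>x. (\<Sum>j\<in>UNIV. d x $ j * u $ j) * (1 / D x))"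
      by (rule pole_mult[OF _ pole_inverse_D]) simp
    from pole_mult[OF pole_mult[OF pole_pol[OF pol_d] pole_inverse_E order_refl] this, of 0]
    have "pole 0 (\<lambda>x. d x $ i * (1 / E x) * ((\<Sum>j\<in>UNIV. d x $ j * u $ j) * (1 / D x)) + (\<Sum>j\<in>UNIV. r x $ i $ j * u $ j))"
      by (intro pole_add pole_sum pole_mult[OF pole_r pole_pol[OF pol_const]]) auto
    then show "pole 0 (\<lambda>x. (m x *v u) $ i)"
    proof (rule pole_cong)
      fix x assume "D x \<noteq> 0" "E x \<noteq> 0"
      then show "d x $ i * (1 / E x) * ((\<Sum>j\<in>UNIV. d x $ j * u $ j) * (1 / D x)) + (\<Sum>j\<in>UNIV. r x $ i $ j * u $ j) = (m x *v u) $ i"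
        by (simp add: matrix_vector_mult_def m_r distrib_left distrib_right sum.distrib sum_distrib_left sum_divide_distrib mult_ac)
    qed
  qed (rule x0)
  then have "m x0 *v u = 0" by (simp add: vec_eq_iff)
  then have "G x0 *v (m x0 *v u) = 0" by simp
  then show ?thesis by (simp add: matrix_vector_mul_assoc m_inv[OF x0])
qed

text \<open>
  A maximal independent set \<open>B\<close> of boundary gradients, completed to a basis, which is dual to some other
  basis. A basis vector outside \<open>B\<close> would have a dual vector annihilated by all boundary gradients.
\<close>

lemma boundary_gradient_basis:
  obtains A :: "complex ^ 'n ^ 'n" where "invertible A" "\<And>i. \<exists>q. D q = 0 \<and> d q \<noteq> 0 \<and> row i A = d q"
proof -
  define X where "X = {d q | q. D q = 0 \<and> d q \<noteq> 0}"
  obtain B where B: "B \<subseteq> X" "vec.independent B" "X \<subseteq> vec.span B"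
    using vec.maximal_independent_subset[of X] .
  obtain B' where B': "B \<subseteq> B'" "B' \<subseteq> UNIV" "vec.independent B'" "UNIV \<subseteq> vec.span B'"
    using vec.maximal_independent_subset_extend[OF subset_UNIV B(2)] .
  have "card B' = CARD('n)"
    using vec.basis_card_eq_dim[OF B'(2,4,3)] by (simp only: vec_dim_card)
  moreover have "finite B'" by (rule vec.finiteI_independent[OF B'(3)])
  ultimately
  obtain f where f: "bij_betw f (UNIV :: 'n set) B'"
    using finite_same_card_bij[of "UNIV :: 'n set" B'] by auto
  define A :: "complex ^ 'n ^ 'n" where "A = (\<chi> i. f i)"
  have row: "row i A = f i" for i by (simp add: A_def row_def vec_eq_iff)
  have "rows A = B'" using f by (auto simp: rows_def row bij_betw_def)
  then obtain A' where A': "A' ** A = mat 1"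
    using matrix_left_invertible_span_rows_gen[of A] B'(4) by auto
  then have inv: "invertible A" using invertible_left_inverse by blast
  have AA': "A ** A' = mat 1" using A' matrix_left_right_inverse by blast
  have "f i \<in> B" for i
  proof (rule ccontr)
    assume fi: "f i \<notin> B"
    define u where "u = column i A'"
    have dual: "(\<Sum>j\<in>UNIV. f k $ j * u $ j) = (if k = i then 1 else 0)" for k
    proof -
      have "(A ** A') $ k $ i = (if k = i then 1 else 0)" by (simp add: AA' mat_def)
      then show ?thesis by (simp add: matrix_matrix_mult_def A_def u_def column_def)
    qed
    have "vec.span B \<subseteq> {s. (\<Sum>j\<in>UNIV. s $ j * u $ j) = 0}"
    proof (rule vec.span_minimal)
      show "B \<subseteq> {s. (\<Sum>j\<in>UNIV. s $ j * u $ j) = 0}"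
      proof
        fix b assume b: "b \<in> B"
        then obtain k where k: "b = f k" using B'(1) f by (auto simp: bij_betw_def)
        then have "k \<noteq> i" using b fi by auto
        then show "b \<in> {s. (\<Sum>j\<in>UNIV. s $ j * u $ j) = 0}" using dual[of k] k by simp
      qed
      show "vec.subspace {s. (\<Sum>j\<in>UNIV. s $ j * u $ j) = 0}"
        by (rule vec.subspaceI) (auto simp: distrib_right sum.distrib mult.assoc simp flip: sum_distrib_left)
    qed
    then have "u = 0"
      using B(3) by (intro boundary_gradients_separate) (auto simp: X_def)
    then show False using dual[of i] by simp
  qed
  then show thesis using that[OF inv] B(1) by (fastforce simp: row X_def)
qed

text \<open>
  \<open>G\<close> is block diagonal for \<open>I\<close> and its complement. That the blocks depend only on their own
  coordinates is a consequence (\<open>decoupled_local\<close>).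
\<close>

definition decoupled :: "'n set \<Rightarrow> bool" where
  "decoupled I \<longleftrightarrow> (\<forall>x i j. i \<in> I \<longrightarrow> j \<notin> I \<longrightarrow> G x $ i $ j = 0)"

lemma decoupledD: assumes "decoupled I" "(i \<in> I) \<noteq> (j \<in> I)" shows "G x $ i $ j = 0" "dG l x $ i $ j = 0"
proof -
  show z: "G x $ i $ j = 0" for x
    using assms sym[of x i j] by (cases "i \<in> I") (auto simp: decoupled_def)
  show "dG l x $ i $ j = 0" by (simp add: dG_def z)
qed

lemma decoupled_Compl: "decoupled I \<Longrightarrow> decoupled (- I)"
  by (simp add: decoupled_def sym[of _ _ _]) (metis sym)

text \<open>
  The projection of \<open>d\<close> to the coordinates in \<open>I\<close> is again in the kernel of \<open>G\<close>, hence a multiple of \<open>d\<close>.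
\<close>

lemma boundary_gradient_side:
  assumes I: "decoupled I" and q: "D q = 0" "d q \<noteq> 0"
  shows "(\<forall>j\<in>I. d q $ j = 0) \<or> (\<forall>j. j \<notin> I \<longrightarrow> d q $ j = 0)"
proof -
  define p where "p = (\<chi> j. if j \<in> I then d q $ j else 0)"
  have "G q *v p = 0"
  proof -
    have "(\<Sum>j\<in>UNIV. G q $ k $ j * p $ j) = 0" for k
    proof (cases "k \<in> I")
      case True
      have "(\<Sum>j\<in>UNIV. G q $ k $ j * p $ j) = (\<Sum>j\<in>UNIV. G q $ k $ j * d q $ j)"
        by (intro sum.cong refl) (use True decoupledD[OF I] in \<open>auto simp: p_def\<close>)
      then show ?thesis using tangent'[of q k] q by simp
    next
      case False
      show ?thesis by (intro sum.neutral ballI) (use False decoupledD[OF I] in \<open>auto simp: p_def\<close>)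
    qed
    then show ?thesis by (simp add: vec_eq_iff matrix_vector_mult_def)
  qed
  then obtain c where "p = c *s d q" using boundary_kernel(3)[OF q] by blast
  then have c: "(if j \<in> I then d q $ j else 0) = c * d q $ j" for j
    by (simp add: vec_eq_iff p_def)
  show ?thesis
  proof (cases "c = 0")
    case True
    then have "\<forall>j\<in>I. d q $ j = 0" using c by (metis mult_zero_left)
    then show ?thesis ..
  next
    case False
    then have "\<forall>j. j \<notin> I \<longrightarrow> d q $ j = 0" using c by (metis mult_eq_0_iff)
    then show ?thesis ..
  qed
qed

text \<open>
  This kills the polar part of \<open>dG l\<close> times the metric. If \<open>d\<close> has no components in \<open>I\<close>, the sum is
  zero because \<open>G\<close> is block diagonal. If \<open>d\<close> has only components in \<open>I\<close>, differentiate
  \<open>G d = D L\<close>: it remains to see that the component \<open>l\<close> of \<open>d\<close> has derivative zero along the tangent vector \<open>G $ i\<close>. The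
  derivatives \<open>y\<close> of all components outside \<open>I\<close> along this vector form a vector in the kernel of
  \<open>G\<close>, so a multiple of \<open>d\<close>; but \<open>d\<close> has no components outside \<open>I\<close>.
\<close>

lemma dG_d_boundary:
  assumes I: "decoupled I" and il: "i \<in> I" "l \<notin> I" and q: "D q = 0" "d q \<noteq> 0"
  shows "(\<Sum>j\<in>UNIV. dG l q $ i $ j * d q $ j) = 0"
  using boundary_gradient_side[OF I q]
proof
  assume "\<forall>j\<in>I. d q $ j = 0"
  then show ?thesis by (intro sum.neutral ballI) (use il decoupledD[OF I] in auto)
next
  assume off: "\<forall>j. j \<notin> I \<longrightarrow> d q $ j = 0"
  define y where "y = (\<chi> j. if j \<in> I then 0 else \<Sum>c\<in>UNIV. G q $ i $ c * J c j q)"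
  have "G q *v y = 0"
  proof -
    have "(\<Sum>j\<in>UNIV. G q $ k $ j * y $ j) = 0" for k
    proof (cases "k \<in> I")
      case True
      show ?thesis by (intro sum.neutral ballI) (use True decoupledD[OF I] in \<open>auto simp: y_def\<close>)
    next
      case False
      have "(\<Sum>j\<in>UNIV. G q $ k $ j * J c j q) = d q $ c * L q $ k" for c
      proof -
        have "(\<Sum>j\<in>UNIV. dG c q $ k $ j * d q $ j) = 0"
        proof (intro sum.neutral ballI)
          fix j show "dG c q $ k $ j * d q $ j = 0"
            using False off decoupledD(2)[OF I, of k j] by (cases "j \<in> I") auto
        qed
        then show ?thesis using diff_tangent[of c q k] q by (simp add: sum.distrib)
      qed
      moreover have "(\<Sum>j\<in>UNIV. G q $ k $ j * y $ j) = (\<Sum>j\<in>UNIV. \<Sum>c\<in>UNIV. G q $ i $ c * (G q $ k $ j * J c j q))"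
        by (intro sum.cong refl) (use False decoupledD[OF I] in \<open>auto simp: y_def sum_distrib_left mult_ac\<close>)
      moreover have "\<dots> = (\<Sum>c\<in>UNIV. G q $ i $ c * (\<Sum>j\<in>UNIV. G q $ k $ j * J c j q))"
        by (subst sum.swap) (simp add: sum_distrib_left)
      moreover have "(\<Sum>c\<in>UNIV. G q $ i $ c * (d q $ c * L q $ k)) = (\<Sum>c\<in>UNIV. G q $ i $ c * d q $ c) * L q $ k"
        by (simp add: sum_distrib_right mult.assoc)
      ultimately show ?thesis using tangent'[of q i] q by simp
    qed
    then show ?thesis by (simp add: vec_eq_iff matrix_vector_mult_def)
  qed
  then obtain c where "y = c *s d q" using boundary_kernel(3)[OF q] by blast
  then have "y $ l = c * d q $ l" by simp
  then have "(\<Sum>c\<in>UNIV. G q $ i $ c * J l c q) = 0" using off il by (simp add: y_def J_sym[of l])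
  then show ?thesis using diff_tangent[of l q i] q off il by (simp add: sum.distrib)
qed

lemma decoupled_independent:
  assumes I: "decoupled I" and il: "i \<in> I" "l \<notin> I"
  shows "dG l x $ i $ j = 0"
proof (rule dense_eq[OF poly_dG polyfun.const[of 0]])
  fix x assume D: "D x \<noteq> 0"
  have "(dG l x ** m x) $ i $ a = 0" for a
  proof (rule decaying_zero[of "\<lambda>x. (dG l x ** m x) $ i $ a", OF _ _ _ D])
    show "regular (\<lambda>x. (dG l x ** m x) $ i $ a)" unfolding matrix_matrix_mult_def vec_lambda_beta
      by (intro regular_sum regular_mult regular_m regular_pol pol_dG)
    show "growth (- 1) (\<lambda>x. (dG l x ** m x) $ i $ a)" unfolding matrix_matrix_mult_def vec_lambda_beta
      by (intro growth_sum growth_mult[OF growth_poly[OF poly_dG] growth_m]) simp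
    have "pole (- 1) (\<lambda>x. \<Sum>j\<in>UNIV. dG l x $ i $ j * d x $ j)"
      by (intro pole_zero pol_sum pol_mult pol_d pol_dG dG_d_boundary[OF I il])
    then have "pole 0 (\<lambda>x. (\<Sum>j\<in>UNIV. dG l x $ i $ j * d x $ j) * (1 / D x))"
      by (rule pole_mult[OF _ pole_inverse_D]) simp
    from pole_mult[OF pole_mult[OF pole_pol[OF pol_d] pole_inverse_E order_refl] this, of 0]
    have "pole 0 (\<lambda>x. d x $ a * (1 / E x) * ((\<Sum>j\<in>UNIV. dG l x $ i $ j * d x $ j) * (1 / D x)) + (\<Sum>j\<in>UNIV. dG l x $ i $ j * r x $ j $ a))"
      by (intro pole_add pole_sum pole_mult[OF pole_pol[OF pol_dG] pole_r]) auto
    then show "pole 0 (\<lambda>x. (dG l x ** m x) $ i $ a)"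
    proof (rule pole_cong)
      fix x assume "D x \<noteq> 0" "E x \<noteq> 0"
      then show "d x $ a * (1 / E x) * ((\<Sum>j\<in>UNIV. dG l x $ i $ j * d x $ j) * (1 / D x)) + (\<Sum>j\<in>UNIV. dG l x $ i $ j * r x $ j $ a) = (dG l x ** m x) $ i $ a"
        by (simp add: matrix_matrix_mult_def m_r distrib_left sum.distrib sum_distrib_left sum_divide_distrib mult_ac)
    qed
  qed
  then have "(dG l x ** m x ** G x) $ i $ j = 0" by (simp add: matrix_matrix_mult_def[of "dG l x ** m x"])
  then show "dG l x $ i $ j = 0" by (simp add: m_inv[OF D] flip: matrix_mul_assoc)
qed

lemma decoupled_local:
  assumes I: "decoupled I" and i: "i \<in> I" and xy: "\<And>k. k \<in> I \<Longrightarrow> x $ k = y $ k"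
  shows "G x $ i $ j = G y $ i $ j"
proof -
  let ?v = "y - x"
  obtain p where p: "\<And>z. G (x + z *s ?v) $ i $ j = poly p z" using polyfun_on_line[OF polyG] by blast
  have "poly (pderiv p) z = 0" for z
  proof -
    have "((\<lambda>z. G (x + z *s ?v) $ i $ j) has_field_derivative (\<Sum>l\<in>UNIV. (\<chi> l. cpartial l (\<lambda>x. G x $ i $ j) (x + z *s ?v)) $ l * ?v $ l)) (at z)"
      by (rule has_grad_direction[OF cdiffD[OF cdiff_G]])
    moreover have "(\<Sum>l\<in>UNIV. (\<chi> l. cpartial l (\<lambda>x. G x $ i $ j) (x + z *s ?v)) $ l * ?v $ l) = 0"
    proof (intro sum.neutral ballI)
      fix l
      show "(\<chi> l. cpartial l (\<lambda>x. G x $ i $ j) (x + z *s ?v)) $ l * ?v $ l = 0"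
        using decoupled_independent[OF I i, of l "x + z *s ?v" j] xy[of l]
        by (cases "l \<in> I") (auto simp: dG_def)
    qed
    ultimately have der: "((\<lambda>z. G (x + z *s ?v) $ i $ j) has_field_derivative 0) (at z)" by (simp only:)
    have "(\<lambda>z. G (x + z *s ?v) $ i $ j) = poly p" using p by (intro ext)
    from der[unfolded this] have "(poly p has_field_derivative 0) (at z)" .
    then show ?thesis using poly_DERIV DERIV_unique by blast
  qed
  then have "pderiv p = 0" by (metis poly_all_0_iff_0)
  then have "degree p = 0" by (simp add: pderiv_eq_0_iff)
  then have "poly p 0 = poly p 1" by (metis degree_eq_zeroE poly_const_conv)
  then show ?thesis using p[of 0] p[of 1] by simp
qed

lemma m_decoupled:
  assumes I: "decoupled I" and D: "D x \<noteq> 0" and ij: "(i \<in> I) \<noteq> (j \<in> I)"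
  shows "m x $ i $ j = 0"
proof -
  define e :: "complex ^ 'n ^ 'n" where "e = (\<chi> i j. if i = j \<and> i \<in> I then 1 else 0)"
  have eX: "(e ** X) $ i $ j = (if i \<in> I then X $ i $ j else 0)" for X :: "complex ^ 'n ^ 'n" and i j
  proof -
    have "(\<Sum>k\<in>UNIV. e $ i $ k * X $ k $ j) = (\<Sum>k\<in>UNIV. if k = i then (if i \<in> I then X $ i $ j else 0) else 0)"
      by (intro sum.cong refl) (auto simp: e_def)
    then show ?thesis by (simp add: matrix_matrix_mult_def)
  qed
  have Xe: "(X ** e) $ i $ j = (if j \<in> I then X $ i $ j else 0)" for X :: "complex ^ 'n ^ 'n" and i j
  proof -
    have "(\<Sum>k\<in>UNIV. X $ i $ k * e $ k $ j) = (\<Sum>k\<in>UNIV. if k = j then (if j \<in> I then X $ i $ j else 0) else 0)"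
      by (intro sum.cong refl) (auto simp: e_def)
    then show ?thesis by (simp add: matrix_matrix_mult_def)
  qed
  have "e ** G x = G x ** e"
    using decoupledD(1)[OF I] by (auto simp: vec_eq_iff eX Xe)
  then have "m x ** (e ** G x) ** m x = m x ** (G x ** e) ** m x" by simp
  then have "m x ** e ** (G x ** m x) = m x ** G x ** (e ** m x)" by (simp add: matrix_mul_assoc)
  then have "m x ** e = e ** m x" by (simp add: m_inv[OF D])
  then have "(m x ** e) $ i $ j = (e ** m x) $ i $ j" by simp
  then show ?thesis using ij by (auto simp: eX Xe split: if_splits)
qed

lemma dm_decoupled:
  assumes I: "decoupled I" and D: "D x \<noteq> 0" and ij: "\<not> ((i \<in> I) = (j \<in> I) \<and> (l \<in> I) = (j \<in> I))"
  shows "dm l x $ i $ j = 0"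
proof (cases "(i \<in> I) = (j \<in> I)")
  case False
  have "cpartial l (\<lambda>y. m y $ i $ j) x = cpartial l (\<lambda>y. 0) x"
    by (rule cpartial_cong_U[OF D]) (rule m_decoupled[OF I _ False])
  then show ?thesis by (simp add: dm_def)
next
  case True
  have "m x ** dG l x ** m x = - (m x ** G x ** dm l x ** (G x ** m x))"
    by (simp add: dm_dG[OF D] matrix_mul_assoc matrix_mult_minus_left matrix_mult_minus_right)
  then have "dm l x = - (m x ** (dG l x ** m x))" by (simp add: m_inv[OF D] matrix_mul_assoc)
  moreover have "(m x ** (dG l x ** m x)) $ i $ j = 0"
  proof -
    have "m x $ i $ a * (dG l x ** m x) $ a $ j = 0" for a
    proof (cases "(a \<in> I) = (i \<in> I)")
      case False
      then show ?thesis using m_decoupled[OF I D, of i a] by auto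
    next
      case a: True
      have "dG l x $ a $ b = 0" for b
      proof (cases "a \<in> I")
        case True
        then show ?thesis using a ij \<open>(i \<in> I) = (j \<in> I)\<close> by (intro decoupled_independent[OF I]) auto
      next
        case False
        then show ?thesis using a ij \<open>(i \<in> I) = (j \<in> I)\<close>
          by (intro decoupled_independent[OF decoupled_Compl[OF I]]) auto
      qed
      then show ?thesis by (simp add: matrix_matrix_mult_def)
    qed
    then show ?thesis unfolding matrix_matrix_mult_def[of "m x"] vec_lambda_beta by (intro sum.neutral ballI)
  qed
  ultimately show ?thesis by simp
qed

lemma Gam_decoupled:
  assumes I: "decoupled I" and D: "D x \<noteq> 0" and ij: "\<not> ((i \<in> I) = (j \<in> I) \<and> (k \<in> I) = (j \<in> I))"
  shows "Gam i x $ k $ j = 0"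
proof -
  have "G x $ k $ l * Lam i x $ l $ j = 0" for l
  proof (cases "(k \<in> I) = (l \<in> I)")
    case False
    then show ?thesis using decoupledD(1)[OF I] by simp
  next
    case True
    have "dm i x $ j $ l = 0" "dm j x $ i $ l = 0" "dm l x $ i $ j = 0"
      using True ij by (auto intro!: dm_decoupled[OF I D])
    then show ?thesis by (simp add: Lam_def)
  qed
  then show ?thesis unfolding Gam_Lam matrix_matrix_mult_def vec_lambda_beta by (intro sum.neutral ballI)
qed

lemma metric_of_decoupled:
  assumes I: "decoupled I" and D: "D x \<noteq> 0" and ij: "i \<in> I" "j \<in> I"
  shows "metric_of I G x $ i $ j = m x $ i $ j"
proof -
  have "block I (G x) ** block I (m x) = mat 1"
  proof -
    have "(\<Sum>k\<in>UNIV. block I (G x) $ i $ k * block I (m x) $ k $ j) = (if i = j then 1 else 0)" for i j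
    proof (cases "i \<in> I")
      case True
      have GM: "(\<Sum>k\<in>UNIV. G x $ i $ k * m x $ k $ j) = (if i = j then 1 else 0)"
        using arg_cong[OF m_inv(1)[OF D], of "\<lambda>A. A $ i $ j"] by (simp add: matrix_matrix_mult_def mat_def)
      show ?thesis
      proof (cases "j \<in> I")
        case j: True
        have "(\<Sum>k\<in>UNIV. block I (G x) $ i $ k * block I (m x) $ k $ j) = (\<Sum>k\<in>UNIV. G x $ i $ k * m x $ k $ j)"
          by (intro sum.cong refl) (use True j decoupledD(1)[OF I] in \<open>auto simp: block_def\<close>)
        then show ?thesis using GM by simp
      next
        case False
        have "(\<Sum>k\<in>UNIV. block I (G x) $ i $ k * block I (m x) $ k $ j) = 0"
          by (intro sum.neutral ballI) (use True False in \<open>auto simp: block_def\<close>)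
        then show ?thesis using True False by auto
      qed
    next
      case False
      have "(\<Sum>k\<in>UNIV. block I (G x) $ i $ k * block I (m x) $ k $ j) = (\<Sum>k\<in>UNIV. if k = i then block I (m x) $ k $ j else 0)"
        by (intro sum.cong refl) (use False in \<open>auto simp: block_def\<close>)
      then show ?thesis using False by (simp add: block_def)
    qed
    then show ?thesis by (simp add: vec_eq_iff matrix_matrix_mult_def mat_def)
  qed
  then have "metric_of I G x = block I (m x)" unfolding metric_of_def by (rule matrix_inv_unique)
  then show ?thesis using ij by (simp add: block_def)
qed

lemma christoffel_decoupled:
  assumes I: "decoupled I" and D: "D x \<noteq> 0" and ij: "i \<in> I" "j \<in> I" "k \<in> I"
  shows "christoffel I G k i j x = Gam i x $ k $ j"
proof -
  have cp: "cpartial a (\<lambda>y. metric_of I G y $ b $ c) x = dm a x $ b $ c" if "b \<in> I" "c \<in> I" for a b c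
    unfolding dm_def vec_lambda_beta by (rule cpartial_cong_U[OF D]) (rule metric_of_decoupled[OF I _ that])
  have "christoffel I G k i j x = (\<Sum>l\<in>I. G x $ k $ l * Lam i x $ l $ j)"
    unfolding christoffel_def sum_distrib_left using ij by (intro sum.cong refl) (simp add: cp Lam_def)
  also have "\<dots> = (\<Sum>l\<in>UNIV. G x $ k $ l * Lam i x $ l $ j)"
    by (rule sum.mono_neutral_left) (use ij decoupledD(1)[OF I] in auto)
  finally show ?thesis by (simp add: Gam_Lam matrix_matrix_mult_def)
qed

lemma ricci_decoupled:
  assumes I: "decoupled I" and D: "D x \<noteq> 0" and ij: "i \<in> I" "j \<in> I"
  shows "ricci I G i j x = ricci UNIV G i j x"
proof -
  have ch: "christoffel UNIV G k i j = (\<lambda>x. Gam i x $ k $ j)" for k i j by (simp add: Gam_def)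
  have cp: "cpartial a (christoffel I G k b c) x = cpartial a (\<lambda>y. Gam b y $ k $ c) x" if "b \<in> I" "c \<in> I" "k \<in> I" for a b c k
    by (rule cpartial_cong_U[OF D]) (rule christoffel_decoupled[OF I _ that])
  have cp0: "cpartial a (\<lambda>y. Gam b y $ k $ c) x = 0" if "b \<in> I" "k \<notin> I" for a b c k
  proof -
    have "cpartial a (\<lambda>y. Gam b y $ k $ c) x = cpartial a (\<lambda>y. 0) x"
      by (rule cpartial_cong_U[OF D]) (rule Gam_decoupled[OF I], use that in auto)
    then show ?thesis by simp
  qed
  have g0: "Gam b x $ k $ c = 0" if "\<not> ((b \<in> I) = (c \<in> I) \<and> (k \<in> I) = (c \<in> I))" for b k c
    using Gam_decoupled[OF I D that] .
  have "ricci I G i j x = (\<Sum>k\<in>I. cpartial k (\<lambda>y. Gam i y $ k $ j) x - cpartial j (\<lambda>y. Gam i y $ k $ k) x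
     + (\<Sum>l\<in>UNIV. Gam k x $ k $ l * Gam i x $ l $ j - Gam j x $ k $ l * Gam i x $ l $ k))"
    unfolding ricci_def
  proof (rule sum.cong[OF refl])
    fix k assume k: "k \<in> I"
    have 1: "cpartial k (christoffel I G k i j) x - cpartial j (christoffel I G k i k) x =
      cpartial k (\<lambda>y. Gam i y $ k $ j) x - cpartial j (\<lambda>y. Gam i y $ k $ k) x"
      using k ij by (simp add: cp)
    have "(\<Sum>l\<in>I. christoffel I G k k l x * christoffel I G l i j x - christoffel I G k j l x * christoffel I G l i k x) =
      (\<Sum>l\<in>I. Gam k x $ k $ l * Gam i x $ l $ j - Gam j x $ k $ l * Gam i x $ l $ k)"
      using k ij by (intro sum.cong refl) (simp add: christoffel_decoupled[OF I D])
    also have "\<dots> = (\<Sum>l\<in>UNIV. Gam k x $ k $ l * Gam i x $ l $ j - Gam j x $ k $ l * Gam i x $ l $ k)"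
      by (rule sum.mono_neutral_left) (use k ij in \<open>auto simp: g0\<close>)
    finally show "cpartial k (christoffel I G k i j) x - cpartial j (christoffel I G k i k) x +
        (\<Sum>l\<in>I. christoffel I G k k l x * christoffel I G l i j x - christoffel I G k j l x * christoffel I G l i k x) =
      cpartial k (\<lambda>y. Gam i y $ k $ j) x - cpartial j (\<lambda>y. Gam i y $ k $ k) x +
        (\<Sum>l\<in>UNIV. Gam k x $ k $ l * Gam i x $ l $ j - Gam j x $ k $ l * Gam i x $ l $ k)"
      by (simp only: 1)
  qed
  also have "\<dots> = (\<Sum>k\<in>UNIV. cpartial k (\<lambda>y. Gam i y $ k $ j) x - cpartial j (\<lambda>y. Gam i y $ k $ k) x
     + (\<Sum>l\<in>UNIV. Gam k x $ k $ l * Gam i x $ l $ j - Gam j x $ k $ l * Gam i x $ l $ k))"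
  proof (rule sum.mono_neutral_left)
    show "\<forall>k\<in>UNIV - I. cpartial k (\<lambda>y. Gam i y $ k $ j) x - cpartial j (\<lambda>y. Gam i y $ k $ k) x
     + (\<Sum>l\<in>UNIV. Gam k x $ k $ l * Gam i x $ l $ j - Gam j x $ k $ l * Gam i x $ l $ k) = 0"
    proof
      fix k assume k: "k \<in> UNIV - I"
      have "Gam k x $ k $ l * Gam i x $ l $ j - Gam j x $ k $ l * Gam i x $ l $ k = 0" for l
        using k ij by (cases "l \<in> I") (auto simp: g0)
      then show "cpartial k (\<lambda>y. Gam i y $ k $ j) x - cpartial j (\<lambda>y. Gam i y $ k $ k) x
     + (\<Sum>l\<in>UNIV. Gam k x $ k $ l * Gam i x $ l $ j - Gam j x $ k $ l * Gam i x $ l $ k) = 0"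
        using k ij by (simp add: cp0)
    qed
  qed auto
  finally show ?thesis by (simp add: ricci_def ch)
qed

lemma cpartial_shift: "cpartial k f (x + t) = cpartial k (\<lambda>z. f (z + t)) x"
  by (simp add: cpartial_def add_ac)

lemma ricci_shift:
  assumes I: "decoupled I" and t: "\<And>k. k \<in> I \<Longrightarrow> t $ k = 0" and ij: "i \<in> I" "j \<in> I"
  shows "ricci I G i j (x + t) = ricci I G i j x" "metric_of I G (x + t) = metric_of I G x"
proof -
  have Gt: "G (z + t) $ k $ l = G z $ k $ l" if "k \<in> I" for z k l
    by (rule decoupled_local[OF I that]) (use t in simp)
  have "block I (G (z + t)) = block I (G z)" for z by (simp add: block_def vec_eq_iff Gt)
  then have mt: "metric_of I G (z + t) = metric_of I G z" for z by (simp add: metric_of_def)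
  then show "metric_of I G (x + t) = metric_of I G x" .
  have ch: "christoffel I G k a b (z + t) = christoffel I G k a b z" if "k \<in> I" for k a b z
    unfolding christoffel_def cpartial_shift using that by (simp add: Gt mt)
  show "ricci I G i j (x + t) = ricci I G i j x"
    unfolding ricci_def cpartial_shift by (intro sum.cong refl) (simp add: ch)
qed

text \<open>
  The block of \<open>I\<close> may be invertible where \<open>G\<close> is not. Changing only the coordinates outside
  \<open>I\<close>, to those of a point where \<open>G\<close> is invertible, makes all blocks invertible.
\<close>

lemma decoupled_extend:
  assumes I: "decoupled I" and x: "det (block I (G x)) \<noteq> 0"
  obtains t where "\<And>k. k \<in> I \<Longrightarrow> t $ k = 0" "D (x + t) \<noteq> 0"
proof -
  obtain y0 where y0: "D y0 \<noteq> 0" using generic by blast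
  define t where "t = (\<chi> k. if k \<in> I then 0 else y0 $ k - x $ k)"
  let ?y = "x + t"
  have GI: "G ?y $ i $ j = G x $ i $ j" if "i \<in> I" for i j
    by (rule decoupled_local[OF I that]) (simp add: t_def)
  have GJ: "G ?y $ i $ j = G y0 $ i $ j" if "i \<notin> I" for i j
    by (rule decoupled_local[OF decoupled_Compl[OF I]]) (use that in \<open>auto simp: t_def\<close>)
  have inj: "v = 0" if "det A \<noteq> 0" "A *v v = 0" for A :: "complex ^ 'n ^ 'n" and v
    using that by (metis invertible_det_nz invertible_left_inverse matrix_left_invertible_ker)
  have "u = 0" if u: "G ?y *v u = 0" for u
  proof -
    have u': "(\<Sum>j\<in>UNIV. G ?y $ i $ j * u $ j) = 0" for i
      using arg_cong[OF u, of "\<lambda>v. v $ i"] by (simp add: matrix_vector_mult_def)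
    define a b where "a = (\<chi> j. if j \<in> I then u $ j else 0)" and "b = (\<chi> j. if j \<in> I then 0 else u $ j)"
    have "block I (G x) *v a = 0"
    proof -
      have "(\<Sum>j\<in>UNIV. block I (G x) $ i $ j * a $ j) = 0" for i
      proof (cases "i \<in> I")
        case True
        have "(\<Sum>j\<in>UNIV. block I (G x) $ i $ j * a $ j) = (\<Sum>j\<in>UNIV. G ?y $ i $ j * u $ j)"
          by (intro sum.cong refl) (use True decoupledD(1)[OF I] in \<open>auto simp: block_def a_def GI\<close>)
        then show ?thesis using u' by simp
      next
        case False
        show ?thesis by (intro sum.neutral ballI) (use False in \<open>auto simp: block_def a_def\<close>)
      qed
      then show ?thesis by (simp add: vec_eq_iff matrix_vector_mult_def)
    qed
    then have a: "a = 0" using inj x by blast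
    have "G y0 *v b = 0"
    proof -
      have "(\<Sum>j\<in>UNIV. G y0 $ i $ j * b $ j) = 0" for i
      proof (cases "i \<in> I")
        case True
        show ?thesis by (intro sum.neutral ballI) (use True decoupledD(1)[OF I] in \<open>auto simp: b_def\<close>)
      next
        case False
        have "(\<Sum>j\<in>UNIV. G y0 $ i $ j * b $ j) = (\<Sum>j\<in>UNIV. G ?y $ i $ j * u $ j)"
          by (intro sum.cong refl) (use False decoupledD(1)[OF I] in \<open>auto simp: b_def GJ\<close>)
        then show ?thesis using u' by simp
      qed
      then show ?thesis by (simp add: vec_eq_iff matrix_vector_mult_def)
    qed
    then have b: "b = 0" using inj y0 by (simp add: D_def)
    show "u = 0" using a b by (simp add: vec_eq_iff a_def b_def) metis
  qed
  then have "\<exists>B. B ** G ?y = mat 1" using matrix_left_invertible_ker by blast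
  then have "D ?y \<noteq> 0" by (metis D_def invertible_det_nz invertible_left_inverse)
  then show thesis by (rule that[rotated]) (simp add: t_def)
qed

lemma decoupled_einstein:
  assumes I: "decoupled I" and ric: "\<And>x i j. D x \<noteq> 0 \<Longrightarrow> i \<in> I \<Longrightarrow> j \<in> I \<Longrightarrow> ricci UNIV G i j x = c * m x $ i $ j"
  shows "einstein_metric I G c"
  unfolding einstein_metric_def
proof (intro ballI impI)
  fix x i j assume det: "det (block I (G x)) \<noteq> 0" and ij: "i \<in> I" "j \<in> I"
  obtain t where t: "\<And>k. k \<in> I \<Longrightarrow> t $ k = 0" and D: "D (x + t) \<noteq> 0" using decoupled_extend[OF I det] by blast
  have "ricci I G i j (x + t) = c * metric_of I G (x + t) $ i $ j"
    using ricci_decoupled[OF I D ij] ric[OF D ij] metric_of_decoupled[OF I D ij] by simp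
  then show "ricci I G i j x = c * metric_of I G x $ i $ j"
    using ricci_shift[OF I t ij] by simp
qed

text \<open>
  \<open>R\<^sup>T\<close> preserves the kernel of \<open>G\<close>, which at a boundary point is spanned by the gradient.
\<close>

lemma symmetric_endomorphism_eigenvector:
  assumes R: "\<And>x. R ** G x = G x ** transpose R" and q: "D q = 0" "d q \<noteq> 0"
  shows "\<exists>c. transpose R *v d q = c *s d q"
proof (rule boundary_kernel(3)[OF q])
  have "G q *v (transpose R *v d q) = R *v (G q *v d q)"
    by (simp only: matrix_vector_mul_assoc R)
  then show "G q *v (transpose R *v d q) = 0" using tangent[of q] q by (simp del: transpose_matrix_vector)
qed

text \<open>
  The coordinate covectors are boundary gradients, so \<open>R\<close> is diagonal; its eigenvalues are the
  Einstein constants, and coordinates with equal eigenvalue form a block.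
\<close>

theorem adapted_decomposition:
  assumes adapted: "\<And>i. \<exists>q c. D q = 0 \<and> c \<noteq> 0 \<and> d q = c *s axis i 1"
  shows "\<exists>P. direct_sum_wrt P G \<and> (\<forall>I\<in>P. \<exists>c. einstein_metric I G c)"
proof -
  obtain R where ric: "\<And>x i j. D x \<noteq> 0 \<Longrightarrow> ricci UNIV G i j x = (m x ** R) $ i $ j"
    and R: "\<And>x. R ** G x = G x ** transpose R" using ricci_endomorphism_const by blast
  have diag: "R $ i $ j = 0" if "i \<noteq> j" for i j
  proof -
    obtain q c where q: "D q = 0" "c \<noteq> 0" "d q = c *s axis i 1" using adapted by blast
    then have "d q \<noteq> 0" by (auto simp: vec_eq_iff axis_def)
    then obtain b where "transpose R *v d q = b *s d q" using symmetric_endomorphism_eigenvector[OF R] q by blast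
    then have "(transpose R *v d q) $ j = b * d q $ j" by simp
    then have "c * R $ i $ j = 0"
      using that q by (simp add: matrix_vector_mult_def transpose_def axis_def if_distrib cong: if_cong del: transpose_matrix_vector)
    then show ?thesis using q by simp
  qed
  define lam where "lam i = R $ i $ i" for i
  define I where "I i = {j. lam j = lam i}" for i
  have RX: "(R ** X) $ i $ j = lam i * X $ i $ j" for X :: "complex ^ 'n ^ 'n" and i j
  proof -
    have "(\<Sum>k\<in>UNIV. R $ i $ k * X $ k $ j) = (\<Sum>k\<in>UNIV. if k = i then R $ i $ i * X $ i $ j else 0)"
      by (intro sum.cong refl) (use diag in auto)
    then show ?thesis by (simp add: matrix_matrix_mult_def lam_def)
  qed
  have XR: "(X ** R) $ i $ j = X $ i $ j * lam j" for X :: "complex ^ 'n ^ 'n" and i j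
  proof -
    have "(\<Sum>k\<in>UNIV. X $ i $ k * R $ k $ j) = (\<Sum>k\<in>UNIV. if k = j then X $ i $ j * R $ j $ j else 0)"
      by (intro sum.cong refl) (use diag in auto)
    then show ?thesis by (simp add: matrix_matrix_mult_def lam_def)
  qed
  have "transpose R = R" using diag by (simp add: vec_eq_iff transpose_def) metis
  then have comm: "lam i * G x $ i $ j = G x $ i $ j * lam j" for x i j
    using R[of x] RX[of "G x" i j] XR[of "G x" i j] by auto
  have dec: "decoupled (I i)" for i
  proof -
    have "G x $ j $ k = 0 \<or> lam j = lam k" for x j k using comm[of j x k] by auto
    then show ?thesis unfolding decoupled_def I_def mem_Collect_eq by metis
  qed
  let ?P = "range I"
  have part: "partition_on UNIV ?P"
    by (rule partition_onI) (auto simp: I_def disjnt_def)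
  have "direct_sum_wrt ?P G"
    unfolding direct_sum_wrt_def
  proof (intro conjI part ballI allI impI)
    fix J i j and x :: "complex ^ 'n" assume "J \<in> ?P" "i \<in> J" "j \<notin> J"
    then show "G x $ i $ j = 0" using dec decoupledD(1) by blast
  next
    fix J i j and x y :: "complex ^ 'n" assume "J \<in> ?P" "i \<in> J" "j \<in> J" "\<forall>k\<in>J. x $ k = y $ k"
    then show "G x $ i $ j = G y $ i $ j" using dec decoupled_local by blast
  qed
  moreover have "einstein_metric (I i) G (lam i)" for i
    by (rule decoupled_einstein[OF dec]) (simp add: ric XR, simp add: I_def)
  ultimately show ?thesis by blast
qed

end

section \<open>Adapted linear coordinates and the theorem\<close>

lemma matrix_mult_axis: "A *v axis i 1 = column i (A :: complex ^ 'n ^ ('n::finite))"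
  by (simp add: vec_eq_iff matrix_vector_mult_def axis_def column_def if_distrib cong: if_cong)

context cometric
begin

lemma d_linear_change:
  fixes B :: "complex ^ 'n ^ 'n"
  shows "(\<chi> i. cpartial i (\<lambda>y. b * D (B *v y)) y) = b *s (transpose B *v d (B *v y))"
proof -
  have "cpartial i (\<lambda>y. b * D (B *v y)) y = b * (\<Sum>k\<in>UNIV. B $ k $ i * d (B *v y) $ k)" for i
  proof -
    have col: "B *v (y + z *s axis i 1) = B *v y + z *s column i B" for z
      by (simp add: matrix_vector_right_distrib vector_scalar_commute matrix_mult_axis)
    have "((\<lambda>z. D (B *v y + z *s column i B)) has_field_derivative (\<Sum>k\<in>UNIV. d (B *v y + 0 *s column i B) $ k * column i B $ k)) (at 0)"
      by (rule D_line_deriv)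
    then have "((\<lambda>z. b * D (B *v (y + z *s axis i 1))) has_field_derivative b * (\<Sum>k\<in>UNIV. B $ k $ i * d (B *v y) $ k)) (at 0)"
      unfolding col by (intro DERIV_cmult) (simp add: column_def mult.commute)
    then show ?thesis unfolding cpartial_def by (rule DERIV_imp_deriv)
  qed
  then show ?thesis by (simp add: vec_eq_iff matrix_vector_mult_def transpose_def del: transpose_matrix_vector)
qed

lemma change_coords_cometric:
  assumes A: "invertible A"
  shows "cometric (change_coords A G) (\<lambda>y. A *v L (matrix_inv A *v y))"
    "det (change_coords A G y) = det A ^ 2 * D (matrix_inv A *v y)"
proof -
  define B where "B = matrix_inv A"
  define G' where "G' = change_coords A G"
  define b where "b = det A ^ 2"
  have detA: "det A \<noteq> 0" using A invertible_det_nz by blast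
  then have b: "b \<noteq> 0" by (simp add: b_def)
  have AB: "A ** B = mat 1" "B ** A = mat 1" unfolding B_def by (rule matrix_inv_inverse[OF detA])+
  have G': "G' y = A ** G (B *v y) ** transpose A" for y by (simp add: G'_def change_coords_def B_def)
  have D': "det (G' y) = b * D (B *v y)" for y
    by (simp add: G' det_mul det_transpose D_def b_def power2_eq_square)
  then show "det (change_coords A G y) = det A ^ 2 * D (matrix_inv A *v y)" by (simp add: G'_def b_def B_def)
  have d': "(\<chi> i. cpartial i (\<lambda>y. det (G' y)) y) = b *s (transpose B *v d (B *v y))" for y
    unfolding D' by (rule d_linear_change)
  have BA: "transpose A ** transpose B = mat 1" by (simp add: AB transpose_mat flip: matrix_transpose_mul)
  show "cometric G' (\<lambda>y. A *v L (B *v y))"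
    unfolding G'_def[symmetric] B_def[symmetric]
  proof
    show "G' y $ i $ j = G' y $ j $ i" for y i j
    proof -
      have "transpose (G' y) = G' y" by (simp add: G' matrix_transpose_mul transpose_G matrix_mul_assoc)
      from arg_cong[OF this, of "\<lambda>X. X $ j $ i"] show ?thesis by (simp add: transpose_def)
    qed
    show "polyfun 2 (\<lambda>y. G' y $ i $ j)" for i j
      unfolding G' matrix_matrix_mult_def vec_lambda_beta
      by (intro polyfun_sum, subst mult.commute, intro polyfun_cmult polyfun_sum polyfun_linear polyG)
    show "\<exists>k. polyfun k (\<lambda>y. (A *v L (B *v y)) $ i)" for i
    proof -
      obtain k where k: "\<And>i. polyfun (k i) (\<lambda>x. L x $ i)" using polyL by metis
      have "polyfun (Max (range k)) (\<lambda>x. L x $ i)" for i by (rule polyfun.weaken[OF k]) simp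
      then have "polyfun (Max (range k)) (\<lambda>y. (A *v L (B *v y)) $ i)"
        unfolding matrix_vector_mult_def[of A] vec_lambda_beta by (intro polyfun_sum polyfun_cmult polyfun_linear)
      then show ?thesis by blast
    qed
    show "G' y *v (\<chi> i. cpartial i (\<lambda>x. det (G' x)) y) = det (G' y) *s (A *v L (B *v y))" for y
    proof -
      have "G' y *v (transpose B *v d (B *v y)) = (A ** G (B *v y) ** (transpose A ** transpose B)) *v d (B *v y)"
        by (simp only: G' matrix_vector_mul_assoc matrix_mul_assoc)
      also have "\<dots> = A *v (G (B *v y) *v d (B *v y))" by (simp add: BA matrix_vector_mul_assoc)
      also have "\<dots> = D (B *v y) *s (A *v L (B *v y))" by (simp add: tangent vector_scalar_commute)
      finally show ?thesis by (subst d', subst D') (simp add: vector_scalar_commute vector_smult_assoc del: transpose_matrix_vector)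
    qed
    from generic obtain x0 c k where gen: "D x0 \<noteq> 0 \<and> polyfun k c \<and> (\<exists>v. c v \<noteq> 0) \<and>
      (\<forall>v. c v \<noteq> 0 \<longrightarrow> (\<forall>z. D (x0 + z *s v) = 0 \<longrightarrow> (\<Sum>i\<in>UNIV. d (x0 + z *s v) $ i * v $ i) \<noteq> 0) \<and>
        (\<exists>l. l \<noteq> 0 \<and> ((\<lambda>z. D (x0 + z *s v) / z ^ (2 * CARD('n))) \<longlongrightarrow> l) at_infinity))"
      by (elim exE)
    note g = gen[THEN conjunct1] gen[THEN conjunct2, THEN conjunct1] gen[THEN conjunct2, THEN conjunct2, THEN conjunct1]
    note ok = gen[THEN conjunct2, THEN conjunct2, THEN conjunct2]
    have Bl: "B *v (A *v x0 + z *s v) = x0 + z *s (B *v v)" for z v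
      by (simp add: matrix_vector_right_distrib vector_scalar_commute matrix_vector_mul_assoc AB)
    show "\<exists>x0 c k. det (G' x0) \<noteq> 0 \<and> polyfun k c \<and> (\<exists>v. c v \<noteq> 0) \<and>
      (\<forall>v. c v \<noteq> 0 \<longrightarrow> (\<forall>z. det (G' (x0 + z *s v)) = 0 \<longrightarrow>
          (\<Sum>i\<in>UNIV. (\<chi> i. cpartial i (\<lambda>x. det (G' x)) (x0 + z *s v)) $ i * v $ i) \<noteq> 0) \<and>
        (\<exists>l. l \<noteq> 0 \<and> ((\<lambda>z. det (G' (x0 + z *s v)) / z ^ (2 * CARD('n))) \<longlongrightarrow> l) at_infinity))"
    proof (rule exI[of _ "A *v x0"], rule exI[of _ "\<lambda>v. c (B *v v)"], rule exI[of _ k], intro conjI allI impI)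
      show "det (G' (A *v x0)) \<noteq> 0" using g b by (simp add: D' matrix_vector_mul_assoc AB)
      show "polyfun k (\<lambda>v. c (B *v v))" by (rule polyfun_linear[OF g(2)])
      show "\<exists>v. c (B *v v) \<noteq> 0"
      proof -
        obtain v where "c v \<noteq> 0" using g by blast
        then have "c (B *v (A *v v)) \<noteq> 0" by (simp add: matrix_vector_mul_assoc AB)
        then show ?thesis by blast
      qed
      fix v assume v: "c (B *v v) \<noteq> 0"
      show "\<exists>l. l \<noteq> 0 \<and> ((\<lambda>z. det (G' (A *v x0 + z *s v)) / z ^ (2 * CARD('n))) \<longlongrightarrow> l) at_infinity"
      proof -
        obtain l where l: "l \<noteq> 0" "((\<lambda>z. D (x0 + z *s (B *v v)) / z ^ (2 * CARD('n))) \<longlongrightarrow> l) at_infinity"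
          using ok v by blast
        have "((\<lambda>z. b * (D (x0 + z *s (B *v v)) / z ^ (2 * CARD('n)))) \<longlongrightarrow> b * l) at_infinity"
          by (rule tendsto_mult_left[OF l(2)])
        then show ?thesis unfolding D' Bl using b l(1) by (intro exI[of _ "b * l"]) simp
      qed
      fix z assume "det (G' (A *v x0 + z *s v)) = 0"
      then have "D (x0 + z *s (B *v v)) = 0" using b by (simp add: D' Bl)
      with ok v have "(\<Sum>k\<in>UNIV. d (x0 + z *s (B *v v)) $ k * (B *v v) $ k) \<noteq> 0" by blast
      moreover have "(\<Sum>i\<in>UNIV. (\<chi> i. cpartial i (\<lambda>x. det (G' x)) (A *v x0 + z *s v)) $ i * v $ i) =
         b * (\<Sum>k\<in>UNIV. d (x0 + z *s (B *v v)) $ k * (B *v v) $ k)"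
      proof -
        have "(\<Sum>i\<in>UNIV. (transpose B *v e) $ i * v $ i) = (\<Sum>k\<in>UNIV. e $ k * (B *v v) $ k)" for e :: "complex ^ 'n"
          unfolding matrix_vector_mult_def transpose_def vec_lambda_beta sum_distrib_left sum_distrib_right
          by (subst sum.swap) (simp add: mult_ac)
        then show ?thesis unfolding d' Bl by (simp add: mult.assoc del: transpose_matrix_vector flip: sum_distrib_left)
      qed
      ultimately show "(\<Sum>i\<in>UNIV. (\<chi> i. cpartial i (\<lambda>x. det (G' x)) (A *v x0 + z *s v)) $ i * v $ i) \<noteq> 0"
        using b by simp
    qed
  qed
qed

text \<open>
  The rows of \<open>A\<close> are boundary gradients, which become the coordinate covectors in the new
  coordinates, up to a scalar.
\<close>

theorem einstein_decomposition:
  "\<exists>(A :: complex ^ 'n ^ 'n) P. invertible A \<and> direct_sum_wrt P (change_coords A G) \<and>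
     (\<forall>I\<in>P. \<exists>c. einstein_metric I (change_coords A G) c)"
proof -
  obtain A :: "complex ^ 'n ^ 'n" where A: "invertible A" and rows: "\<And>i. \<exists>q. D q = 0 \<and> d q \<noteq> 0 \<and> row i A = d q"
    using boundary_gradient_basis by blast
  have detA: "det A \<noteq> 0" using A invertible_det_nz by blast
  define B where "B = matrix_inv A"
  have AB: "A ** B = mat 1" "B ** A = mat 1" unfolding B_def by (rule matrix_inv_inverse[OF detA])+
  have D': "det (change_coords A G y) = det A ^ 2 * D (B *v y)" for y
    using change_coords_cometric(2)[OF A] by (simp add: B_def)
  have "\<exists>q c. det (change_coords A G q) = 0 \<and> c \<noteq> 0 \<and> (\<chi> i. cpartial i (\<lambda>x. det (change_coords A G x)) q) = c *s axis i 1" for i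
  proof -
    obtain q where q: "D q = 0" "row i A = d q" using rows by blast
    have Bq: "B *v (A *v q) = q" by (simp add: matrix_vector_mul_assoc AB)
    have "transpose B *v (transpose A *v axis i 1) = axis i 1"
      by (simp only: matrix_vector_mul_assoc matrix_transpose_mul[symmetric] AB transpose_mat matrix_vector_mul_lid)
    moreover have "transpose A *v axis i 1 = row i A"
      by (simp only: matrix_mult_axis) (simp add: row_def column_def transpose_def)
    ultimately have "(\<chi> i. cpartial i (\<lambda>x. det (change_coords A G x)) (A *v q)) = det A ^ 2 *s axis i 1"
      unfolding D' d_linear_change Bq q(2) by simp
    moreover have "det (change_coords A G (A *v q)) = 0" by (simp add: D' Bq q)
    ultimately show ?thesis using detA by (intro exI[of _ "A *v q"] exI[of _ "det A ^ 2"]) auto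
  qed
  from cometric.adapted_decomposition[OF change_coords_cometric(1)[OF A] this] A show ?thesis by blast
qed

end

lemma eval_det:
  fixes g :: "('n::finite) cpoly ^ 'n ^ 'n"
  shows "eval_poly (det g) x = det (eval_mat g x)"
  unfolding det_def eval_sum eval_mult ring_hom_simps(7)[OF eval_hom]
proof (rule sum.cong[OF refl])
  fix p :: "'n \<Rightarrow> 'n"
  have "eval_poly (of_int (sign p)) x = of_int (sign p)"
    by (auto simp: sign_def ring_hom_simps(8)[OF eval_hom])
  then show "eval_poly (of_int (sign p)) x * (\<Prod>i\<in>UNIV. eval_poly (g $ i $ p i) x) =
    of_int (sign p) * (\<Prod>i\<in>UNIV. eval_mat g x $ i $ p i)"
    by (simp add: eval_mat_def)
qed

lemma cpartial_eval_poly: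
  fixes p :: "('n::finite) cpoly"
  shows "cpartial i (eval_poly p) x = eval_poly (partial_poly i p) x"
proof -
  let ?mon = "\<lambda>m y. \<Prod>j\<in>UNIV. (y $ j) ^ lookup m (j::'n)"
  have cd: "cdiff (\<lambda>y. y $ j ^ n) x" for j n
    using polyfun_cdiff[OF polyfun_power[OF polyfun.coord]] .
  have pw: "cpartial i (\<lambda>y. y $ j ^ n) x = (if i = j then of_nat n * x $ j ^ (n - 1) else 0)" for j n
  proof (induction n)
    case (Suc n)
    have "cpartial i (\<lambda>y. y $ j * y $ j ^ n) x = cpartial i (\<lambda>y. y $ j) x * x $ j ^ n + x $ j * cpartial i (\<lambda>y. y $ j ^ n) x"
      by (rule cpartial_mult[OF cdiff_coord cd])
    then show ?case unfolding power_Suc Suc.IH cpartial_coord by (cases n) (auto simp: algebra_simps)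
  qed simp
  have mon: "cdiff (?mon m) x" "cpartial i (?mon m) x = of_nat (lookup m i) * ?mon (m - Poly_Mapping.single i 1) x" for m
  proof -
    have P: "cdiff (?mon m) x \<and> cpartial i (?mon m) x = (\<Sum>k\<in>UNIV. cpartial i (\<lambda>y. y $ k ^ lookup m k) x * (\<Prod>j\<in>UNIV - {k}. x $ j ^ lookup m j))"
      by (rule cpartial_prod) (auto intro: cd)
    show "cdiff (?mon m) x" using P by blast
    let ?n = "lookup m i"
    have "cpartial i (?mon m) x = (\<Sum>j\<in>UNIV. if j = i then of_nat ?n * x $ i ^ (?n - 1) * (\<Prod>j\<in>UNIV - {i}. x $ j ^ lookup m j) else 0)"
      unfolding P[THEN conjunct2] pw by (intro sum.cong refl) auto
    also have "\<dots> = of_nat ?n * (x $ i ^ (?n - 1) * (\<Prod>j\<in>UNIV - {i}. x $ j ^ lookup m j))" by simp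
    also have "x $ i ^ (?n - 1) * (\<Prod>j\<in>UNIV - {i}. x $ j ^ lookup m j) = ?mon (m - Poly_Mapping.single i 1) x"
      by (subst prod.remove[of UNIV i]) (auto simp: lookup_minus lookup_single when_def intro!: prod.cong)
    finally show "cpartial i (?mon m) x = of_nat ?n * ?mon (m - Poly_Mapping.single i 1) x" .
  qed
  have "cpartial i (eval_poly p) x = (\<Sum>m\<in>keys p. lookup p m * cpartial i (?mon m) x)"
    unfolding eval_poly_def[abs_def] by (simp add: cpartial_sum cpartial_cmult cdiff_mult mon(1))
  then show ?thesis by (simp add: mon(2) partial_poly_def eval_sum eval_single mult_ac)
qed

theorem theorem2p1:
  fixes g :: "('n::finite) cpoly ^ 'n ^ 'n"
  assumes "\<forall>i j. g $ i $ j = g $ j $ i"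
    and "\<forall>i j. total_degree (g $ i $ j) \<le> 2"
    and "total_degree (det g) = 2 * CARD('n)"
    and "squarefree (det g)"
    and "\<forall>i. det g dvd (\<Sum>j\<in>UNIV. g $ i $ j * partial_poly j (det g))"
  shows "\<exists>(A :: complex ^ 'n ^ 'n) P. invertible A \<and>
           direct_sum_wrt P (change_coords A (eval_mat g)) \<and>
           (\<forall>I\<in>P. \<exists>c. einstein_metric I (change_coords A (eval_mat g)) c)"
proof -
  define Dp where "Dp = det g"
  have D: "det (eval_mat g x) = eval_poly Dp x" for x by (simp add: Dp_def eval_det)
  have "\<exists>l. (\<Sum>j\<in>UNIV. g $ i $ j * partial_poly j Dp) = Dp * l" for i
    using assms(5) unfolding Dp_def dvd_def by blast
  then obtain l where l: "\<And>i. (\<Sum>j\<in>UNIV. g $ i $ j * partial_poly j Dp) = Dp * l i" by metis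
  have Dp0: "Dp \<noteq> 0" using assms(4) by (auto simp: Dp_def)
  obtain x0 where x0: "eval_poly Dp x0 \<noteq> 0" using generic_line Dp0 by blast
  obtain c1 where c1: "c1 \<noteq> 0" "\<And>v. eval_poly c1 v \<noteq> 0 \<Longrightarrow> coprime (along x0 v Dp) (pderiv (along x0 v Dp))"
    using squarefree_generic_line[OF assms(4)[folded Dp_def] x0] by blast
  obtain c2 where c2: "c2 \<noteq> 0" "\<And>v x0. eval_poly c2 v \<noteq> 0 \<Longrightarrow>
      ((\<lambda>t. eval_poly Dp (x0 + t *s v) / t ^ (2 * CARD('n))) \<longlongrightarrow> eval_poly c2 v) at_infinity"
    using generic_leading_term[OF assms(3)[folded Dp_def]] by auto
  have "cometric (eval_mat g) (\<lambda>x. \<chi> i. eval_poly (l i) x)"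
  proof
    show "eval_mat g x $ i $ j = eval_mat g x $ j $ i" for x i j using assms(1) by (simp add: eval_mat_def)
    show "polyfun 2 (\<lambda>x. eval_mat g x $ i $ j)" for i j
      using polyfun_eval[of "g $ i $ j" 2] assms(2) by (simp add: eval_mat_def)
    show "\<exists>k. polyfun k (\<lambda>x. (\<chi> i. eval_poly (l i) x) $ i)" for i
      using polyfun_eval[OF order_refl] by auto
    show "eval_mat g x *v (\<chi> i. cpartial i (\<lambda>x. det (eval_mat g x)) x) = det (eval_mat g x) *s (\<chi> i. eval_poly (l i) x)" for x
      unfolding D cpartial_eval_poly[of _ Dp, unfolded eta_contract_eq]
      using arg_cong[OF l, of "\<lambda>p. eval_poly p x"]
      by (simp add: vec_eq_iff matrix_vector_mult_def eval_sum eval_mat_def cpartial_eval_poly)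
    show "\<exists>x0 c k. det (eval_mat g x0) \<noteq> 0 \<and> polyfun k c \<and> (\<exists>v. c v \<noteq> 0) \<and>
      (\<forall>v. c v \<noteq> 0 \<longrightarrow> (\<forall>z. det (eval_mat g (x0 + z *s v)) = 0 \<longrightarrow>
          (\<Sum>i\<in>UNIV. (\<chi> i. cpartial i (\<lambda>x. det (eval_mat g x)) (x0 + z *s v)) $ i * v $ i) \<noteq> 0) \<and>
        (\<exists>l. l \<noteq> 0 \<and> ((\<lambda>z. det (eval_mat g (x0 + z *s v)) / z ^ (2 * CARD('n))) \<longlongrightarrow> l) at_infinity))"
    proof (rule exI[of _ x0], rule exI[of _ "eval_poly (c1 * c2)"], rule exI[of _ "total_degree (c1 * c2)"], intro conjI allI impI)
      show "det (eval_mat g x0) \<noteq> 0" using x0 by (simp add: D)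
      show "polyfun (total_degree (c1 * c2)) (eval_poly (c1 * c2))" by (rule polyfun_eval) simp
      show "\<exists>v. eval_poly (c1 * c2) v \<noteq> 0"
        using generic_line[OF cpoly_mult_neq_0[OF c1(1) c2(1)]] by blast
      fix v assume "eval_poly (c1 * c2) v \<noteq> 0"
      then have v: "eval_poly c1 v \<noteq> 0" "eval_poly c2 v \<noteq> 0" by auto
      show "\<exists>l. l \<noteq> 0 \<and> ((\<lambda>z. det (eval_mat g (x0 + z *s v)) / z ^ (2 * CARD('n))) \<longlongrightarrow> l) at_infinity"
        using c2(2)[OF v(2)] v(2) unfolding D by blast
      fix z assume "det (eval_mat g (x0 + z *s v)) = 0"
      then have z: "poly (along x0 v Dp) z = 0" by (simp add: D poly_along)
      have "poly (pderiv (along x0 v Dp)) z \<noteq> 0"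
        using c1(2)[OF v(1)] z coprime_poly_0 by blast
      moreover have "((\<lambda>z. eval_poly Dp (x0 + z *s v)) has_field_derivative (\<Sum>i\<in>UNIV. (\<chi> i. cpartial i (eval_poly Dp) (x0 + z *s v)) $ i * v $ i)) (at z)"
        by (rule has_grad_direction[OF cdiffD[OF polyfun_cdiff[OF polyfun_eval[OF order_refl]]]])
      then have "(\<Sum>i\<in>UNIV. (\<chi> i. cpartial i (eval_poly Dp) (x0 + z *s v)) $ i * v $ i) = poly (pderiv (along x0 v Dp)) z"
        using poly_DERIV[of "along x0 v Dp" z] DERIV_unique unfolding poly_along by blast
      ultimately show "(\<Sum>i\<in>UNIV. (\<chi> i. cpartial i (\<lambda>x. det (eval_mat g x)) (x0 + z *s v)) $ i * v $ i) \<noteq> 0"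
        unfolding D by simp
    qed
  qed
  then show ?thesis by (rule cometric.einstein_decomposition)
qed

end
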